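(* Let $X=(V,E)$ be a $\Gamma$-nilpotent covering graph of a finite graph $X_0$ with a $\Gamma$-invariant transition probability $p$ whose induced walk on $X_0$ is irreducible, let $G$ be the associated nilpotent Lie group, and let $\Phi_0:V\to G$ be a modified harmonic realization. Assume (A1) ($G$ is stratified of step $r$) and (A2) (the random walk is centered). Let $\Phi:V\to G$ be a $\Gamma$-equivariant realization of $X$ (not necessarily modified harmonic), and for $n\in\mathbb N$ let $\mathcal P_{n^{-1/2}}:C_\infty(G)\to C_\infty(X)$ be defined by $$\mathcal P_{n^{-1/2}}f(x)=f\big(\tau_{n^{-1/2}}(\Phi(x))\big),\qquad x\in V.$$ Let $t>0$. For every $f\in C_c^\infty(G)$ there is a constant $C=C(G,f,p,\Phi,\Phi_0,t)>0$ such that $$\big\|\mathcal{L}^{[nt]}\mathcal{P}_{n^{-1/2}}f-\mathcal{P}_{n^{-1/2}}e^{t\mathcal{A}(\Phi_0)}f\big\|_\infty\le\frac{C}{n^{1/2}},\qquad n\in\mathbb N,$$ where $\|\cdot\|_\infty$ is the sup-norm over $V$.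
   Context: **Graphs.** In a graph $(V,E)$, $E$ is the set of oriented edges; $o(e),t(e),\overline e$ are the origin, terminus and inverse of $e\in E$, and $E_x=\{e\in E: o(e)=x\}$. $\Gamma$ is a torsion-free finitely generated nilpotent group and $X=(V,E)$ is an infinite connected graph on which $\Gamma$ acts freely by graph automorphisms with finite quotient graph $X_0=\Gamma\backslash X=(V_0,E_0)$; $X$ is called a $\Gamma$-nilpotent covering graph. **Random walk.** $p:E\to[0,1]$ satisfies $\sum_{e\in E_x}p(e)=1$ ($x\in V$), $p(e)+p(\overline e)>0$ and $p(\gamma e)=p(e)$ ($e\in E,\gamma\in\Gamma$). It descends to a transition probability on $X_0$, also denoted $p$, whose random walk is assumed irreducible. $m:V_0\to(0,1]$ is the unique normalized invariant measure: $\sum_{x\in V_0}m(x)=1$ and $\sum_{e\in (E_0)_x}p(\overline e)m(t(e))=m(x)$ for $x\in V_0$. Put $\widetilde m(e)=p(e)m(o(e))$, $e\in E_0$. $\{w_n\}_{n\ge0}$ is the random walk on $X$ with transition probability $p$. **Lie group.** $G=(G,\bullet)$ is the connected, simply connected nilpotent Lie group in which $\Gamma$ is a cocompact lattice, with Lie algebra $\mathfrak g$; $\log:G\to\mathfrak g$ is the inverse of $\exp$. (A1): $G$ is stratified of step $r$: $\mathfrak g=\mathfrak g^{(1)}\oplus\cdots\oplus\mathfrak g^{(r)}$ with $[\mathfrak g^{(k)},\mathfrak g^{(\ell)}]\subset\mathfrak g^{(k+\ell)}$ if $k+\ell\le r$, and $\mathfrak g^{(k)}=[\mathfrak g^{(1)},\mathfrak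 g^{(k-1)}]$ for $k=2,\dots,r$. Let $d_k=\dim\mathfrak g^{(k)}$, and fix a basis $\mathfrak a_1,\dots,\mathfrak a_{d_1+\cdots+d_r}$ of $\mathfrak g$ such that $\mathfrak a_{d_1+\cdots+d_{k-1}+1},\dots,\mathfrak a_{d_1+\cdots+d_k}$ is a basis of $\mathfrak g^{(k)}$. For $v\in\mathfrak g$, $v|_{\mathfrak a_i}$ is its $\mathfrak a_i$-coordinate and $v|_{\mathfrak g^{(1)}}$ its $\mathfrak g^{(1)}$-component. The dilation is $\tau_\varepsilon(\exp(\mathfrak a^{(1)}+\cdots+\mathfrak a^{(r)}))=\exp(\varepsilon\mathfrak a^{(1)}+\cdots+\varepsilon^r\mathfrak a^{(r)})$, $\mathfrak a^{(k)}\in\mathfrak g^{(k)}$. Each $\mathfrak a\in\mathfrak g$ acts as the left invariant vector field $\mathfrak a f(x)=\frac{d}{ds}\big|_{s=0}f(x\bullet\exp(s\mathfrak a))$. $C_\infty(G)$, $C_\infty(X)$ are the spaces of continuous functions on $G$, resp. functions on $V$, vanishing at infinity; $C_c^\infty(G)$ is the space of compactly supported smooth functions. **Realizations.** Let $\gamma_p=\sum_{e\in E_0}\widetilde m(e)e\in H_1(X_0,\mathbb R)$ and let $\rho_{\mathbb R}:H_1(X_0,\mathbb R)\to\Gamma/[\Gamma,\Gamma]\otimes\mathbb R\cong\mathfrak g^{(1)}$ be the surjective linear map induced by the canonical surjection $\pi_1(X_0)\to\Gamma$. A map $\Phi:V\to G$ is a $\Gamma$-equivariant realization if $\Phi(\gamma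 x)=\gamma\bullet\Phi(x)$ for $\gamma\in\Gamma$, $x\in V$; write $d\Phi(e)=\Phi(o(e))^{-1}\bullet\Phi(t(e))$. A $\Gamma$-equivariant realization $\Phi_0$ is modified harmonic if $\sum_{e\in E_x}p(e)\log(d\Phi_0(e))|_{\mathfrak g^{(1)}}=\rho_{\mathbb R}(\gamma_p)$ for all $x\in V$. (A2): the walk is centered: $\lim_{n\to\infty}\frac1n\log(\Phi_0(w_n))|_{\mathfrak g^{(1)}}=0$ a.s.; equivalently $\rho_{\mathbb R}(\gamma_p)=0$. **Generator and semigroup.** With $\widetilde e\in E$ any lift of $e\in E_0$, put $A_{ij}(\Phi_0)=\sum_{e\in E_0}\widetilde m(e)\,\log(d\Phi_0(\widetilde e))|_{\mathfrak a_i}\log(d\Phi_0(\widetilde e))|_{\mathfrak a_j}$ for $1\le i,j\le d_1$ and $\beta_i(\Phi_0)=\sum_{e\in E_0}\widetilde m(e)\log(d\Phi_0(\widetilde e))|_{\mathfrak a_i}$ for $d_1<i\le d_1+d_2$, and $$\mathcal A(\Phi_0)=\frac12\sum_{i,j=1}^{d_1}A_{ij}(\Phi_0)\mathfrak a_i\mathfrak a_j+\sum_{i=d_1+1}^{d_1+d_2}\beta_i(\Phi_0)\mathfrak a_i .$$ $(e^{t\mathcal A(\Phi_0)})_{t\ge0}$ is the $C_0$-semigroup on $C_\infty(G)$ with infinitesimal generator $\mathcal A(\Phi_0)$; explicitly $e^{t\mathcal A(\Phi_0)}f(x)=\int_Gf(x\bullet y)\,\nu^{\Phi_0}_t(dy)$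 where $(\nu^{\Phi_0}_t)_{t\ge0}$ is the convolution semigroup of probability measures on $G$ with generator $\mathcal A(\Phi_0)$. **Operators.** $\mathcal Lf(x)=\sum_{e\in E_x}p(e)f(t(e))$ for $f\in C_\infty(X)$. $[s]$ is the greatest integer $\le s$. *)

theory Defs
  imports
    "HOL-Probability.Probability"
    "HOL-Algebra.Generated_Groups"
    "HOL-Algebra.Group_Action"
    "Graph_Theory.Bidirected_Digraph"
    "Graph_Theory.Digraph_Component"
begin

section \<open>Smooth functions between Euclidean spaces\<close>

primrec Ck :: "nat \<Rightarrow> ('a::euclidean_space \<Rightarrow> 'b::real_normed_vector) \<Rightarrow> bool" where
  "Ck 0 f \<longleftrightarrow> continuous_on UNIV f"
| "Ck (Suc k) f \<longleftrightarrow> (\<forall>x. f differentiable at x) \<and>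
     (\<forall>v. Ck k (\<lambda>x. frechet_derivative f (at x) v))"

definition smooth :: "('a::euclidean_space \<Rightarrow> 'b::real_normed_vector) \<Rightarrow> bool" where
  "smooth f \<longleftrightarrow> (\<forall>k. Ck k f)"


section \<open>Connected, simply connected nilpotent Lie groups\<close>

text \<open>
  A Lie group together with its Lie algebra (the finite-dimensional vector space \<open>'a\<close> with
  \<open>bracket\<close>) and its exponential map.
\<close>

record ('g, 'a) lie_data = "'g monoid" +
  Exp :: "'a \<Rightarrow> 'g"
  bracket :: "'a \<Rightarrow> 'a \<Rightarrow> 'a"

definition Log :: "('g, 'a) lie_data \<Rightarrow> 'g \<Rightarrow> 'a" where
  "Log G = inv_into UNIV (Exp G)"

definition vector_field ::
  "('g, 'a::real_vector) lie_data \<Rightarrow> 'a \<Rightarrow> ('g \<Rightarrow> real) \<Rightarrow> 'g \<Rightarrow> real" where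
  "vector_field G a f x = deriv (\<lambda>s. f (x \<otimes>\<^bsub>G\<^esub> Exp G (s *\<^sub>R a))) 0"

definition smooth_on_group :: "('g, 'a::euclidean_space) lie_data \<Rightarrow> ('g \<Rightarrow> real) \<Rightarrow> bool" where
  "smooth_on_group G f \<longleftrightarrow> smooth (\<lambda>a. f (Exp G a))"

primrec lie_lower_central :: "('g, 'a::real_vector) lie_data \<Rightarrow> nat \<Rightarrow> 'a set" where
  "lie_lower_central G 0 = UNIV"
| "lie_lower_central G (Suc k) = span {bracket G a b | a b. b \<in> lie_lower_central G k}"

text \<open>
  For a connected, simply connected nilpotent Lie group the exponential map is a diffeomorphism
  from the Lie algebra onto the group. So the smooth structure is the one given by the single
  global chart \<open>Log G\<close>, and conversely a nilpotent Lie group with such a global chart is connected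
  and simply connected. \<open>Exp\<close> is the exponential map since \<open>s \<mapsto> exp (s a)\<close> is the
  one-parameter subgroup whose velocity at \<open>s = 0\<close> is \<open>a\<close> (in the chart \<open>Log G\<close>), and
  \<open>bracket\<close> is the Lie bracket of left invariant vector fields.
\<close>

locale simply_connected_nilpotent_lie_group =
  group G for G :: "('g::{t2_space,second_countable_topology}, 'a::euclidean_space) lie_data" (structure) +
  assumes carrier_UNIV: "carrier G = UNIV"
    and Exp_homeomorphism: "homeomorphism UNIV UNIV (Exp G) (Log G)"
    and smooth_mult: "smooth (\<lambda>(a, b). Log G (Exp G a \<otimes> Exp G b))"
    and smooth_inv: "smooth (\<lambda>a. Log G (inv\<^bsub>G\<^esub> (Exp G a)))"
    and one_parameter_subgroup: "Exp G ((s + t) *\<^sub>R a) = Exp G (s *\<^sub>R a) \<otimes> Exp G (t *\<^sub>R a)"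
    and bracket_bilinear: "bilinear (bracket G)"
    and bracket_alternating: "bracket G a a = 0"
    and bracket_jacobi: "bracket G a (bracket G b c) + bracket G b (bracket G c a)
      + bracket G c (bracket G a b) = 0"
    and bracket_vector_fields: "smooth_on_group G f \<Longrightarrow>
      vector_field G (bracket G a b) f x =
        vector_field G a (vector_field G b f) x - vector_field G b (vector_field G a f) x"
    and nilpotent: "\<exists>k. lie_lower_central G k = {0}"

text \<open>
  Layers are indexed by \<open>1, \<dots>, r\<close>; setting the layers beyond \<open>r\<close> to \<open>{0}\<close> makes the inclusion
  \<open>[g k, g l] \<subseteq> g (k + l)\<close> cover the case \<open>k + l > r\<close>, where the bracket of a
  group of step \<open>r\<close> vanishes.
\<close>

definition stratification ::
  "('g, 'a::euclidean_space) lie_data \<Rightarrow> nat \<Rightarrow> (nat \<Rightarrow> 'a set) \<Rightarrow> bool" where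
  "stratification G r g \<longleftrightarrow>
     1 \<le> r \<and> g r \<noteq> {0} \<and>
     (\<forall>k\<in>{1..r}. subspace (g k)) \<and> (\<forall>k>r. g k = {0}) \<and>
     (\<forall>v. \<exists>!u. u \<in> (\<Pi>\<^sub>E k\<in>{1..r}. g k) \<and> v = (\<Sum>k=1..r. u k)) \<and>
     (\<forall>k\<ge>1. \<forall>l\<ge>1. \<forall>a\<in>g k. \<forall>b\<in>g l. bracket G a b \<in> g (k + l)) \<and>
     (\<forall>k\<in>{2..r}. g k = span {bracket G a b | a b. a \<in> g 1 \<and> b \<in> g (k - 1)})"

definition layer_component :: "nat \<Rightarrow> (nat \<Rightarrow> 'a::real_vector set) \<Rightarrow> nat \<Rightarrow> 'a \<Rightarrow> 'a" where
  "layer_component r g k v =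
     (THE u. u \<in> (\<Pi>\<^sub>E j\<in>{1..r}. g j) \<and> v = (\<Sum>j=1..r. u j)) k"

definition dims_upto :: "(nat \<Rightarrow> 'a::euclidean_space set) \<Rightarrow> nat \<Rightarrow> nat" where
  "dims_upto g k = (\<Sum>j=1..k. dim (g j))"

definition adapted_basis :: "nat \<Rightarrow> (nat \<Rightarrow> 'a::euclidean_space set) \<Rightarrow> (nat \<Rightarrow> 'a) \<Rightarrow> bool" where
  "adapted_basis r g \<aa> \<longleftrightarrow>
     inj_on \<aa> {1..dims_upto g r} \<and>
     (\<forall>k\<in>{1..r}. independent (\<aa> ` {dims_upto g (k - 1) + 1..dims_upto g k}) \<and>
        span (\<aa> ` {dims_upto g (k - 1) + 1..dims_upto g k}) = g k)"

definition coord ::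
  "nat \<Rightarrow> (nat \<Rightarrow> 'a::euclidean_space set) \<Rightarrow> (nat \<Rightarrow> 'a) \<Rightarrow> nat \<Rightarrow> 'a \<Rightarrow> real" where
  "coord r g \<aa> i v = representation (\<aa> ` {1..dims_upto g r}) v (\<aa> i)"

definition dilation ::
  "('g, 'a::real_vector) lie_data \<Rightarrow> nat \<Rightarrow> (nat \<Rightarrow> 'a set) \<Rightarrow> real \<Rightarrow> 'g \<Rightarrow> 'g" where
  "dilation G r g \<epsilon> x = Exp G (\<Sum>k=1..r. \<epsilon> ^ k *\<^sub>R layer_component r g k (Log G x))"

definition C_vanishing :: "('g::topological_space \<Rightarrow> real) set" where
  "C_vanishing = {f. continuous_on UNIV f \<and>
     (\<forall>\<epsilon>>0. \<exists>K. compact K \<and> (\<forall>x. x \<notin> K \<longrightarrow> \<bar>f x\<bar> < \<epsilon>))}"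

definition test_functions ::
  "('g::topological_space, 'a::euclidean_space) lie_data \<Rightarrow> ('g \<Rightarrow> real) set" where
  "test_functions G =
     {f. smooth_on_group G f \<and> (\<exists>K. compact K \<and> (\<forall>x. x \<notin> K \<longrightarrow> f x = 0))}"


section \<open>Convolution semigroups\<close>

definition convolution_semigroup ::
  "('g::topological_space, 'b) monoid_scheme \<Rightarrow> (real \<Rightarrow> 'g measure) \<Rightarrow> bool" where
  "convolution_semigroup G \<nu> \<longleftrightarrow>
     (\<forall>t\<ge>0. prob_space (\<nu> t) \<and> sets (\<nu> t) = sets borel) \<and>
     \<nu> 0 = return borel \<one>\<^bsub>G\<^esub> \<and>
     (\<forall>s\<ge>0. \<forall>t\<ge>0. \<nu> (s + t) = distr (\<nu> s \<Otimes>\<^sub>M \<nu> t) borel (\<lambda>(x, y). x \<otimes>\<^bsub>G\<^esub> y)) \<and>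
     (\<forall>f\<in>C_vanishing. ((\<lambda>t. LINT x|\<nu> t. f x) \<longlongrightarrow> f \<one>\<^bsub>G\<^esub>) (at_right 0))"

definition heat_semigroup ::
  "('g::topological_space, 'b) monoid_scheme \<Rightarrow> (real \<Rightarrow> 'g measure) \<Rightarrow> real \<Rightarrow> ('g \<Rightarrow> real) \<Rightarrow> 'g \<Rightarrow> real" where
  "heat_semigroup G \<nu> t f x = (LINT y|\<nu> t. f (x \<otimes>\<^bsub>G\<^esub> y))"

text \<open>
  The infinitesimal generator is the differential operator \<open>A\<close> on the compactly supported smooth
  functions (by a theorem of Hunt this determines the convolution semigroup).
\<close>

definition has_generator ::
  "('g::topological_space, 'a::euclidean_space) lie_data \<Rightarrow> (real \<Rightarrow> 'g measure) \<Rightarrow>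
     (('g \<Rightarrow> real) \<Rightarrow> 'g \<Rightarrow> real) \<Rightarrow> bool" where
  "has_generator G \<nu> A \<longleftrightarrow> (\<forall>f\<in>test_functions G.
     uniform_limit UNIV (\<lambda>t x. (heat_semigroup G \<nu> t f x - f x) / t) (A f) (at_right 0))"


section \<open>Nilpotent covering graphs\<close>

primrec lower_central :: "('g, 'b) monoid_scheme \<Rightarrow> nat \<Rightarrow> 'g set" where
  "lower_central H 0 = carrier H"
| "lower_central H (Suc k) = generate H
     {x \<otimes>\<^bsub>H\<^esub> y \<otimes>\<^bsub>H\<^esub> inv\<^bsub>H\<^esub> x \<otimes>\<^bsub>H\<^esub> inv\<^bsub>H\<^esub> y | x y. x \<in> carrier H \<and> y \<in> lower_central H k}"

definition nilpotent_group :: "('g, 'b) monoid_scheme \<Rightarrow> bool" where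
  "nilpotent_group H \<longleftrightarrow> group H \<and> (\<exists>k. lower_central H k = {\<one>\<^bsub>H\<^esub>})"

definition torsion_free :: "('g, 'b) monoid_scheme \<Rightarrow> bool" where
  "torsion_free H \<longleftrightarrow> (\<forall>x\<in>carrier H. \<forall>n::nat. 0 < n \<and> x [^]\<^bsub>H\<^esub> n = \<one>\<^bsub>H\<^esub> \<longrightarrow> x = \<one>\<^bsub>H\<^esub>)"

definition finitely_generated :: "('g, 'b) monoid_scheme \<Rightarrow> bool" where
  "finitely_generated H \<longleftrightarrow> (\<exists>S. finite S \<and> S \<subseteq> carrier H \<and> generate H S = carrier H)"

definition cocompact_lattice ::
  "'g set \<Rightarrow> ('g::topological_space, 'b) monoid_scheme \<Rightarrow> bool" where
  "cocompact_lattice \<Gamma> G \<longleftrightarrow> subgroup \<Gamma> G \<and> topological_space_class.discrete \<Gamma> \<and>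
     (\<exists>K. compact K \<and> \<Gamma> <#>\<^bsub>G\<^esub> K = carrier G)"

text \<open>
  Graphs are bidirected multigraphs: \<open>tail X e\<close> is the origin, \<open>head X e\<close> the terminus and
  \<open>rv e\<close> the inverse of the oriented edge \<open>e\<close>. The group \<open>H\<close> acts on vertices by \<open>\<phi>\<close> and on
  oriented edges by \<open>\<psi>\<close>.
\<close>

locale free_graph_action =
  bidirected_digraph X rv + V: group_action H "verts X" \<phi> + E: group_action H "arcs X" \<psi>
  for X :: "('v, 'e) pre_digraph" and rv :: "'e \<Rightarrow> 'e"
    and H :: "('g, 'b) monoid_scheme" and \<phi> :: "'g \<Rightarrow> 'v \<Rightarrow> 'v" and \<psi> :: "'g \<Rightarrow> 'e \<Rightarrow> 'e" +
  assumes tail_action: "\<gamma> \<in> carrier H \<Longrightarrow> e \<in> arcs X \<Longrightarrow> tail X (\<psi> \<gamma> e) = \<phi> \<gamma> (tail X e)"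
    and head_action: "\<gamma> \<in> carrier H \<Longrightarrow> e \<in> arcs X \<Longrightarrow> head X (\<psi> \<gamma> e) = \<phi> \<gamma> (head X e)"
    and rev_action: "\<gamma> \<in> carrier H \<Longrightarrow> e \<in> arcs X \<Longrightarrow> rv (\<psi> \<gamma> e) = \<psi> \<gamma> (rv e)"
    and free: "\<gamma> \<in> carrier H \<Longrightarrow> x \<in> verts X \<Longrightarrow> \<phi> \<gamma> x = x \<Longrightarrow> \<gamma> = \<one>\<^bsub>H\<^esub>"

text \<open>
  Vertices and edges of the quotient graph are orbits. The image under \<open>tail X\<close> of the orbit of an
  edge is the orbit of its origin; similarly for \<open>head X\<close>, and the inverse of \<open>e\<close> is \<open>rv ` e\<close>.
\<close>

definition quotient_graph ::
  "('v, 'e) pre_digraph \<Rightarrow> ('g, 'b) monoid_scheme \<Rightarrow> ('g \<Rightarrow> 'v \<Rightarrow> 'v) \<Rightarrow> ('g \<Rightarrow> 'e \<Rightarrow> 'e) \<Rightarrow>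
     ('v set, 'e set) pre_digraph" where
  "quotient_graph X H \<phi> \<psi> =
     \<lparr> verts = orbits H (verts X) \<phi>, arcs = orbits H (arcs X) \<psi>,
       tail = (\<lambda>e. tail X ` e), head = (\<lambda>e. head X ` e) \<rparr>"

text \<open>The group \<open>\<Gamma>\<close> is identified with its image in \<open>G\<close>, as a lattice.\<close>

locale nilpotent_covering_graph =
  simply_connected_nilpotent_lie_group G +
  free_graph_action X rv "G\<lparr>carrier := \<Gamma>\<rparr>" \<phi> \<psi>
  for G :: "('g::{t2_space,second_countable_topology}, 'a::euclidean_space) lie_data" (structure)
    and \<Gamma> :: "'g set"
    and X :: "('v, 'e) pre_digraph" and rv :: "'e \<Rightarrow> 'e"
    and \<phi> :: "'g \<Rightarrow> 'v \<Rightarrow> 'v" and \<psi> :: "'g \<Rightarrow> 'e \<Rightarrow> 'e" +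
  assumes lattice: "cocompact_lattice \<Gamma> G"
    and torsion_free: "torsion_free (G\<lparr>carrier := \<Gamma>\<rparr>)"
    and finitely_generated: "finitely_generated (G\<lparr>carrier := \<Gamma>\<rparr>)"
    and nilpotent_group: "nilpotent_group (G\<lparr>carrier := \<Gamma>\<rparr>)"
    and infinite_graph: "infinite (verts X)"
    and connected_graph: "Digraph_Component.connected X"
    and finite_quotient: "finite (verts (quotient_graph X (G\<lparr>carrier := \<Gamma>\<rparr>) \<phi> \<psi>))"
      "finite (arcs (quotient_graph X (G\<lparr>carrier := \<Gamma>\<rparr>) \<phi> \<psi>))"

definition equivariant_realization ::
  "('g, 'b) monoid_scheme \<Rightarrow> 'g set \<Rightarrow> ('v, 'e) pre_digraph \<Rightarrow> ('g \<Rightarrow> 'v \<Rightarrow> 'v) \<Rightarrow> ('v \<Rightarrow> 'g) \<Rightarrow> bool" where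
  "equivariant_realization G \<Gamma> X \<phi> \<Phi> \<longleftrightarrow>
     (\<forall>\<gamma>\<in>\<Gamma>. \<forall>x\<in>verts X. \<Phi> (\<phi> \<gamma> x) = \<gamma> \<otimes>\<^bsub>G\<^esub> \<Phi> x)"

definition edge_increment ::
  "('g, 'b) monoid_scheme \<Rightarrow> ('v, 'e) pre_digraph \<Rightarrow> ('v \<Rightarrow> 'g) \<Rightarrow> 'e \<Rightarrow> 'g" where
  "edge_increment G X \<Phi> e = inv\<^bsub>G\<^esub> (\<Phi> (tail X e)) \<otimes>\<^bsub>G\<^esub> \<Phi> (head X e)"

text \<open>An arbitrary element of an orbit; invariant functions descend to the quotient through it.\<close>

definition lift :: "'c set \<Rightarrow> 'c" where
  "lift A = (SOME a. a \<in> A)"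


section \<open>Random walks\<close>

locale invariant_transition_probability =
  free_graph_action X rv H \<phi> \<psi>
  for X :: "('v, 'e) pre_digraph" and rv :: "'e \<Rightarrow> 'e"
    and H :: "('g, 'b) monoid_scheme" and \<phi> :: "'g \<Rightarrow> 'v \<Rightarrow> 'v" and \<psi> :: "'g \<Rightarrow> 'e \<Rightarrow> 'e" +
  fixes p :: "'e \<Rightarrow> real"
  assumes p_range: "e \<in> arcs X \<Longrightarrow> p e \<in> {0..1}"
    and p_sum: "x \<in> verts X \<Longrightarrow> (\<Sum>e\<in>out_arcs X x. p e) = 1"
    and p_pos: "e \<in> arcs X \<Longrightarrow> p e + p (rv e) > 0"
    and p_invariant: "\<gamma> \<in> carrier H \<Longrightarrow> e \<in> arcs X \<Longrightarrow> p (\<psi> \<gamma> e) = p e"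

definition irreducible_walk :: "('v, 'e) pre_digraph \<Rightarrow> ('e \<Rightarrow> real) \<Rightarrow> bool" where
  "irreducible_walk X p \<longleftrightarrow> strongly_connected (X\<lparr>arcs := {e \<in> arcs X. 0 < p e}\<rparr>)"

definition invariant_measure ::
  "('v, 'e) pre_digraph \<Rightarrow> ('e \<Rightarrow> 'e) \<Rightarrow> ('e \<Rightarrow> real) \<Rightarrow> ('v \<Rightarrow> real) \<Rightarrow> bool" where
  "invariant_measure X rv p m \<longleftrightarrow>
     (\<forall>x\<in>verts X. m x \<in> {0<..1}) \<and> (\<Sum>x\<in>verts X. m x) = 1 \<and>
     (\<forall>x\<in>verts X. (\<Sum>e\<in>out_arcs X x. p (rv e) * m (head X e)) = m x)"

definition edge_measure ::
  "('v, 'e) pre_digraph \<Rightarrow> ('e \<Rightarrow> real) \<Rightarrow> ('v \<Rightarrow> real) \<Rightarrow> 'e \<Rightarrow> real" where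
  "edge_measure X p m e = p e * m (tail X e)"

definition transition_operator ::
  "('v, 'e) pre_digraph \<Rightarrow> ('e \<Rightarrow> real) \<Rightarrow> ('v \<Rightarrow> real) \<Rightarrow> 'v \<Rightarrow> real" where
  "transition_operator X p f x = (\<Sum>e\<in>out_arcs X x. p e * f (head X e))"

text \<open>\<open>w\<close> is the Markov chain on the vertices with transition probability \<open>p\<close> started at \<open>x0\<close>.\<close>

definition random_walk ::
  "('v, 'e) pre_digraph \<Rightarrow> ('e \<Rightarrow> real) \<Rightarrow> 'v \<Rightarrow> 'w measure \<Rightarrow> (nat \<Rightarrow> 'w \<Rightarrow> 'v) \<Rightarrow> bool" where
  "random_walk X p x0 M w \<longleftrightarrow>
     prob_space M \<and> x0 \<in> verts X \<and>
     (\<forall>n. w n \<in> measurable M (count_space (verts X))) \<and>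
     (AE \<omega> in M. w 0 \<omega> = x0) \<and>
     (\<forall>n. \<forall>y. (\<forall>i\<le>Suc n. y i \<in> verts X) \<longrightarrow>
        measure M {\<omega>\<in>space M. \<forall>i\<le>Suc n. w i \<omega> = y i} =
        measure M {\<omega>\<in>space M. \<forall>i\<le>n. w i \<omega> = y i} *
          (\<Sum>e\<in>{e \<in> out_arcs X (y n). head X e = y (Suc n)}. p e))"


section \<open>Homology and modified harmonic realizations\<close>

text \<open>
  Real 1-chains modulo \<open>rv e = - e\<close> are represented by antisymmetric functions on the oriented
  edges: the oriented edge \<open>e\<close> is the function with value \<open>1\<close> at \<open>e\<close>, \<open>-1\<close> at \<open>rv e\<close>, and \<open>0\<close>
  elsewhere. A graph has no 2-chains, so the first homology group is the space of cycles.
\<close>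

definition edge_chain :: "('e \<Rightarrow> 'e) \<Rightarrow> 'e \<Rightarrow> 'e \<Rightarrow> real" where
  "edge_chain rv e = (\<lambda>e'. of_bool (e' = e) - of_bool (e' = rv e))"

definition path_chain :: "('e \<Rightarrow> 'e) \<Rightarrow> 'e list \<Rightarrow> 'e \<Rightarrow> real" where
  "path_chain rv es = (\<lambda>e'. \<Sum>e\<leftarrow>es. edge_chain rv e e')"

definition homology1 :: "('v, 'e) pre_digraph \<Rightarrow> ('e \<Rightarrow> 'e) \<Rightarrow> ('e \<Rightarrow> real) set" where
  "homology1 X rv = {c. (\<forall>e. e \<notin> arcs X \<longrightarrow> c e = 0) \<and> (\<forall>e\<in>arcs X. c (rv e) = - c e) \<and>
     (\<forall>x\<in>verts X. (\<Sum>e\<in>in_arcs X x. c e) = (\<Sum>e\<in>out_arcs X x. c e))}"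

definition homological_direction ::
  "('v, 'e) pre_digraph \<Rightarrow> ('e \<Rightarrow> 'e) \<Rightarrow> ('e \<Rightarrow> real) \<Rightarrow> ('v \<Rightarrow> real) \<Rightarrow> 'e \<Rightarrow> real" where
  "homological_direction X rv p m =
     (\<lambda>e'. \<Sum>e\<in>arcs X. edge_measure X p m e * edge_chain rv e e')"

text \<open>
  The linear map on the homology of the quotient graph induced by the surjection from its fundamental
  group to \<open>\<Gamma>\<close>. A closed path in the quotient lifts to a path from some \<open>x\<close> to \<open>\<gamma> x\<close>, and its class
  is sent to \<open>\<gamma>\<close>. The identification of the real abelianization of \<open>\<Gamma>\<close> with the first layer sends the
  class of \<open>\<gamma>\<close> to the first-layer component of \<open>log \<gamma>\<close>. Linearity and these values determine \<open>\<rho>\<close>.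
\<close>

definition induced_homology_map ::
  "('g, 'a::euclidean_space) lie_data \<Rightarrow> 'g set \<Rightarrow> nat \<Rightarrow> (nat \<Rightarrow> 'a set) \<Rightarrow>
     ('v, 'e) pre_digraph \<Rightarrow> ('e \<Rightarrow> 'e) \<Rightarrow> ('g \<Rightarrow> 'v \<Rightarrow> 'v) \<Rightarrow> ('g \<Rightarrow> 'e \<Rightarrow> 'e) \<Rightarrow>
     (('e set \<Rightarrow> real) \<Rightarrow> 'a) \<Rightarrow> bool" where
  "induced_homology_map G \<Gamma> r g X rv \<phi> \<psi> \<rho> \<longleftrightarrow>
     (let H = G\<lparr>carrier := \<Gamma>\<rparr>; Z = homology1 (quotient_graph X H \<phi> \<psi>) ((`) rv) in
       (\<forall>c\<in>Z. \<forall>d\<in>Z. \<forall>s t. \<rho> (\<lambda>e. s * c e + t * d e) = s *\<^sub>R \<rho> c + t *\<^sub>R \<rho> d) \<and>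
       (\<forall>x\<in>verts X. \<forall>\<gamma>\<in>\<Gamma>. \<forall>es. pre_digraph.awalk X x es (\<phi> \<gamma> x) \<longrightarrow>
          \<rho> (path_chain ((`) rv) (map (Group_Action.orbit H \<psi>) es)) = layer_component r g 1 (Log G \<gamma>)))"

definition modified_harmonic ::
  "('g, 'a::euclidean_space) lie_data \<Rightarrow> 'g set \<Rightarrow> nat \<Rightarrow> (nat \<Rightarrow> 'a set) \<Rightarrow>
     ('v, 'e) pre_digraph \<Rightarrow> ('e \<Rightarrow> 'e) \<Rightarrow> ('g \<Rightarrow> 'v \<Rightarrow> 'v) \<Rightarrow> ('g \<Rightarrow> 'e \<Rightarrow> 'e) \<Rightarrow>
     ('e \<Rightarrow> real) \<Rightarrow> ('v set \<Rightarrow> real) \<Rightarrow> (('e set \<Rightarrow> real) \<Rightarrow> 'a) \<Rightarrow> ('v \<Rightarrow> 'g) \<Rightarrow> bool" where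
  "modified_harmonic G \<Gamma> r g X rv \<phi> \<psi> p m \<rho> \<Phi> \<longleftrightarrow>
     equivariant_realization G \<Gamma> X \<phi> \<Phi> \<and>
     (\<forall>x\<in>verts X.
        (\<Sum>e\<in>out_arcs X x. p e *\<^sub>R layer_component r g 1 (Log G (edge_increment G X \<Phi> e))) =
        \<rho> (homological_direction (quotient_graph X (G\<lparr>carrier := \<Gamma>\<rparr>) \<phi> \<psi>) ((`) rv) (p \<circ> lift) m))"


section \<open>The limiting generator and the approximation operators\<close>

text \<open>
  In the coefficients, \<open>X0\<close> is the quotient graph, \<open>p0\<close> and \<open>m\<close> are the transition probability and
  the invariant measure on it.
\<close>

definition diffusion_coefficient ::
  "('g, 'a::euclidean_space) lie_data \<Rightarrow> nat \<Rightarrow> (nat \<Rightarrow> 'a set) \<Rightarrow> (nat \<Rightarrow> 'a) \<Rightarrow>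
     ('v, 'e) pre_digraph \<Rightarrow> ('v set, 'e set) pre_digraph \<Rightarrow> ('e set \<Rightarrow> real) \<Rightarrow> ('v set \<Rightarrow> real) \<Rightarrow>
     ('v \<Rightarrow> 'g) \<Rightarrow> nat \<Rightarrow> nat \<Rightarrow> real" where
  "diffusion_coefficient G r g \<aa> X X0 p0 m \<Phi> i j =
     (\<Sum>e\<in>arcs X0. edge_measure X0 p0 m e *
        coord r g \<aa> i (Log G (edge_increment G X \<Phi> (lift e))) *
        coord r g \<aa> j (Log G (edge_increment G X \<Phi> (lift e))))"

definition drift_coefficient ::
  "('g, 'a::euclidean_space) lie_data \<Rightarrow> nat \<Rightarrow> (nat \<Rightarrow> 'a set) \<Rightarrow> (nat \<Rightarrow> 'a) \<Rightarrow>
     ('v, 'e) pre_digraph \<Rightarrow> ('v set, 'e set) pre_digraph \<Rightarrow> ('e set \<Rightarrow> real) \<Rightarrow> ('v set \<Rightarrow> real) \<Rightarrow>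
     ('v \<Rightarrow> 'g) \<Rightarrow> nat \<Rightarrow> real" where
  "drift_coefficient G r g \<aa> X X0 p0 m \<Phi> i =
     (\<Sum>e\<in>arcs X0. edge_measure X0 p0 m e *
        coord r g \<aa> i (Log G (edge_increment G X \<Phi> (lift e))))"

definition limit_generator ::
  "('g, 'a::euclidean_space) lie_data \<Rightarrow> 'g set \<Rightarrow> nat \<Rightarrow> (nat \<Rightarrow> 'a set) \<Rightarrow> (nat \<Rightarrow> 'a) \<Rightarrow>
     ('v, 'e) pre_digraph \<Rightarrow> ('g \<Rightarrow> 'v \<Rightarrow> 'v) \<Rightarrow> ('g \<Rightarrow> 'e \<Rightarrow> 'e) \<Rightarrow>
     ('e \<Rightarrow> real) \<Rightarrow> ('v set \<Rightarrow> real) \<Rightarrow> ('v \<Rightarrow> 'g) \<Rightarrow> ('g \<Rightarrow> real) \<Rightarrow> 'g \<Rightarrow> real" where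
  "limit_generator G \<Gamma> r g \<aa> X \<phi> \<psi> p m \<Phi> f x =
     (let X0 = quotient_graph X (G\<lparr>carrier := \<Gamma>\<rparr>) \<phi> \<psi>; p0 = p \<circ> lift;
          d1 = dims_upto g 1; d2 = dims_upto g 2 in
        1 / 2 * (\<Sum>i=1..d1. \<Sum>j=1..d1. diffusion_coefficient G r g \<aa> X X0 p0 m \<Phi> i j *
            vector_field G (\<aa> i) (vector_field G (\<aa> j) f) x)
        + (\<Sum>i=d1+1..d2. drift_coefficient G r g \<aa> X X0 p0 m \<Phi> i * vector_field G (\<aa> i) f x))"

definition scaling_operator ::
  "('g, 'a::real_vector) lie_data \<Rightarrow> nat \<Rightarrow> (nat \<Rightarrow> 'a set) \<Rightarrow> ('v \<Rightarrow> 'g) \<Rightarrow> real \<Rightarrow>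
     ('g \<Rightarrow> real) \<Rightarrow> 'v \<Rightarrow> real" where
  "scaling_operator G r g \<Phi> \<epsilon> f x = f (dilation G r g \<epsilon> (\<Phi> x))"

text \<open>With values in the extended reals, so that unbounded functions have norm \<open>\<infinity>\<close>.\<close>

definition sup_norm :: "'v set \<Rightarrow> ('v \<Rightarrow> real) \<Rightarrow> ereal" where
  "sup_norm V h = (SUP x\<in>V. ereal \<bar>h x\<bar>)"

end

theory Submission
  imports Defs
begin

text \<open>
  Write \<open>\<epsilon> = n\<^sup>-\<^sup>1\<^sup>/\<^sup>2\<close> and, in logarithmic coordinates, let \<open>F\<^sub>k A u\<close> be the expectation of \<open>f\<close> at \<open>u\<close>
  times the dilated displacement of \<open>k\<close> steps of the walk started over the vertex \<open>A\<close> of the quotient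
  graph. These are finite sums of right translates of \<open>f\<close>, hence test functions. Left invariant
  derivatives of a translate involve the adjoint action of the displacement; as the increments are
  centered, its mean operator size grows by a factor \<open>1 + O(\<epsilon>\<^sup>2)\<close> per step, so all derivatives of
  \<open>F\<^sub>k\<close> stay bounded for \<open>k \<le> t / \<epsilon>\<^sup>2\<close>. The same argument gives \<open>F\<^sub>k\<^sub>+\<^sub>1 - F\<^sub>k = O(\<epsilon>\<^sup>2)\<close>, and irreducibility then
  makes the dependence on \<open>A\<close> of order \<open>\<epsilon>\<^sup>2\<close>. Therefore the averages of \<open>F\<^sub>k\<close> with respect to the
  invariant measure satisfy the Euler scheme of the heat equation up to \<open>O(\<epsilon>\<^sup>3)\<close> per step. The heat
  semigroup enters only through contractivity and its generator on test functions; no moments of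
  \<open>\<nu>\<close> are needed.
\<close>

section \<open>Calculus of smooth maps\<close>

text \<open>A right translation conjugates the directions of left invariant derivatives, and a
  single step changes their norms by a factor 1 + O(\<epsilon>); compounded over t / \<epsilon>^2
  steps this would be exp(O(1 / \<epsilon>)). For each fixed direction the first order change of a
  Euclidean norm is linear in the first layer of the increment, so its mean vanishes by (A2).
  Derivative bounds are therefore weighted by the norms of arbitrary direction lists, and the mean
  is taken before any absolute value. The powers of \<epsilon> are forced: t / \<epsilon>^2 steps of
  error \<epsilon>^3 leave \<epsilon>. Replacing an iterate by its average inside a derivative along
  an increment of size \<epsilon> is affordable because the oscillation is \<epsilon>^2; in the
  recursion the undifferentiated term is not replaced, as stationarity reproduces the average
  exactly. A single vertex sees its own drift and covariance, only the average sees those of the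
  limit. In the exponential chart inversion is negation and dilations are linear. That they are
  automorphisms follows from a linear differential equation instead of the Baker-Campbell-Hausdorff
  formula.\<close>

abbreviation ddir :: "('a::euclidean_space \<Rightarrow> 'b::real_normed_vector) \<Rightarrow> 'a \<Rightarrow> 'a \<Rightarrow> 'b" where
  "ddir f v \<equiv> \<lambda>x. frechet_derivative f (at x) v"

lemma Ck_Suc_imp: "Ck (Suc k) f \<Longrightarrow> Ck k f"
proof (induction k arbitrary: f)
  case 0
  then show ?case
    by (auto simp: continuous_on_eq_continuous_within intro: differentiable_imp_continuous_within)
next
  case (Suc k)
  show ?case unfolding Ck.simps(2)[of k f]
  proof (intro conjI allI)
    show "f differentiable at x" for x using Suc.prems by auto
    show "Ck k (ddir f v)" for v
    proof (rule Suc.IH)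
      show "Ck (Suc k) (ddir f v)" using Suc.prems unfolding Ck.simps(2)[of "Suc k" f] by blast
    qed
  qed
qed

lemma Ck_const: "Ck k (\<lambda>x. c)"
  by (induction k arbitrary: c) auto

lemma frechet_derivative_eq: "(f has_derivative f') (at x) \<Longrightarrow> frechet_derivative f (at x) = f'"
  by (rule frechet_derivative_at[symmetric])

lemma Ck_linear: assumes "bounded_linear f" shows "Ck k f"
proof (cases k)
  case 0
  then show ?thesis using assms by (simp add: linear_continuous_on)
next
  case (Suc l)
  have "(f has_derivative f) (at x)" for x
    using assms by (rule bounded_linear_imp_has_derivative)
  then have "ddir f v = (\<lambda>x. f v)" for v using frechet_derivative_eq by metis
  moreover have "f differentiable at x" for x
    using assms by (rule bounded_linear_imp_differentiable)
  ultimately show ?thesis using Suc by (auto simp: Ck_const)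
qed

lemma Ck_add: "Ck k f \<Longrightarrow> Ck k g \<Longrightarrow> Ck k (\<lambda>x. f x + g x)"
proof (induction k arbitrary: f g)
  case 0
  then show ?case by (simp add: continuous_on_add)
next
  case (Suc k)
  have d: "f differentiable at x" "g differentiable at x" for x using Suc.prems by auto
  have "ddir (\<lambda>x. f x + g x) v = (\<lambda>x. ddir f v x + ddir g v x)" for v
    using d by (intro ext) (subst frechet_derivative_eq[OF has_derivative_add], 
        auto simp: frechet_derivative_works[symmetric])
  then show ?case using Suc d by (auto intro: differentiable_add)
qed

text \<open>By the product rule the derivative is a sum of two terms of the same bilinear shape, so
  the induction closes. Scalar multiples, inner products and products are all instances.\<close>

lemma Ck_bilinear:
  assumes "bounded_bilinear (B :: 'b::real_normed_vector \<Rightarrow> 'c::real_normed_vector \<Rightarrow> 'd::real_normed_vector)"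
  shows "Ck k f \<Longrightarrow> Ck k g \<Longrightarrow> Ck k (\<lambda>x. B (f x) (g x))"
proof (induction k arbitrary: f g)
  case 0
  then show ?case by (simp add: bounded_bilinear.continuous_on[OF assms])
next
  case (Suc k)
  have d: "f differentiable at x" "g differentiable at x" for x using Suc.prems by auto
  have h: "((\<lambda>x. B (f x) (g x)) has_derivative
      (\<lambda>v. B (f x) (ddir g v x) + B (ddir f v x) (g x))) (at x)" for x
    by (rule bounded_bilinear.FDERIV[OF assms]) (use d frechet_derivative_works in blast)+
  have "ddir (\<lambda>x. B (f x) (g x)) v = (\<lambda>x. B (f x) (ddir g v x) + B (ddir f v x) (g x))" for v
    by (rule ext) (simp add: frechet_derivative_eq[OF h])
  moreover have "Ck k f" "Ck k g" using Suc.prems Ck_Suc_imp by blast+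
  moreover have "(\<lambda>x. B (f x) (g x)) differentiable at x" for x
    using h unfolding differentiable_def by blast
  ultimately show ?case using Suc by (auto intro!: Ck_add)
qed

lemma Ck_sum: "finite I \<Longrightarrow> (\<And>i. i \<in> I \<Longrightarrow> Ck k (f i)) \<Longrightarrow> Ck k (\<lambda>x. \<Sum>i\<in>I. f i x)"
  by (induction I rule: finite_induct) (auto simp: Ck_const Ck_add)

text \<open>\<open>Ck\<close> speaks of derivatives in fixed directions only. Expanding in
  \<open>Basis\<close> reduces a direction that varies with the point to fixed ones; this drives the
  chain rule and every bound that is uniform over directions.\<close>

lemma linear_expand_Basis: 
  assumes "linear L" shows "L v = (\<Sum>b\<in>Basis. (v \<bullet> b) *\<^sub>R L b)"
  using linear_sum[OF assms, of "\<lambda>b. (v \<bullet> b) *\<^sub>R b" Basis] 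
  by (simp add: euclidean_representation linear_scale[OF assms])

lemma frechet_linear: "f differentiable at x \<Longrightarrow> linear (frechet_derivative f (at x))"
  by (simp add: linear_frechet_derivative)

lemma Ck_compose:
  fixes f :: "'a::euclidean_space \<Rightarrow> 'b::euclidean_space" and g :: "'b \<Rightarrow> 'c::real_normed_vector"
  shows "Ck k g \<Longrightarrow> Ck k f \<Longrightarrow> Ck k (\<lambda>x. g (f x))"
proof (induction k arbitrary: f g)
  case 0
  then show ?case by (auto intro: continuous_on_compose2[of UNIV g])
next
  case (Suc k)
  have d: "f differentiable at x" "g differentiable at y" for x y using Suc.prems by auto
  have h: "((\<lambda>x. g (f x)) has_derivative (\<lambda>v. ddir g (ddir f v x) (f x))) (at x)" for x
    using has_derivative_compose[of f "frechet_derivative f (at x)" x UNIV g] d 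
    by (simp add: frechet_derivative_works)
  have "ddir (\<lambda>x. g (f x)) v = (\<lambda>x. \<Sum>b\<in>Basis. (ddir f v x \<bullet> b) *\<^sub>R ddir g b (f x))" for v
    by (rule ext, subst frechet_derivative_eq[OF h], 
        rule linear_expand_Basis[OF frechet_linear[OF d(2)]])
  moreover have "Ck k (\<lambda>x. (ddir f v x \<bullet> b) *\<^sub>R ddir g b (f x))" for v b
    using Suc.prems Ck_Suc_imp[OF Suc.prems(2)]
    by (intro Ck_bilinear[OF bounded_bilinear_scaleR] Ck_bilinear[OF bounded_bilinear_inner] 
        Suc.IH[of "ddir g b"] Ck_const) auto
  moreover have "(\<lambda>x. g (f x)) differentiable at x" for x
    using h unfolding differentiable_def by blast
  ultimately show ?case by (auto intro!: Ck_sum)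
qed

section \<open>Closure properties of smooth maps\<close>

lemma smooth_Ck: "smooth f \<Longrightarrow> Ck k f"
  by (simp add: smooth_def)

lemma smooth_differentiable: "smooth f \<Longrightarrow> f differentiable at x"
  using smooth_Ck[of f 1] by simp

lemma smooth_has_derivative: "smooth f \<Longrightarrow> (f has_derivative frechet_derivative f (at x)) (at x)"
  using smooth_differentiable frechet_derivative_works by blast

lemma smooth_ddir: "smooth f \<Longrightarrow> smooth (ddir f v)"
  unfolding smooth_def by (metis Ck.simps(2))

lemma smooth_continuous_on: "smooth f \<Longrightarrow> continuous_on S f"
  using smooth_Ck[of f 0] continuous_on_subset by auto

lemma smooth_const: "smooth (\<lambda>x. c)"
  by (simp add: smooth_def Ck_const)

lemma smooth_linear: "bounded_linear f \<Longrightarrow> smooth f"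
  by (simp add: smooth_def Ck_linear)

lemma smooth_id: "smooth (\<lambda>x. x)"
  by (rule smooth_linear) (rule bounded_linear_ident)

lemma smooth_fst: "smooth (fst :: 'a::euclidean_space \<times> 'b::euclidean_space \<Rightarrow> 'a)"
  and smooth_snd: "smooth (snd :: 'a::euclidean_space \<times> 'b::euclidean_space \<Rightarrow> 'b)"
  by (rule smooth_linear, rule bounded_linear_fst) (rule smooth_linear, rule bounded_linear_snd)

lemma smooth_add: "smooth f \<Longrightarrow> smooth g \<Longrightarrow> smooth (\<lambda>x. f x + g x)"
  by (simp add: smooth_def Ck_add)

lemma smooth_bilinear:
  "bounded_bilinear B \<Longrightarrow> smooth f \<Longrightarrow> smooth g \<Longrightarrow> smooth (\<lambda>x. B (f x) (g x))"
  by (simp add: smooth_def Ck_bilinear)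

lemma smooth_scaleR: "smooth f \<Longrightarrow> smooth g \<Longrightarrow> smooth (\<lambda>x. f x *\<^sub>R g x)"
  by (rule smooth_bilinear[OF bounded_bilinear_scaleR])

lemma smooth_inner: "smooth f \<Longrightarrow> smooth g \<Longrightarrow> smooth (\<lambda>x. f x \<bullet> g x)"
  by (rule smooth_bilinear[OF bounded_bilinear_inner])

lemma smooth_mult: 
  fixes f :: "'a::euclidean_space \<Rightarrow> real" shows "smooth f \<Longrightarrow> smooth g \<Longrightarrow> smooth (\<lambda>x. f x * g x)"
  by (rule smooth_bilinear[OF bounded_bilinear_mult])

lemma smooth_sum: "finite I \<Longrightarrow> (\<And>i. i \<in> I \<Longrightarrow> smooth (f i)) \<Longrightarrow> smooth (\<lambda>x. \<Sum>i\<in>I. f i x)"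
  by (simp add: smooth_def Ck_sum)

lemma smooth_compose:
  fixes f :: "'a::euclidean_space \<Rightarrow> 'b::euclidean_space" and g :: "'b \<Rightarrow> 'c::real_normed_vector"
  shows "smooth g \<Longrightarrow> smooth f \<Longrightarrow> smooth (\<lambda>x. g (f x))"
  by (simp add: smooth_def Ck_compose)

lemma smooth_linear_compose:
  fixes f :: "'a::euclidean_space \<Rightarrow> 'b::euclidean_space" and L :: "'b \<Rightarrow> 'c::real_normed_vector"
  shows "bounded_linear L \<Longrightarrow> smooth f \<Longrightarrow> smooth (\<lambda>x. L (f x))"
  by (rule smooth_compose[OF smooth_linear])

lemma smooth_minus: 
  fixes f :: "'a::euclidean_space \<Rightarrow> 'b::euclidean_space"
  shows "smooth f \<Longrightarrow> smooth (\<lambda>x. - f x)"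
  by (rule smooth_linear_compose[OF bounded_linear_minus[OF bounded_linear_ident]])

lemma smooth_Pair:
  fixes f :: "'a::euclidean_space \<Rightarrow> 'b::euclidean_space" and g :: "'a \<Rightarrow> 'c::euclidean_space"
  assumes "smooth f" "smooth g" shows "smooth (\<lambda>x. (f x, g x))"
proof -
  have "bounded_linear (\<lambda>y::'b. (y, 0::'c))" "bounded_linear (\<lambda>y::'c. (0::'b, y))"
    by (auto intro!: bounded_linear_Pair bounded_linear_ident bounded_linear_zero)
  from smooth_add[OF smooth_linear_compose[OF this(1) assms(1)] smooth_linear_compose[OF this(2) assms(2)]]
  show ?thesis by simp
qed

text \<open>Base point and direction both vary with \<open>x\<close>. This yields smoothness of
  derivatives of joint maps such as \<open>(u, b) \<mapsto> F (u b)\<close> along a slice.\<close>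

lemma smooth_frechet:
  fixes f :: "'b::euclidean_space \<Rightarrow> 'c::euclidean_space" 
    and h k :: "'a::euclidean_space \<Rightarrow> 'b"
  assumes "smooth f" "smooth h" "smooth k"
  shows "smooth (\<lambda>x. frechet_derivative f (at (h x)) (k x))"
proof -
  have "(\<lambda>x. frechet_derivative f (at (h x)) (k x)) = (\<lambda>x. \<Sum>b\<in>Basis. (k x \<bullet> b) *\<^sub>R ddir f b (h x))"
    by (rule ext, rule linear_expand_Basis[OF frechet_linear[OF smooth_differentiable[OF assms(1)]]])
  then show ?thesis
    by (auto intro!: smooth_sum smooth_scaleR smooth_inner assms smooth_const 
         smooth_compose[of "ddir f _"] smooth_ddir)
qed

lemma smooth_curve_derivative:
  assumes "smooth f" "(c has_vector_derivative c') (at t)"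
  shows "((\<lambda>t. f (c t)) has_vector_derivative frechet_derivative f (at (c t)) c') (at t)"
  using has_derivative_compose[OF assms(2)[unfolded has_vector_derivative_def] 
      smooth_has_derivative[OF assms(1)]]
  unfolding has_vector_derivative_def
  by (simp add: linear_scale[OF frechet_linear[OF smooth_differentiable[OF assms(1)]]])

lemma smooth_line_derivative:
  assumes "smooth f"
  shows "((\<lambda>t. f (x + t *\<^sub>R v)) has_vector_derivative ddir f v (x + t *\<^sub>R v)) (at t)"
  by (rule smooth_curve_derivative[OF assms]) (auto intro!: derivative_eq_intros)

lemma vector_derivative_unique: 
  assumes "(f has_vector_derivative a) (at t)" "(f has_vector_derivative b) (at t)" shows "a = b"
  using assms by (metis vector_derivative_at)

text \<open>Directional derivatives are computed throughout in this way: differentiability is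
  already known, so the derivative along one line determines the value.\<close>

lemma ddir_eqI: 
  assumes "smooth f" "((\<lambda>t. f (x + t *\<^sub>R v)) has_vector_derivative d) (at 0)" shows "ddir f v x = d"
  using smooth_line_derivative[OF assms(1), of x v 0] assms(2) vector_derivative_unique
  by fastforce

lemma constant_if_zero_derivative:
  fixes q :: "real \<Rightarrow> 'b::real_normed_vector"
  assumes "\<And>s. (q has_vector_derivative 0) (at s)" shows "q s = q 0"
proof -
  have "\<exists>c. \<forall>x\<in>UNIV. q x = c"
    by (rule has_vector_derivative_zero_constant[of UNIV q]) (use assms in auto)
  then show ?thesis by auto
qed

text \<open>The mean value theorem is applied once in direction \<open>u\<close> and once in
  direction \<open>v\<close>. The left side is symmetric in \<open>u\<close> and \<open>v\<close>,
  the right side is not, which is what makes mixed derivatives commute.\<close>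

lemma second_difference:
  fixes f :: "'a::euclidean_space \<Rightarrow> real"
  assumes f: "smooth f" and s: "0 < s"
  shows "\<exists>\<sigma>\<in>{0<..<s}. \<exists>\<tau>\<in>{0<..<s}. f (x + s *\<^sub>R u + s *\<^sub>R v) - f (x + s *\<^sub>R u) - f (x + s *\<^sub>R v) + f x
     = s * s * ddir (ddir f u) v (x + \<sigma> *\<^sub>R u + \<tau> *\<^sub>R v)"
proof -
  define g where "g \<sigma> = f (x + s *\<^sub>R v + \<sigma> *\<^sub>R u) - f (x + \<sigma> *\<^sub>R u)" for \<sigma>
  have "(g has_real_derivative ddir f u (x + s *\<^sub>R v + \<sigma> *\<^sub>R u) - ddir f u (x + \<sigma> *\<^sub>R u)) (at \<sigma>)" for \<sigma>
    unfolding g_def 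
    using smooth_line_derivative[OF f, where x="x + s *\<^sub>R v" and v=u and t=\<sigma>] smooth_line_derivative[OF f, where x=x and v=u and t=\<sigma>]
    by (auto simp: has_real_derivative_iff_has_vector_derivative intro!: has_vector_derivative_diff)
  from MVT2[OF s this] obtain \<sigma> where \<sigma>: "0 < \<sigma>" "\<sigma> < s" 
    "g s - g 0 = s * (ddir f u (x + s *\<^sub>R v + \<sigma> *\<^sub>R u) - ddir f u (x + \<sigma> *\<^sub>R u))" by auto
  define h where "h \<tau> = ddir f u (x + \<sigma> *\<^sub>R u + \<tau> *\<^sub>R v)" for \<tau>
  have "(h has_real_derivative ddir (ddir f u) v (x + \<sigma> *\<^sub>R u + \<tau> *\<^sub>R v)) (at \<tau>)" for \<tau>
    unfolding h_def 
    using smooth_line_derivative[OF smooth_ddir[OF f, of u], of "x + \<sigma> *\<^sub>R u" v \<tau>] 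
    by (simp add: has_real_derivative_iff_has_vector_derivative)
  from MVT2[OF s this] obtain \<tau> where \<tau>: "0 < \<tau>" "\<tau> < s" 
    "h s - h 0 = s * ddir (ddir f u) v (x + \<sigma> *\<^sub>R u + \<tau> *\<^sub>R v)" by auto
  have "f (x + s *\<^sub>R u + s *\<^sub>R v) - f (x + s *\<^sub>R u) - f (x + s *\<^sub>R v) + f x = g s - g 0"
    by (simp add: g_def algebra_simps)
  also have "\<dots> = s * (h s - h 0)" unfolding \<sigma>(3) h_def by (simp add: algebra_simps)
  finally show ?thesis using \<tau> \<sigma> by (intro bexI[of _ \<sigma>] bexI[of _ \<tau>]) auto
qed

lemma ddir_commute_real:
  fixes f :: "'a::euclidean_space \<Rightarrow> real"
  assumes f: "smooth f"
  shows "ddir (ddir f u) v x = ddir (ddir f v) u x"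
proof -
  \<comment> \<open>Any positive null sequence of step lengths serves: two expansions of one
    symmetric difference are divided by \<open>P n * P n\<close>, and continuity of the second
    derivatives gives equality in the limit.\<close>
  define P where "P n = inverse (real (Suc n))" for n
  have P: "P n > 0" for n by (simp add: P_def)
  have P0: "P \<longlonglongrightarrow> 0" unfolding P_def by (rule LIMSEQ_inverse_real_of_nat)
  obtain \<sigma> \<tau> :: "nat \<Rightarrow> real" where 1: "\<And>n. \<sigma> n \<in> {0<..<P n}" "\<And>n. \<tau> n \<in> {0<..<P n}" 
    "\<And>n. f (x + P n *\<^sub>R u + P n *\<^sub>R v) - f (x + P n *\<^sub>R u) - f (x + P n *\<^sub>R v) + f x
     = P n * P n * ddir (ddir f u) v (x + \<sigma> n *\<^sub>R u + \<tau> n *\<^sub>R v)"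
    using second_difference[OF f P, of _ x u v] by metis
  obtain \<sigma>' \<tau>' :: "nat \<Rightarrow> real" where 2: "\<And>n. \<sigma>' n \<in> {0<..<P n}" "\<And>n. \<tau>' n \<in> {0<..<P n}" 
    "\<And>n. f (x + P n *\<^sub>R v + P n *\<^sub>R u) - f (x + P n *\<^sub>R v) - f (x + P n *\<^sub>R u) + f x
     = P n * P n * ddir (ddir f v) u (x + \<sigma>' n *\<^sub>R v + \<tau>' n *\<^sub>R u)"
    using second_difference[OF f P, of _ x v u] by metis
  have eq: "ddir (ddir f u) v (x + \<sigma> n *\<^sub>R u + \<tau> n *\<^sub>R v) = ddir (ddir f v) u (x + \<sigma>' n *\<^sub>R v + \<tau>' n *\<^sub>R u)" for n
    using 1(3)[of n] 2(3)[of n] P[of n] by (simp add: algebra_simps)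
  have sq: "a \<longlonglongrightarrow> 0" if "\<And>n. a n \<in> {0<..<P n}" for a
    by (rule tendsto_sandwich[OF _ _ tendsto_const P0]) (use that in \<open>auto intro!: always_eventually less_imp_le\<close>)
  have lim: "(\<lambda>n. ddir (ddir f u) v (x + a n *\<^sub>R u' + b n *\<^sub>R v')) \<longlonglongrightarrow> ddir (ddir f u) v x" 
    if "a \<longlonglongrightarrow> 0" "b \<longlonglongrightarrow> 0" for a b u v u' v'
  proof -
    have "(\<lambda>n. x + a n *\<^sub>R u' + b n *\<^sub>R v') \<longlonglongrightarrow> x + 0 *\<^sub>R u' + 0 *\<^sub>R v'"
      by (intro tendsto_intros that)
    then show ?thesis
      using continuous_on_tendsto_compose[OF smooth_continuous_on[OF smooth_ddir[OF smooth_ddir[OF f]], of UNIV u v]]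
      by simp
  qed
  show ?thesis
    using lim[OF sq[OF 1(1)] sq[OF 1(2)], where u=u and v=v and u'=u and v'=v] lim[OF sq[OF 2(1)] sq[OF 2(2)], where u=v and v=u and u'=v and v'=u]
    unfolding eq by (rule LIMSEQ_unique)
qed

text \<open>The remainder is bounded on a ball by the Lipschitz constant of the derivative there.\<close>

lemma smooth_linearization_bound:
  fixes f :: "'a::euclidean_space \<Rightarrow> 'b::euclidean_space"
  assumes f: "smooth f"
  shows "\<exists>C\<ge>0. \<forall>w. norm w \<le> R \<longrightarrow> norm (f w - f 0 - ddir f w 0) \<le> C * (norm w)\<^sup>2"
proof -
  have "\<exists>K\<ge>0. \<forall>w\<in>cball 0 R. \<forall>v. norm (ddir (ddir f b) v w) \<le> K * norm v" for b
  proof -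
    have "bounded (ddir (ddir f b) c ` cball 0 R)" for c
      by (intro compact_imp_bounded compact_continuous_image smooth_continuous_on smooth_ddir f compact_cball)
    then have "\<exists>B. \<forall>w\<in>cball 0 R. norm (ddir (ddir f b) c w) \<le> B" for c
      by (auto simp: bounded_iff)
    then obtain B where B: "\<And>c w. w \<in> cball 0 R \<Longrightarrow> norm (ddir (ddir f b) c w) \<le> B c" by metis
    have "norm (ddir (ddir f b) v w) \<le> (\<Sum>c\<in>Basis. \<bar>B c\<bar>) * norm v" if w: "w \<in> cball 0 R" for v w
    proof -
      have "norm (ddir (ddir f b) v w) = norm (\<Sum>c\<in>Basis. (v \<bullet> c) *\<^sub>R ddir (ddir f b) c w)"
        by (subst linear_expand_Basis[OF frechet_linear[OF smooth_differentiable[OF smooth_ddir[OF f]]]]) simp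
      also have "\<dots> \<le> (\<Sum>c\<in>Basis. norm v * \<bar>B c\<bar>)"
        by (rule order_trans[OF norm_sum], rule sum_mono, unfold norm_scaleR,
            rule mult_mono) (use B[OF w] in \<open>auto simp: Basis_le_norm intro: order_trans[OF _ abs_ge_self]\<close>)
      finally show ?thesis by (simp add: sum_distrib_left mult.commute)
    qed
    then show ?thesis by (intro exI[of _ "\<Sum>c\<in>Basis. \<bar>B c\<bar>"]) (auto intro: sum_nonneg)
  qed
  then obtain K where K: "\<And>b. 0 \<le> K b" "\<And>b w v. w \<in> cball 0 R \<Longrightarrow> norm (ddir (ddir f b) v w) \<le> K b * norm v" by metis
  define C where "C = (\<Sum>b\<in>(Basis::'a set). K b)"
  have lip: "norm (ddir f b w - ddir f b 0) \<le> K b * norm w" if w: "w \<in> cball 0 R" for b w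
  proof -
    have "0 \<le> norm w" by simp
    also have "\<dots> \<le> R" using w by simp
    finally have R: "0 \<le> R" .
    have "norm (ddir f b w - ddir f b 0) \<le> K b * norm (w - 0)"
    proof (rule differentiable_bound[of "cball 0 R" "ddir f b" "\<lambda>x. frechet_derivative (ddir f b) (at x)"])
      fix x :: 'a assume "x \<in> cball 0 R"
      then show "onorm (frechet_derivative (ddir f b) (at x)) \<le> K b"
        by (intro onorm_bound K)
    qed (use w R in \<open>auto intro!: has_derivative_at_withinI smooth_has_derivative smooth_ddir f\<close>)
    then show ?thesis by simp
  qed
  have "norm (f w - f 0 - ddir f w 0) \<le> C * (norm w)\<^sup>2" if w: "norm w \<le> R" for w
  proof -
    \<comment> \<open>The ball has radius \<open>norm w\<close> rather than \<open>R\<close>, so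
      that the variation of the derivative on it is itself of order \<open>norm w\<close>; this
      makes the error quadratic.\<close>
    have "norm (f w - f 0 - frechet_derivative f (at 0) (w - 0)) \<le> norm (w - 0) * (C * norm w)"
    proof (rule differentiable_bound_linearization[where S="cball 0 (norm w)"])
      show "t \<in> {0..1} \<Longrightarrow> 0 + t *\<^sub>R (w - 0) \<in> cball 0 (norm w)" for t
        by (auto intro: mult_left_le_one_le)
      show "(f has_derivative frechet_derivative f (at x)) (at x within cball 0 (norm w))" for x
        by (rule has_derivative_at_withinI[OF smooth_has_derivative[OF f]])
      fix x :: 'a assume "x \<in> cball 0 (norm w)"
      then have x: "norm x \<le> norm w" by simp
      show "onorm (frechet_derivative f (at x) - frechet_derivative f (at 0)) \<le> C * norm w"
        unfolding fun_diff_def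
      proof (rule onorm_bound)
        show "0 \<le> C * norm w" unfolding C_def using K(1) by (auto intro!: mult_nonneg_nonneg sum_nonneg)
        fix v
        have "norm (ddir f v x - ddir f v 0) = norm (\<Sum>b\<in>Basis. (v \<bullet> b) *\<^sub>R (ddir f b x - ddir f b 0))"
          using linear_expand_Basis[OF frechet_linear[OF smooth_differentiable[OF f]], of x v]
           linear_expand_Basis[OF frechet_linear[OF smooth_differentiable[OF f]], of 0 v]
          by (simp add: sum_subtractf scaleR_diff_right)
        also have "\<dots> \<le> (\<Sum>b\<in>Basis. norm v * (K b * norm w))"
        proof (rule order_trans[OF norm_sum], rule sum_mono, unfold norm_scaleR, rule mult_mono)
          fix b :: 'a 
          have "norm (ddir f b x - ddir f b 0) \<le> K b * norm x" by (rule lip) (use x w in auto)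
          also have "\<dots> \<le> K b * norm w" using K(1) x by (intro mult_left_mono)
          finally show "norm (ddir f b x - ddir f b 0) \<le> K b * norm w" .
        qed (auto simp: Basis_le_norm)
        finally show "norm (ddir f v x - ddir f v 0) \<le> C * norm w * norm v"
          by (simp add: C_def sum_distrib_left sum_distrib_right mult_ac)
      qed
    qed simp
    then show ?thesis by (simp add: power2_eq_square mult_ac)
  qed
  moreover have "0 \<le> C" unfolding C_def using K(1) by (auto intro!: sum_nonneg)
  ultimately show ?thesis by blast
qed

section \<open>Group laws in logarithmic coordinates\<close>

text \<open>The group transported to its Lie algebra by the exponential chart. The unit is 0 and
  rays are one-parameter subgroups, whence inversion is negation.\<close>

locale log_group =
  fixes mul :: "'a::euclidean_space \<Rightarrow> 'a \<Rightarrow> 'a"  (infixl \<open>\<diamondop>\<close> 70)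
  assumes smooth_mul: "smooth (\<lambda>(a, b). a \<diamondop> b)"
    and mul_assoc: "(a \<diamondop> b) \<diamondop> c = a \<diamondop> (b \<diamondop> c)"
    and zero_mul [simp]: "0 \<diamondop> a = a"
    and mul_zero [simp]: "a \<diamondop> 0 = a"
    and one_parameter: "(s + t) *\<^sub>R a = (s *\<^sub>R a) \<diamondop> (t *\<^sub>R a)"
begin

lemma mul_minus [simp]: "a \<diamondop> (- a) = 0" and minus_mul [simp]: "(- a) \<diamondop> a = 0"
  using one_parameter[of 1 "-1" a] one_parameter[of "-1" 1 a] by auto

lemma minus_mul_cancel [simp]: "(- a) \<diamondop> (a \<diamondop> b) = b" and mul_minus_cancel [simp]: "a \<diamondop> ((- a) \<diamondop> b) = b"
  by (metis mul_assoc zero_mul mul_minus minus_mul)+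

lemma minus_mul_distrib: "- (a \<diamondop> b) = (- b) \<diamondop> (- a)"
proof -
  have "- (a \<diamondop> b) = - (a \<diamondop> b) \<diamondop> ((a \<diamondop> b) \<diamondop> ((- b) \<diamondop> (- a)))" by (simp add: mul_assoc)
  then show ?thesis by (metis minus_mul_cancel)
qed

lemma smooth_mul': 
  fixes f g :: "'b::euclidean_space \<Rightarrow> 'a"
  shows "smooth f \<Longrightarrow> smooth g \<Longrightarrow> smooth (\<lambda>x. f x \<diamondop> g x)"
  using smooth_compose[OF smooth_mul smooth_Pair[of f g]] by simp

lemma smooth_left_mul: "smooth (\<lambda>b. a \<diamondop> b)" and smooth_right_mul: "smooth (\<lambda>a. a \<diamondop> b)"
  by (intro smooth_mul' smooth_const smooth_id)+

text \<open>Both partial derivatives at the unit are the identity because 0 is neutral. Hence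
  products of curves through 0 have the sum of the velocities.\<close>

lemma frechet_mul_zero: "frechet_derivative (\<lambda>(a, b). a \<diamondop> b) (at (0, 0)) (a, b) = a + b"
proof -
  let ?D = "frechet_derivative (\<lambda>(a, b). a \<diamondop> b) (at (0, 0))"
  have "?D (a, 0) = a" "?D (0, b) = b"
    by (rule ddir_eqI[OF smooth_mul], auto intro!: derivative_eq_intros)+
  moreover have "?D ((a, 0) + (0, b)) = ?D (a, 0) + ?D (0, b)"
    by (rule linear_add[OF frechet_linear[OF smooth_differentiable[OF smooth_mul]]])
  ultimately show ?thesis by simp
qed

lemma mul_curve_derivative:
  assumes "(c has_vector_derivative c') (at t)" "(d has_vector_derivative d') (at t)"
    and "c t = 0" "d t = 0"
  shows "((\<lambda>t. c t \<diamondop> d t) has_vector_derivative c' + d') (at t)"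
  using smooth_curve_derivative[OF smooth_mul has_vector_derivative_Pair[OF assms(1,2)]] assms(3,4)
  by (simp add: frechet_mul_zero)

text \<open>The group law simplifies increments from a given parameter, so derivatives are computed
  at 0; this lemma and the next carry them to and from other parameters.\<close>

lemma shift_vector_derivative:
  "((\<lambda>\<sigma>. q (s + \<sigma>)) has_vector_derivative d) (at (0::real)) \<Longrightarrow> (q has_vector_derivative d) (at s)"
  using vector_diff_chain_at[of "\<lambda>x. x - s" 1 s "\<lambda>\<sigma>. q (s + \<sigma>)" d]
  by (simp add: o_def has_vector_derivative_diff_const) 

lemma vector_derivative_shift:
  assumes "(q has_vector_derivative d) (at (s::real))"
  shows "((\<lambda>\<sigma>. q (s + \<sigma>)) has_vector_derivative d) (at 0)"
  using vector_diff_chain_at[OF has_vector_derivative_add[OF has_vector_derivative_const 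
        has_vector_derivative_id], of q d s 0] assms
  by (simp add: o_def)

text \<open>Uniqueness for the equation "logarithmic derivative equals \<open>c\<close>": the curve
  obtained from \<open>u\<close> by dividing out the one-parameter subgroup of \<open>c\<close> on
  the right is constant.\<close>

lemma constant_log_derivative:
  assumes "\<And>s. ((\<lambda>\<sigma>. (- u s) \<diamondop> u (s + \<sigma>)) has_vector_derivative c) (at 0)"
  shows "u s = u 0 \<diamondop> (s *\<^sub>R c)"
proof -
  define q where "q s = u s \<diamondop> (- (s *\<^sub>R c))" for s
  have "(q has_vector_derivative 0) (at s)" for s
  proof (rule shift_vector_derivative)
    let ?c = "\<lambda>\<sigma>. ((- u s) \<diamondop> u (s + \<sigma>)) \<diamondop> (- (\<sigma> *\<^sub>R c))"
    \<comment> \<open>Up to fixed outer factors the increment of \<open>q\<close> is a product of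
      two curves through 0 with velocities \<open>c\<close> and \<open>- c\<close>.\<close>
    have q: "q (s + \<sigma>) = u s \<diamondop> (?c \<sigma> \<diamondop> (- (s *\<^sub>R c)))" for \<sigma>
      using one_parameter[of s \<sigma> c] by (simp add: q_def mul_assoc minus_mul_distrib)
    have "(?c has_vector_derivative c + - c) (at 0)"
      by (rule mul_curve_derivative[OF assms]) (auto intro!: derivative_eq_intros)
    then have c: "(?c has_vector_derivative 0) (at 0)" by simp
    have "smooth (\<lambda>y. u s \<diamondop> (y \<diamondop> (- (s *\<^sub>R c))))"
      by (intro smooth_mul' smooth_const smooth_id)
    from smooth_curve_derivative[OF this c] show "((\<lambda>\<sigma>. q (s + \<sigma>)) has_vector_derivative 0) (at 0)"
      unfolding q by (simp add: linear_0[OF frechet_linear[OF smooth_differentiable[OF \<open>smooth _\<close>]]])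
  qed
  then have "q s = q 0" by (rule constant_if_zero_derivative)
  then have "u s = u 0 \<diamondop> (- (- (s *\<^sub>R c)))"
    unfolding q_def by (metis mul_assoc mul_minus mul_zero minus_mul minus_zero scaleR_zero_left minus_minus)
  then show ?thesis by simp
qed

text \<open>Conjugation of group elements in the chart. Since rays are one-parameter subgroups, this
  is also the adjoint representation, but linearity has to be proved
  (\<open>linear_Ad\<close>).\<close>

definition Ad :: "'a \<Rightarrow> 'a \<Rightarrow> 'a" where "Ad z a = z \<diamondop> (a \<diamondop> (- z))"

lemma Ad_zero_left [simp]: "Ad 0 a = a" and Ad_zero [simp]: "Ad z 0 = 0"
  by (simp_all add: Ad_def)

lemma Ad_mul_left: "Ad (x \<diamondop> y) a = Ad x (Ad y a)"
  by (simp add: Ad_def mul_assoc minus_mul_distrib)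

lemma Ad_mul: "Ad z (a \<diamondop> b) = Ad z a \<diamondop> Ad z b"
  by (simp add: Ad_def mul_assoc)

lemma Ad_minus_cancel [simp]: "Ad (- z) (Ad z a) = a" "Ad z (Ad (- z) a) = a"
  by (simp_all add: Ad_mul_left[symmetric])

lemma mul_eq_Ad: "z \<diamondop> a = Ad z a \<diamondop> z"
  by (simp add: Ad_def mul_assoc)

lemma mul_eq_Ad': "a \<diamondop> z = z \<diamondop> Ad (- z) a"
  by (simp add: Ad_def mul_assoc)

lemma smooth_Ad: 
  fixes f g :: "'b::euclidean_space \<Rightarrow> 'a"
  shows "smooth f \<Longrightarrow> smooth g \<Longrightarrow> smooth (\<lambda>x. Ad (f x) (g x))"
  unfolding Ad_def by (intro smooth_mul' smooth_minus)

text \<open>Conjugation is a homomorphism, so the image of a ray has constant logarithmic derivative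
  and is again a ray.\<close>

lemma Ad_scaleR: "Ad z (s *\<^sub>R a) = s *\<^sub>R Ad z a"
proof -
  define c where "c = ddir (Ad z) a 0"
  have sm: "smooth (Ad z)" by (intro smooth_Ad smooth_const smooth_id)
  have "Ad z (s *\<^sub>R a) = Ad z (0 *\<^sub>R a) \<diamondop> (s *\<^sub>R c)" for s
  proof (rule constant_log_derivative[of "\<lambda>s. Ad z (s *\<^sub>R a)"])
    fix s
    have "(- Ad z (s *\<^sub>R a)) \<diamondop> Ad z ((s + \<sigma>) *\<^sub>R a) = Ad z (0 + \<sigma> *\<^sub>R a)" for \<sigma>
      by (simp add: one_parameter Ad_mul)
    then show "((\<lambda>\<sigma>. (- Ad z (s *\<^sub>R a)) \<diamondop> Ad z ((s + \<sigma>) *\<^sub>R a)) has_vector_derivative c) (at 0)"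
      using smooth_line_derivative[OF sm, of 0 a 0] by (simp add: c_def)
  qed
  from this[of s] this[of 1] show ?thesis by simp
qed

text \<open>A map that is homogeneous of degree one and differentiable at 0 coincides with its
  derivative there.\<close>

lemma linear_Ad: "linear (Ad z)"
proof -
  have sm: "smooth (Ad z)" by (intro smooth_Ad smooth_const smooth_id)
  have "ddir (Ad z) a 0 = Ad z a" for a
    by (rule ddir_eqI[OF sm]) (auto simp: Ad_scaleR intro!: derivative_eq_intros)
  then show ?thesis using frechet_linear[OF smooth_differentiable[OF sm], of 0] by (metis ext)
qed

text \<open>The left logarithmic derivative: for a curve \<open>c\<close>, it is the derivative of
  \<open>\<sigma> \<mapsto> c(s)\<inverse> c(s + \<sigma>)\<close> at \<open>0\<close> in terms of \<open>c s\<close> and \<open>c' s\<close>.\<close>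

definition logd :: "'a \<Rightarrow> 'a \<Rightarrow> 'a" where
  "logd u v = frechet_derivative (\<lambda>y. (- u) \<diamondop> y) (at u) v"

lemma logd_curve:
  assumes "(c has_vector_derivative c') (at s)"
  shows "((\<lambda>\<sigma>. (- c s) \<diamondop> c (s + \<sigma>)) has_vector_derivative logd (c s) c') (at 0)"
proof -
  have "((\<lambda>\<sigma>. c (s + \<sigma>)) has_vector_derivative c') (at 0)"
    by (rule vector_derivative_shift[OF assms])
  from smooth_curve_derivative[OF smooth_left_mul this] show ?thesis by (simp add: logd_def)
qed

lemma logd_zero: "logd 0 v = v"
  by (simp add: logd_def)

lemma linear_logd: "linear (logd u)"
  unfolding logd_def using frechet_linear[OF smooth_differentiable[OF smooth_left_mul]] .

lemma smooth_logd: "smooth (\<lambda>\<sigma>::real. logd (\<sigma> *\<^sub>R u) v)"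
proof -
  have sm: "smooth (\<lambda>(x, y). (- x) \<diamondop> y)" 
    unfolding split_def by (intro smooth_mul' smooth_minus smooth_fst smooth_snd)
  have eq: "logd x v = frechet_derivative (\<lambda>(x, y). (- x) \<diamondop> y) (at (x, x)) (0, v)" for x
    unfolding logd_def using smooth_line_derivative[OF sm, of "(x, x)" "(0, v)" 0]
    by (intro ddir_eqI[OF smooth_left_mul]) simp
  show ?thesis unfolding eq
    by (intro smooth_frechet[OF sm] smooth_Pair smooth_scaleR smooth_const smooth_id)
qed

text \<open>Varying \<open>u\<close> moves the end point of the ray by \<open>s\<close> times the
  variation, whence the factor \<open>s\<close>. With this factor the logarithmic derivative
  satisfies a cocycle identity in \<open>s\<close>.\<close>

lemma logd_ray_derivative: 
  "((\<lambda>t. (- (s *\<^sub>R u)) \<diamondop> (s *\<^sub>R (u + t *\<^sub>R v))) has_vector_derivative s *\<^sub>R logd (s *\<^sub>R u) v) (at 0)"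
proof -
  have "((\<lambda>t. s *\<^sub>R (u + t *\<^sub>R v)) has_vector_derivative s *\<^sub>R v) (at 0)"
    by (auto intro!: derivative_eq_intros)
  from logd_curve[OF this] show ?thesis by (simp add: linear_scale[OF linear_logd])
qed

text \<open>Splitting the ray at time \<open>s\<close> writes its varied increment as a product of
  two. The first part is conjugated past the rest of the ray, which produces \<open>Ad\<close>, and
  to first order a product near 0 is a sum.\<close>

lemma logd_cocycle:
  "(s + \<sigma>) *\<^sub>R logd ((s + \<sigma>) *\<^sub>R u) v = Ad (- (\<sigma> *\<^sub>R u)) (s *\<^sub>R logd (s *\<^sub>R u) v) + \<sigma> *\<^sub>R logd (\<sigma> *\<^sub>R u) v"
proof (rule vector_derivative_unique)
  let ?P = "\<lambda>s t. (- (s *\<^sub>R u)) \<diamondop> (s *\<^sub>R (u + t *\<^sub>R v))"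
  show "(?P (s + \<sigma>) has_vector_derivative (s + \<sigma>) *\<^sub>R logd ((s + \<sigma>) *\<^sub>R u) v) (at 0)"
    by (rule logd_ray_derivative)
  have P: "?P (s + \<sigma>) = (\<lambda>t. Ad (- (\<sigma> *\<^sub>R u)) (?P s t) \<diamondop> ?P \<sigma> t)"
    by (rule ext, subst (1 2) one_parameter) (simp add: Ad_def mul_assoc minus_mul_distrib)
  show "(?P (s + \<sigma>) has_vector_derivative 
      Ad (- (\<sigma> *\<^sub>R u)) (s *\<^sub>R logd (s *\<^sub>R u) v) + \<sigma> *\<^sub>R logd (\<sigma> *\<^sub>R u) v) (at 0)"
    unfolding P
    by (rule mul_curve_derivative[OF bounded_linear.has_vector_derivative[OF _ logd_ray_derivative] logd_ray_derivative])
       (simp_all add: linear_Ad linear_linear)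
qed

end

text \<open>The bracket enters as the derivative of the adjoint action. For the Lie group itself
  this is obtained from commutators of left invariant fields by
  \<open>Ad_derivative_bracket\<close>.\<close>

locale log_lie_group = log_group mul for mul :: "'a::euclidean_space \<Rightarrow> 'a \<Rightarrow> 'a"  (infixl \<open>\<diamondop>\<close> 70) +
  fixes br :: "'a \<Rightarrow> 'a \<Rightarrow> 'a"
  assumes bilinear_br: "bilinear br"
    and Ad_br: "((\<lambda>s. Ad (s *\<^sub>R a) b) has_vector_derivative br a b) (at 0)"
begin

lemma br_minus_left: "br (- a) b = - br a b"
  by (rule bilinear_lneg[OF bilinear_br])

lemma Ad_br_minus: "((\<lambda>s. Ad (- (s *\<^sub>R a)) b) has_vector_derivative - br a b) (at 0)"
  using Ad_br[of "- a" b] by (simp add: br_minus_left)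

lemma Ad_curve_derivative:
  assumes "(d has_vector_derivative d') (at 0)"
  shows "((\<lambda>\<sigma>. Ad (\<sigma> *\<^sub>R c) (d \<sigma>)) has_vector_derivative br c (d 0) + d') (at 0)"
proof -
  have sm: "smooth (\<lambda>(z, x). Ad z x)" unfolding split_def by (intro smooth_Ad smooth_fst smooth_snd)
  let ?D = "frechet_derivative (\<lambda>(z, x). Ad z x) (at (0, d 0))"
  have "?D (c, 0) = br c (d 0)" 
    by (rule ddir_eqI[OF sm]) (use Ad_br[of c "d 0"] in simp)
  moreover have "?D (0, d') = d'"
    by (rule ddir_eqI[OF sm]) (auto intro!: derivative_eq_intros)
  moreover have "?D ((c, 0) + (0, d')) = ?D (c, 0) + ?D (0, d')"
    by (rule linear_add[OF frechet_linear[OF smooth_differentiable[OF sm]]])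
  ultimately have "?D (c, d') = br c (d 0) + d'" by simp
  moreover have "((\<lambda>\<sigma>. \<sigma> *\<^sub>R c) has_vector_derivative c) (at 0)" by (auto intro!: derivative_eq_intros)
  ultimately show ?thesis
    using smooth_curve_derivative[OF sm has_vector_derivative_Pair[OF _ assms, of "\<lambda>\<sigma>. \<sigma> *\<^sub>R c" c]]
    by simp
qed

text \<open>\<open>Ad (s *\<^sub>R c)\<close> is an integrating factor: applied to
  \<open>d s\<close> it gives a constant curve, and it is invertible.\<close>

lemma br_ode_zero:
  assumes d: "\<And>s. (d has_vector_derivative - br c (d s)) (at s)" and "d 0 = 0"
  shows "d s = 0"
proof -
  have "((\<lambda>s. Ad (s *\<^sub>R c) (d s)) has_vector_derivative 0) (at s)" for s
  proof (rule shift_vector_derivative)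
    have "((\<lambda>\<sigma>. d (s + \<sigma>)) has_vector_derivative - br c (d s)) (at 0)"
      by (rule vector_derivative_shift[OF d])
    from Ad_curve_derivative[OF this, of c]
    have "((\<lambda>\<sigma>. Ad (\<sigma> *\<^sub>R c) (d (s + \<sigma>))) has_vector_derivative 0) (at 0)" by simp
    from bounded_linear.has_vector_derivative[OF linear_linear[THEN iffD2, OF linear_Ad[of "s *\<^sub>R c"]] this]
    show "((\<lambda>\<sigma>. Ad ((s + \<sigma>) *\<^sub>R c) (d (s + \<sigma>))) has_vector_derivative 0) (at 0)"
      by (simp add: one_parameter Ad_mul_left)
  qed
  then have "Ad (s *\<^sub>R c) (d s) = Ad (0 *\<^sub>R c) (d 0)"
    by (rule constant_if_zero_derivative)
  then show ?thesis using assms(2) by (metis Ad_minus_cancel(1) Ad_zero)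
qed

text \<open>This is \<open>logd_cocycle\<close> differentiated in \<sigma> at 0; the inhomogeneous
  term \<open>v\<close> comes from \<open>logd 0 v = v\<close>.\<close>

lemma logd_ode: 
  "((\<lambda>s. s *\<^sub>R logd (s *\<^sub>R u) v) has_vector_derivative v - br u (s *\<^sub>R logd (s *\<^sub>R u) v)) (at s)"
proof (rule shift_vector_derivative)
  have "((\<lambda>\<sigma>. logd (\<sigma> *\<^sub>R u) v) has_vector_derivative ddir (\<lambda>\<sigma>. logd (\<sigma> *\<^sub>R u) v) 1 0) (at 0)"
    using smooth_line_derivative[OF smooth_logd[of u v], of 0 1 0] by simp
  then have "((\<lambda>\<sigma>. \<sigma> *\<^sub>R logd (\<sigma> *\<^sub>R u) v) has_vector_derivative v) (at 0)"
    by (auto intro!: derivative_eq_intros simp: logd_zero)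
  from has_vector_derivative_add[OF Ad_br_minus this]
  show "((\<lambda>\<sigma>. (s + \<sigma>) *\<^sub>R logd ((s + \<sigma>) *\<^sub>R u) v) has_vector_derivative v - br u (s *\<^sub>R logd (s *\<^sub>R u) v)) (at 0)"
    unfolding logd_cocycle by simp
qed

text \<open>A Lie algebra endomorphism intertwines the logarithmic derivatives, since on rays these solve
  a linear differential equation written in terms of the bracket. Hence it maps the curve
  \<open>s \<mapsto> a \<diamondop> (s *\<^sub>R b)\<close>, which has constant logarithmic derivative, to a curve of the same kind.\<close>

lemma hom_logd:
  assumes \<delta>: "linear \<delta>" "\<And>a b. \<delta> (br a b) = br (\<delta> a) (\<delta> b)"
  shows "\<delta> (logd u v) = logd (\<delta> u) (\<delta> v)"
proof -
  \<comment> \<open>Both terms vanish at 0 and solve inhomogeneous equations with the same right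
    side \<open>\<delta> v\<close>, so their difference solves the homogeneous equation of
    \<open>br_ode_zero\<close>.\<close>
  define d where "d s = \<delta> (s *\<^sub>R logd (s *\<^sub>R u) v) - s *\<^sub>R logd (s *\<^sub>R \<delta> u) (\<delta> v)" for s
  have "d 1 = 0"
  proof (rule br_ode_zero)
    fix s
    have "(d has_vector_derivative \<delta> (v - br u (s *\<^sub>R logd (s *\<^sub>R u) v)) 
        - (\<delta> v - br (\<delta> u) (s *\<^sub>R logd (s *\<^sub>R \<delta> u) (\<delta> v)))) (at s)"
      unfolding d_def
      by (intro has_vector_derivative_diff logd_ode
          bounded_linear.has_vector_derivative[OF linear_linear[THEN iffD2, OF \<delta>(1)] logd_ode])
    then show "(d has_vector_derivative - br (\<delta> u) (d s)) (at s)"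
      by (simp add: d_def linear_diff[OF \<delta>(1)] \<delta>(2) bilinear_rsub[OF bilinear_br] algebra_simps)
  qed (simp add: d_def linear_0[OF \<delta>(1)])
  then show ?thesis by (simp add: d_def)
qed

lemma hom_mul:
  assumes \<delta>: "linear \<delta>" "\<And>a b. \<delta> (br a b) = br (\<delta> a) (\<delta> b)"
  shows "\<delta> (a \<diamondop> b) = \<delta> a \<diamondop> \<delta> b"
proof -
  have "\<delta> (a \<diamondop> (s *\<^sub>R b)) = \<delta> (a \<diamondop> (0 *\<^sub>R b)) \<diamondop> (s *\<^sub>R \<delta> b)" for s
  proof (rule constant_log_derivative[where u="\<lambda>s. \<delta> (a \<diamondop> (s *\<^sub>R b))"])
    fix s
    define c where "c s = a \<diamondop> (s *\<^sub>R b)" for s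
    define c' where "c' = ddir (\<lambda>y. a \<diamondop> y) b (0 + s *\<^sub>R b)"
    have c: "(c has_vector_derivative c') (at s)"
      using smooth_line_derivative[OF smooth_left_mul, of a 0 b s] by (simp add: c_def[abs_def] c'_def)
    have "(- c s) \<diamondop> c (s + \<sigma>) = \<sigma> *\<^sub>R b" for \<sigma>
      by (simp add: c_def one_parameter minus_mul_distrib mul_assoc)
    then have "((\<lambda>\<sigma>. \<sigma> *\<^sub>R b) has_vector_derivative logd (c s) c') (at 0)"
      using logd_curve[OF c] by simp
    moreover have "((\<lambda>\<sigma>. \<sigma> *\<^sub>R b) has_vector_derivative b) (at 0)" by (auto intro!: derivative_eq_intros)
    ultimately have "logd (c s) c' = b" by (rule vector_derivative_unique)
    then have "logd (\<delta> (c s)) (\<delta> c') = \<delta> b" by (simp add: hom_logd[OF \<delta>, symmetric])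
    then show "((\<lambda>\<sigma>. (- \<delta> (a \<diamondop> (s *\<^sub>R b))) \<diamondop> \<delta> (a \<diamondop> ((s + \<sigma>) *\<^sub>R b))) has_vector_derivative \<delta> b) (at 0)"
      using logd_curve[OF bounded_linear.has_vector_derivative[OF linear_linear[THEN iffD2, OF \<delta>(1)] c]]
      by (simp add: c_def)
  qed
  from this[of 1] show ?thesis by simp
qed

end

section \<open>Left invariant vector fields\<close>

definition test :: "('a::euclidean_space \<Rightarrow> real) \<Rightarrow> bool" where
  "test F \<longleftrightarrow> smooth F \<and> (\<exists>S. compact S \<and> (\<forall>u. u \<notin> S \<longrightarrow> F u = 0))"

lemma test_smooth: "test F \<Longrightarrow> smooth F"
  by (simp add: test_def)

lemma test_zero: "test (\<lambda>u. 0)"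
  by (auto simp: test_def smooth_const intro: compact_empty)

lemma test_scale: "test F \<Longrightarrow> test (\<lambda>u. c * F u)"
  by (auto simp: test_def intro: smooth_mult smooth_const)

lemma test_add: assumes "test F" "test H" shows "test (\<lambda>u. F u + H u)"
proof -
  obtain S T where "compact S" "\<forall>u. u \<notin> S \<longrightarrow> F u = 0" "compact T" "\<forall>u. u \<notin> T \<longrightarrow> H u = 0"
    using assms by (auto simp: test_def)
  then show ?thesis using assms
    by (auto simp: test_def intro!: smooth_add exI[of _ "S \<union> T"] compact_Un)
qed

lemma test_sum: "finite I \<Longrightarrow> (\<And>i. i \<in> I \<Longrightarrow> test (F i)) \<Longrightarrow> test (\<lambda>u. \<Sum>i\<in>I. F i u)"
  by (induction I rule: finite_induct) (auto simp: test_zero test_add)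

lemma test_bounded: assumes "test F" shows "\<exists>K\<ge>0. \<forall>u. \<bar>F u\<bar> \<le> K"
proof -
  obtain S where S: "compact S" "\<forall>u. u \<notin> S \<longrightarrow> F u = 0" using assms by (auto simp: test_def)
  have "bounded (F ` S)"
    by (intro compact_imp_bounded compact_continuous_image smooth_continuous_on test_smooth assms S)
  then obtain K where K: "\<And>u. u \<in> S \<Longrightarrow> \<bar>F u\<bar> \<le> K" by (auto simp: bounded_iff)
  show ?thesis
  proof (intro exI[of _ "max K 0"] conjI allI)
    show "\<bar>F u\<bar> \<le> max K 0" for u using K[of u] S(2) by (cases "u \<in> S") auto
  qed simp
qed

lemma (in log_group) smooth_translate: "smooth F \<Longrightarrow> smooth (\<lambda>u. F (u \<diamondop> z))"
  by (rule smooth_compose[OF _ smooth_right_mul])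

lemma (in log_group) test_translate: assumes "test F" shows "test (\<lambda>u. F (u \<diamondop> z))"
proof -
  obtain S where S: "compact S" "\<forall>u. u \<notin> S \<longrightarrow> F u = 0" using assms by (auto simp: test_def)
  have "compact ((\<lambda>u. u \<diamondop> (- z)) ` S)"
    by (intro compact_continuous_image smooth_continuous_on smooth_right_mul S)
  moreover have "F (u \<diamondop> z) = 0" if "u \<notin> (\<lambda>u. u \<diamondop> (- z)) ` S" for u
  proof -
    have "u = (u \<diamondop> z) \<diamondop> (- z)" by (simp add: mul_assoc)
    then show ?thesis using S that by blast
  qed
  ultimately show ?thesis using assms by (auto simp: test_def intro!: smooth_translate)
qed

section \<open>Single and iterated left invariant derivatives\<close>

context log_group begin

definition vf :: "'a \<Rightarrow> ('a \<Rightarrow> real) \<Rightarrow> 'a \<Rightarrow> real" where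
  "vf a F u = deriv (\<lambda>s. F (u \<diamondop> (s *\<^sub>R a))) 0"

lemma vf_eq: assumes "smooth F" shows "vf a F u = ddir (\<lambda>b. F (u \<diamondop> b)) a 0"
proof -
  have "smooth (\<lambda>b. F (u \<diamondop> b))" by (intro smooth_compose[OF assms] smooth_left_mul)
  from smooth_line_derivative[OF this, of 0 a 0] show ?thesis
    by (auto simp: vf_def has_real_derivative_iff_has_vector_derivative[symmetric] intro: DERIV_imp_deriv)
qed

lemma vf_has_derivative: 
  assumes "smooth F" shows "((\<lambda>s. F (u \<diamondop> (s *\<^sub>R a))) has_real_derivative vf a F u) (at 0)"
proof -
  have "smooth (\<lambda>b. F (u \<diamondop> b))" by (intro smooth_compose[OF assms] smooth_left_mul)
  from smooth_line_derivative[OF this, of 0 a 0] show ?thesis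
    by (simp add: vf_eq[OF assms] has_real_derivative_iff_has_vector_derivative)
qed

lemma vf_line: 
  assumes "smooth F" 
  shows "((\<lambda>s. F (u \<diamondop> (s *\<^sub>R a))) has_real_derivative vf a F (u \<diamondop> (s *\<^sub>R a))) (at s)"
  unfolding has_real_derivative_iff_has_vector_derivative
  by (rule shift_vector_derivative) 
    (use vf_has_derivative[OF assms, of "u \<diamondop> (s *\<^sub>R a)" a] in
      \<open>simp add: one_parameter mul_assoc has_real_derivative_iff_has_vector_derivative\<close>)

lemma linear_vf: "smooth F \<Longrightarrow> linear (\<lambda>a. vf a F u)"
  unfolding vf_eq by (intro linear_frechet_derivative smooth_differentiable smooth_compose[OF _ smooth_left_mul])

lemma smooth_vf: assumes F: "smooth F" shows "smooth (vf a F)"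
proof -
  have sm: "smooth (\<lambda>(u, b). F (u \<diamondop> b))"
    unfolding split_def by (intro smooth_compose[OF F] smooth_mul' smooth_fst smooth_snd)
  have "vf a F u = frechet_derivative (\<lambda>(u, b). F (u \<diamondop> b)) (at (u, 0)) (0, a)" for u
    using vf_has_derivative[OF F] 
    by (intro ddir_eqI[OF sm, symmetric]) (simp add: has_real_derivative_iff_has_vector_derivative)
  then have "vf a F = (\<lambda>u. frechet_derivative (\<lambda>(u, b). F (u \<diamondop> b)) (at (u, 0)) (0, a))" by blast
  then show ?thesis by (simp only:) (intro smooth_frechet[OF sm] smooth_Pair smooth_const smooth_id)
qed

lemma vf_add: "smooth F \<Longrightarrow> smooth H \<Longrightarrow> vf a (\<lambda>u. F u + H u) u = vf a F u + vf a H u"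
  unfolding vf_def[of _ "\<lambda>u. F u + H u"]
  by (intro DERIV_imp_deriv DERIV_add vf_has_derivative)

lemma vf_scale: "smooth F \<Longrightarrow> vf a (\<lambda>u. c * F u) u = c * vf a F u"
  unfolding vf_def[of _ "\<lambda>u. c * F u"]
  by (intro DERIV_imp_deriv DERIV_cmult vf_has_derivative)

lemma vf_zero: "vf a (\<lambda>u. 0) = (\<lambda>u. 0)"
  by (simp add: vf_def fun_eq_iff)

text \<open>To act after the translation, the increment along \<open>a\<close> has to be moved past
  \<open>z\<close>, which conjugates it. All adjoint factors in the estimates originate
  here.\<close>

lemma vf_translate: "vf a (\<lambda>u. F (u \<diamondop> z)) = (\<lambda>u. vf (Ad (- z) a) F (u \<diamondop> z))"
proof -
  have "u \<diamondop> (s *\<^sub>R a) \<diamondop> z = u \<diamondop> z \<diamondop> (s *\<^sub>R Ad (- z) a)" for s u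
    using mul_eq_Ad'[of "s *\<^sub>R a" z] by (simp add: mul_assoc Ad_scaleR)
  then show ?thesis by (simp add: vf_def fun_eq_iff)
qed

lemma test_vf: assumes F: "test F" shows "test (vf a F)"
proof -
  obtain S where S: "compact S" "\<forall>u. u \<notin> S \<longrightarrow> F u = 0" using assms by (auto simp: test_def)
  have "vf a F u = 0" if u: "u \<notin> S" for u
  proof -
    have "((\<lambda>s. u \<diamondop> (s *\<^sub>R a)) \<longlongrightarrow> u \<diamondop> (0 *\<^sub>R a)) (at 0)"
      using has_vector_derivative_continuous[OF smooth_line_derivative[OF smooth_left_mul[of u], of 0 a 0]]
      by (simp add: isCont_def)
    moreover have "open (- S)" "u \<diamondop> (0 *\<^sub>R a) \<in> - S" using S u by (auto dest: compact_imp_closed)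
    ultimately have "eventually (\<lambda>s. u \<diamondop> (s *\<^sub>R a) \<in> - S) (at 0)"
      by (rule topological_tendstoD)
    then have "eventually (\<lambda>s. F (u \<diamondop> (s *\<^sub>R a)) = 0) (nhds 0)"
      unfolding eventually_at_filter using S(2) u by (auto elim!: eventually_mono)
    then have "deriv (\<lambda>s. F (u \<diamondop> (s *\<^sub>R a))) 0 = deriv (\<lambda>s. 0) 0"
      by (rule deriv_cong_ev) simp
    then show ?thesis by (simp add: vf_def)
  qed
  with S show ?thesis using smooth_vf[OF test_smooth[OF F]] by (auto simp: test_def)
qed

text \<open>The head of the list is the outermost derivative, so a vector appended at the end acts
  on \<open>F\<close> before the others. Increments of the walk enter at that end, as in
  \<open>vs @ [w]\<close>.\<close>

definition vfs :: "'a list \<Rightarrow> ('a \<Rightarrow> real) \<Rightarrow> 'a \<Rightarrow> real" where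
  "vfs vs F = foldr vf vs F"

lemma vfs_Nil [simp]: "vfs [] F = F" and vfs_Cons [simp]: "vfs (v # vs) F = vf v (vfs vs F)"
  and vfs_append: "vfs (vs @ ws) F = vfs vs (vfs ws F)"
  by (simp_all add: vfs_def)

lemma smooth_vfs: "smooth F \<Longrightarrow> smooth (vfs vs F)"
  by (induction vs) (auto intro: smooth_vf)

lemma vfs_add: 
  assumes "smooth F" "smooth H" shows "vfs vs (\<lambda>u. F u + H u) = (\<lambda>u. vfs vs F u + vfs vs H u)"
  by (induction vs) (auto simp: vf_add smooth_vfs assms)

lemma vfs_scale: 
  assumes "smooth F" shows "vfs vs (\<lambda>u. c * F u) = (\<lambda>u. c * vfs vs F u)"
  by (induction vs) (auto simp: vf_scale smooth_vfs assms)

lemma vfs_zero: "vfs vs (\<lambda>u. 0) = (\<lambda>u. 0)"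
  by (induction vs) (auto simp: vf_zero)

lemma vfs_sum: 
  "finite I \<Longrightarrow> (\<And>i. i \<in> I \<Longrightarrow> smooth (F i)) \<Longrightarrow> 
    vfs vs (\<lambda>u. \<Sum>i\<in>I. c i * F i u) = (\<lambda>u. \<Sum>i\<in>I. c i * vfs vs (F i) u)"
  by (induction I rule: finite_induct) 
     (auto simp: vfs_zero vfs_add vfs_scale smooth_sum smooth_mult smooth_const)

lemma vfs_diff: 
  assumes "smooth F" "smooth H" shows "vfs vs (\<lambda>u. F u - H u) = (\<lambda>u. vfs vs F u - vfs vs H u)"
  using vfs_add[OF assms(1), of "\<lambda>u. (-1) * H u" vs] vfs_scale[OF assms(2), of vs "-1"]
  by (simp add: smooth_minus assms)

text \<open>Linearity in the innermost direction lets an average of derivatives along increments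
  become one derivative along the mean increment, where centering can act.\<close>

lemma vfs_snoc_sum:
  assumes "smooth F" "finite I" 
  shows "vfs (vs @ [(\<Sum>i\<in>I. c i *\<^sub>R w i)]) F u = (\<Sum>i\<in>I. c i * vfs (vs @ [w i]) F u)"
proof -
  have "vf (\<Sum>i\<in>I. c i *\<^sub>R w i) F = (\<lambda>u. \<Sum>i\<in>I. c i * vf (w i) F u)"
    by (rule ext, subst linear_sum[OF linear_vf[OF assms(1)]]) (simp add: linear_scale[OF linear_vf[OF assms(1)]])
  then show ?thesis using assms by (simp add: vfs_append vfs_sum smooth_vf)
qed

lemma vfs_translate: 
  "vfs vs (\<lambda>u. F (u \<diamondop> z)) = (\<lambda>u. vfs (map (Ad (- z)) vs) F (u \<diamondop> z))"
  by (induction vs) (simp_all add: vf_translate)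

text \<open>The map \<open>L\<close> is jointly smooth in parameter, point and group increment. The
  parameter derivative and the left invariant derivative are directional derivatives of
  \<open>L\<close>, so they commute.\<close>

lemma vf_param:
  fixes K :: "real \<Rightarrow> 'a \<Rightarrow> real"
  assumes sm: "smooth (\<lambda>(s, u). K s u)" 
    and K': "\<And>s u. ((\<lambda>s. K s u) has_real_derivative K' s u) (at s)"
  shows "smooth (\<lambda>(s, u). vf a (K s) u)" "smooth (\<lambda>(s, u). K' s u)"
    "((\<lambda>s. vf a (K s) u) has_real_derivative vf a (K' s) u) (at s)"
proof -
  have smK: "smooth (K s)" for s
    using smooth_compose[OF sm smooth_Pair[OF smooth_const[of s] smooth_id]] by simp
  have "(\<lambda>(s, u). K' s u) = ddir (\<lambda>(s, u). K s u) (1, 0)"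
    using K' by (auto simp: fun_eq_iff has_real_derivative_iff_has_vector_derivative 
        intro!: ddir_eqI[OF sm, symmetric] vector_derivative_shift)
  then show sm': "smooth (\<lambda>(s, u). K' s u)" using smooth_ddir[OF sm] by simp
  have smK': "smooth (K' s)" for s
    using smooth_compose[OF sm' smooth_Pair[OF smooth_const[of s] smooth_id]] by simp
  define L where "L = (\<lambda>(s, u, b). K s (u \<diamondop> b))"
  have L: "smooth L" 
    using smooth_compose[OF sm smooth_Pair[OF smooth_fst smooth_mul'[of "\<lambda>p. fst (snd p)" "\<lambda>p. snd (snd p)"]]]
    by (simp add: L_def split_def smooth_compose[OF smooth_fst smooth_snd] smooth_compose[OF smooth_snd smooth_snd])
  have 1: "ddir L (0, 0, a) (s, u, 0) = vf a (K s) u" for s u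
    using vf_has_derivative[OF smK] 
    by (intro ddir_eqI[OF L]) (simp add: L_def has_real_derivative_iff_has_vector_derivative)
  have 2: "ddir L (1, 0, 0) (s, u, b) = K' s (u \<diamondop> b)" for s u b
    using vector_derivative_shift[OF K'[unfolded has_real_derivative_iff_has_vector_derivative]]
    by (intro ddir_eqI[OF L]) (simp add: L_def)
  have 3: "ddir (ddir L (1, 0, 0)) (0, 0, a) (s, u, 0) = vf a (K' s) u" for s u
    using vf_has_derivative[OF smK'] 
    by (intro ddir_eqI[OF smooth_ddir[OF L]]) (simp add: 2 has_real_derivative_iff_has_vector_derivative)
  show "smooth (\<lambda>(s, u). vf a (K s) u)"
    using smooth_compose[OF smooth_ddir[OF L, of "(0, 0, a)"] smooth_Pair[OF smooth_fst smooth_Pair[OF smooth_snd smooth_const[of 0]]]]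
    by (simp add: 1 split_def)
  show "((\<lambda>s. vf a (K s) u) has_real_derivative vf a (K' s) u) (at s)"
    using smooth_line_derivative[OF smooth_ddir[OF L, of "(0, 0, a)"], of "(0, u, 0)" "(1, 0, 0)" s]
    by (simp add: 1 ddir_commute_real[OF L, where u="(0, 0, a)" and v="(1, 0, 0)"] 3 has_real_derivative_iff_has_vector_derivative)
qed

lemma vfs_param:
  fixes K :: "real \<Rightarrow> 'a \<Rightarrow> real"
  assumes sm: "smooth (\<lambda>(s, u). K s u)" 
    and K': "\<And>s u. ((\<lambda>s. K s u) has_real_derivative K' s u) (at s)"
  shows "smooth (\<lambda>(s, u). vfs vs (K s) u) \<and>
    (\<forall>s u. ((\<lambda>s. vfs vs (K s) u) has_real_derivative vfs vs (K' s) u) (at s))"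
proof (induction vs)
  case (Cons v vs)
  then have 1: "smooth (\<lambda>(s, u). vfs vs (K s) u)" 
    and 2: "\<And>s u. ((\<lambda>s. vfs vs (K s) u) has_real_derivative vfs vs (K' s) u) (at s)" by auto
  from vf_param(1,3)[OF 1 2] show ?case by simp
qed (use assms in simp)

lemma vfs_translate_derivative:
  assumes F: "smooth F" 
  shows "((\<lambda>s. vfs vs (\<lambda>u. F (u \<diamondop> (s *\<^sub>R w))) u) has_real_derivative
          vfs vs (\<lambda>u. vf w F (u \<diamondop> (s *\<^sub>R w))) u) (at s)"
proof -
  have "smooth (\<lambda>p. F (snd p \<diamondop> (fst p *\<^sub>R w)))"
    by (intro smooth_compose[OF F] smooth_mul' smooth_snd smooth_scaleR smooth_fst smooth_const)
  then show ?thesis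
    using vfs_param[of "\<lambda>s u. F (u \<diamondop> (s *\<^sub>R w))", OF _ vf_line[OF F]] by (simp add: split_def)
qed

text \<open>Maclaurin's formula in the length \<open>s\<close> of the translation: each derivative
  in \<open>s\<close> appends one more \<open>w\<close>. In the remainder the translation is taken
  out of the outer derivatives, which conjugates them.\<close>

lemma vfs_taylor:
  assumes F: "smooth F" and n: "0 < n"
  shows "\<exists>s\<in>{0<..<1}. vfs vs (\<lambda>u. F (u \<diamondop> w)) u =
    (\<Sum>m<n. vfs (vs @ replicate m w) F u / fact m) +
    vfs (map (Ad (- (s *\<^sub>R w))) vs @ replicate n w) F (u \<diamondop> (s *\<^sub>R w)) / fact n"
proof -
  define diff where "diff m s = vfs vs (\<lambda>u. vfs (replicate m w) F (u \<diamondop> (s *\<^sub>R w))) u" for m s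
  have "(diff m has_real_derivative diff (Suc m) s) (at s)" for m s
    unfolding diff_def using vfs_translate_derivative[OF smooth_vfs[OF F], of vs "replicate m w" w u s]
    by simp
  then obtain s where s: "0 < s" "s < 1" "diff 0 1 = (\<Sum>m<n. diff m 0 / fact m * 1 ^ m) + diff n s / fact n * 1 ^ n"
    using Maclaurin[of 1 n diff "diff 0"] n by auto
  show ?thesis
  proof (intro bexI[of _ s])
    show "vfs vs (\<lambda>u. F (u \<diamondop> w)) u = (\<Sum>m<n. vfs (vs @ replicate m w) F u / fact m) +
       vfs (map (Ad (- (s *\<^sub>R w))) vs @ replicate n w) F (u \<diamondop> (s *\<^sub>R w)) / fact n"
      using s(3) by (simp add: diff_def vfs_append vfs_translate)
  qed (use s in auto)
qed

text \<open>A uniform bound on the \<open>j\<close>-fold derivative as a multilinear form.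
  Quantifying over all direction lists instead of basis vectors allows the effect of
  \<open>Ad\<close> to be followed separately for each direction.\<close>

definition vbound :: "real \<Rightarrow> nat \<Rightarrow> ('a \<Rightarrow> real) \<Rightarrow> bool" where
  "vbound K j F \<longleftrightarrow> (\<forall>vs u. length vs = j \<longrightarrow> \<bar>vfs vs F u\<bar> \<le> K * prod_list (map norm vs))"

lemma vboundD: "vbound K j F \<Longrightarrow> length vs = j \<Longrightarrow> \<bar>vfs vs F u\<bar> \<le> K * prod_list (map norm vs)"
  by (simp add: vbound_def)

lemma prod_list_norm_nonneg: "0 \<le> prod_list (map norm vs)"
  by (induction vs) auto

lemma vbound_mono: "vbound K j F \<Longrightarrow> K \<le> K' \<Longrightarrow> vbound K' j F"
  unfolding vbound_def by (intro allI impI, rule order_trans[OF _ mult_right_mono[of K K']])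
    (auto simp: prod_list_norm_nonneg)

text \<open>Compact support bounds the derivative for fixed directions only. Peeling off the
  innermost direction and expanding it in \<open>Basis\<close> makes the bound uniform.\<close>

lemma test_vbound: "test F \<Longrightarrow> \<exists>K\<ge>0. vbound K j F"
proof (induction j arbitrary: F)
  case 0
  then show ?case using test_bounded by (auto simp: vbound_def)
next
  case (Suc j)
  have "\<exists>K\<ge>0. vbound K j (vf b F)" for b using Suc test_vf by blast
  then obtain K where K: "\<And>b. 0 \<le> K b" "\<And>b. vbound (K b) j (vf b F)" by metis
  have "vbound (\<Sum>b\<in>Basis. K b) (Suc j) F"
    unfolding vbound_def
  proof (intro allI impI)
    fix vs :: "'a list" and u assume "length vs = Suc j"
    then obtain ws w where vs: "vs = ws @ [w]" and ws: "length ws = j" by (metis length_Suc_conv_rev)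
    have "vfs vs F u = (\<Sum>b\<in>Basis. (w \<bullet> b) * vfs (ws @ [b]) F u)"
      using vfs_snoc_sum[OF test_smooth[OF Suc.prems], of Basis ws "\<lambda>b. w \<bullet> b" "\<lambda>b. b" u]
      by (simp add: vs euclidean_representation)
    also have "\<bar>\<dots>\<bar> \<le> (\<Sum>b\<in>Basis. norm w * (K b * prod_list (map norm ws)))"
      by (rule order_trans[OF sum_abs], rule sum_mono, unfold abs_mult, rule mult_mono)
         (use vboundD[OF K(2) ws] in \<open>auto simp: Basis_le_norm vfs_append\<close>)
    finally show "\<bar>vfs vs F u\<bar> \<le> (\<Sum>b\<in>Basis. K b) * prod_list (map norm vs)"
      by (simp add: vs sum_distrib_left sum_distrib_right mult_ac)
  qed
  then show ?case using K(1) by (intro exI[of _ "\<Sum>b\<in>Basis. K b"]) (auto intro: sum_nonneg)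
qed

lemma Ad_bound: "\<exists>C\<ge>1. \<forall>w v. norm w \<le> R \<longrightarrow> norm (Ad (- w) v) \<le> C * norm v"
proof -
  have "\<exists>B. \<forall>w\<in>cball 0 R. norm (Ad (- w) b) \<le> B" for b
  proof -
    have "bounded ((\<lambda>w. Ad (- w) b) ` cball 0 R)"
      by (intro compact_imp_bounded compact_continuous_image smooth_continuous_on smooth_Ad smooth_minus 
          smooth_const smooth_id compact_cball)
    then show ?thesis by (auto simp: bounded_iff)
  qed
  then obtain B where B: "\<And>b w. w \<in> cball 0 R \<Longrightarrow> norm (Ad (- w) b) \<le> B b" by metis
  have "norm (Ad (- w) v) \<le> (1 + (\<Sum>b\<in>Basis. \<bar>B b\<bar>)) * norm v" if w: "norm w \<le> R" for v w
  proof -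
    have "norm (Ad (- w) v) = norm (\<Sum>b\<in>Basis. (v \<bullet> b) *\<^sub>R Ad (- w) b)"
      by (subst linear_expand_Basis[OF linear_Ad]) simp
    also have "\<dots> \<le> (\<Sum>b\<in>Basis. norm v * \<bar>B b\<bar>)"
      by (rule order_trans[OF norm_sum], rule sum_mono, unfold norm_scaleR,
          rule mult_mono) (use B[of w] w in \<open>auto simp: Basis_le_norm intro: order_trans[OF _ abs_ge_self]\<close>)
    also have "\<dots> \<le> (1 + (\<Sum>b\<in>Basis. \<bar>B b\<bar>)) * norm v"
      by (simp add: sum_distrib_left mult.commute algebra_simps)
    finally show ?thesis .
  qed
  then show ?thesis by (intro exI[of _ "1 + (\<Sum>b\<in>Basis. \<bar>B b\<bar>)"]) (auto intro: sum_nonneg)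
qed

lemma prod_list_norm_map_Ad:
  assumes "\<And>v. norm (Ad z v) \<le> C * norm v" "0 \<le> C"
  shows "prod_list (map norm (map (Ad z) vs)) \<le> C ^ length vs * prod_list (map norm vs)"
proof (induction vs)
  case (Cons v vs)
  have "norm (Ad z v) * prod_list (map norm (map (Ad z) vs)) 
      \<le> (C * norm v) * (C ^ length vs * prod_list (map norm vs))"
    by (intro mult_mono assms Cons.IH prod_list_norm_nonneg) (use assms in auto)
  then show ?case by (simp add: mult_ac)
qed simp

lemma prod_list_replicate_norm: "prod_list (map norm (replicate n w)) = norm w ^ n"
  by (induction n) auto

text \<open>Uniform Taylor remainder: \<open>F\<close> enters only through its \<open>vbound\<close>.\<close>

lemma vfs_taylor_bound:
  "\<exists>C\<ge>0. \<forall>F K vs w u. smooth F \<longrightarrow> vbound K (length vs + n) F \<longrightarrow> 0 \<le> K \<longrightarrow> norm w \<le> R \<longrightarrow> length vs = j \<longrightarrow> 0 < n \<longrightarrow>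
     \<bar>vfs vs (\<lambda>u. F (u \<diamondop> w)) u - (\<Sum>m<n. vfs (vs @ replicate m w) F u / fact m)\<bar>
       \<le> C * K * prod_list (map norm vs) * norm w ^ n"
proof -
  obtain B where B: "B \<ge> 1" "\<And>w v. norm w \<le> R \<Longrightarrow> norm (Ad (- w) v) \<le> B * norm v"
    using Ad_bound[of R] by blast
  show ?thesis
  \<comment> \<open>One factor \<open>B\<close> for each of the \<open>j\<close> outer directions,
    which are conjugated in the Taylor remainder; the factor \<open>1 / fact n\<close> is given
    away.\<close>
  proof (intro exI[of _ "B ^ j"] conjI allI impI)
    fix F :: "'a \<Rightarrow> real" and K :: real and vs :: "'a list" and w u :: 'a
    assume F: "smooth F" and K: "vbound K (length vs + n) F" "0 \<le> K" and w: "norm w \<le> R" 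
      and j: "length vs = j" and n: "0 < n"
    obtain s where s: "s \<in> {0<..<1}" and eq: "vfs vs (\<lambda>u. F (u \<diamondop> w)) u =
      (\<Sum>m<n. vfs (vs @ replicate m w) F u / fact m) +
      vfs (map (Ad (- (s *\<^sub>R w))) vs @ replicate n w) F (u \<diamondop> (s *\<^sub>R w)) / fact n"
      using vfs_taylor[OF F n, of vs w u] by blast
    have sw: "norm (s *\<^sub>R w) \<le> R" using s w 
      by simp (metis abs_of_pos less_eq_real_def mult_left_le_one_le norm_ge_zero order_trans)
    let ?r = "vfs (map (Ad (- (s *\<^sub>R w))) vs @ replicate n w) F (u \<diamondop> (s *\<^sub>R w))"
    have "\<bar>?r\<bar> \<le> K * prod_list (map norm (map (Ad (- (s *\<^sub>R w))) vs @ replicate n w))"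
      by (rule vboundD[OF K(1)]) simp
    also have "\<dots> = K * (prod_list (map norm (map (Ad (- (s *\<^sub>R w))) vs)) * norm w ^ n)"
      by (simp add: prod_list_replicate_norm del: map_map map_replicate)
    also have "\<dots> \<le> K * ((B ^ length vs * prod_list (map norm vs)) * norm w ^ n)"
      by (intro mult_left_mono mult_right_mono prod_list_norm_map_Ad B sw K) (use B in auto)
    finally have r: "\<bar>?r\<bar> \<le> B ^ j * K * prod_list (map norm vs) * norm w ^ n" by (simp add: j mult_ac)
    have "\<bar>?r / fact n\<bar> \<le> \<bar>?r\<bar>"
      by (simp add: divide_le_eq mult_left_le_one_le abs_mult) (simp add: mult_le_cancel_left1)
    then show "\<bar>vfs vs (\<lambda>u. F (u \<diamondop> w)) u - (\<Sum>m<n. vfs (vs @ replicate m w) F u / fact m)\<bar>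
       \<le> B ^ j * K * prod_list (map norm vs) * norm w ^ n"
      using r unfolding eq by linarith
  qed (use B in auto)
qed

text \<open>Linear functionals \<open>F\<close> separate vectors, and \<open>vf v F 0\<close>
  returns the value of the functional at \<open>v\<close>. Both iterated fields become second
  derivatives of \<open>F (x y)\<close> at the origin; their mixed parts cancel by symmetry, and
  what is left is the derivative of \<open>Ad\<close>.\<close>

lemma Ad_derivative_bracket:
  assumes comm: "\<And>F. smooth F \<Longrightarrow> vf c F 0 = vf a (vf b F) 0 - vf b (vf a F) 0"
  shows "((\<lambda>s. Ad (s *\<^sub>R a) b) has_vector_derivative c) (at 0)"
proof -
  define w where "w = ddir (\<lambda>z. Ad z b) a 0"
  have "smooth (\<lambda>z. Ad z b)" by (intro smooth_Ad smooth_id smooth_const)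
  from smooth_line_derivative[OF this, of 0 a 0]
  have w: "((\<lambda>s. Ad (s *\<^sub>R a) b) has_vector_derivative w) (at 0)" by (simp add: w_def)
  have "w = c"
  proof (rule euclidean_eqI)
    fix e :: 'a
    define F where "F u = u \<bullet> e" for u :: 'a
    have F: "smooth F" unfolding F_def by (intro smooth_inner smooth_id smooth_const)
    define N where "N = (\<lambda>(x, y). F (x \<diamondop> y))"
    have N: "smooth N" unfolding N_def split_def
      by (intro smooth_compose[OF F] smooth_mul' smooth_fst smooth_snd)
    have vf0: "vf v F 0 = v \<bullet> e" for v
      unfolding vf_def F_def by (auto intro!: DERIV_imp_deriv derivative_eq_intros)
    have a1: "vf a F x = ddir N (0, a) (x, 0)" for x
      using vf_has_derivative[OF F, of x a]
      by (intro ddir_eqI[OF N, symmetric]) (simp add: N_def has_real_derivative_iff_has_vector_derivative)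
    have ba: "vf b (vf a F) 0 = ddir (ddir N (0, a)) (b, 0) (0, 0)"
      using vf_has_derivative[OF smooth_vf[OF F, of a], of 0 b]
      by (intro ddir_eqI[OF smooth_ddir[OF N], symmetric]) (simp add: a1 has_real_derivative_iff_has_vector_derivative)
    \<comment> \<open>Moving the increment along \<open>b\<close> to the left of
      \<open>s *\<^sub>R a\<close> conjugates it, so the field becomes a derivative of
      \<open>N\<close> in its left argument.\<close>
    have b1: "vf b F (s *\<^sub>R a) = frechet_derivative N (at (0, s *\<^sub>R a)) (Ad (s *\<^sub>R a) b, 0)" for s
      using vf_has_derivative[OF F, of "s *\<^sub>R a" b] 
      by (intro ddir_eqI[OF N, symmetric]) 
         (simp add: N_def has_real_derivative_iff_has_vector_derivative Ad_scaleR[symmetric] mul_eq_Ad[symmetric])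
    \<comment> \<open>Separates the two ways in which \<open>s\<close> enters \<open>b1\<close>,
      through the conjugated direction and through the base point, so that the derivative splits
      into two terms.\<close>
    define P where "P = (\<lambda>(x, y). frechet_derivative N (at (0, y)) (x, 0))"
    have P: "smooth P" unfolding P_def split_def 
      by (intro smooth_frechet[OF N] smooth_Pair smooth_fst smooth_snd smooth_const)
    let ?D = "frechet_derivative P (at (b, 0))"
    have "((\<lambda>s. s *\<^sub>R a) has_vector_derivative a) (at 0)" by (auto intro!: derivative_eq_intros)
    then have "((\<lambda>s. P (Ad (s *\<^sub>R a) b, s *\<^sub>R a)) has_vector_derivative ?D (w, a)) (at 0)"
      using smooth_curve_derivative[OF P has_vector_derivative_Pair[OF w], of "\<lambda>s. s *\<^sub>R a" a]
      by simp
    moreover have "((\<lambda>s. vf b F (s *\<^sub>R a)) has_vector_derivative vf a (vf b F) 0) (at 0)"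
      using vf_has_derivative[OF smooth_vf[OF F, of b], of 0 a]
      by (simp add: has_real_derivative_iff_has_vector_derivative)
    ultimately have ab: "vf a (vf b F) 0 = ?D (w, a)"
      unfolding b1 P_def split_conv by (rule vector_derivative_unique[rotated])
    have "?D ((w, 0) + (0, a)) = ?D (w, 0) + ?D (0, a)"
      by (rule linear_add[OF frechet_linear[OF smooth_differentiable[OF P]]])
    moreover have "?D (w, 0) = w \<bullet> e"
    proof (rule ddir_eqI[OF P])
      have "P (x, 0) = x \<bullet> e" for x
        unfolding P_def split_conv
        by (rule ddir_eqI[OF N]) (auto simp: N_def F_def intro!: derivative_eq_intros)
      then show "((\<lambda>t. P ((b, 0) + t *\<^sub>R (w, 0))) has_vector_derivative w \<bullet> e) (at 0)"
        by (auto simp: inner_add_left intro!: derivative_eq_intros)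
    qed
    moreover have "?D (0, a) = ddir (ddir N (b, 0)) (0, a) (0, 0)"
      using smooth_line_derivative[OF smooth_ddir[OF N, of "(b, 0)"], of "(0, 0)" "(0, a)" 0]
      by (intro ddir_eqI[OF P]) (simp add: P_def)
    ultimately have "?D (w, a) = w \<bullet> e + vf b (vf a F) 0"
      by (simp add: ba ddir_commute_real[OF N])
    then show "w \<bullet> e = c \<bullet> e" using comm[OF F] by (simp add: vf0 ab)
  qed
  with w show ?thesis by simp
qed

end

section \<open>Random walks driven by a finite Markov chain\<close>

text \<open>The squared norm is expanded and compared with the square of
  \<open>1 + \<epsilon> l + c\<^sup>2 \<epsilon>\<^sup>2\<close>. A triangle inequality would
  replace the first order term by its absolute value; here it stays linear in \<open>x\<close> and
  can average to zero.\<close>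

lemma norm_perturbation:
  fixes v x y :: "'a::real_inner"
  assumes x: "norm x \<le> c * norm v" and y: "norm y \<le> c * \<epsilon>\<^sup>2 * norm v" and c: "0 \<le> c" and \<epsilon>: "0 \<le> \<epsilon>"
  shows "norm (v + \<epsilon> *\<^sub>R x + y) \<le> norm v * (1 + \<epsilon> * ((x \<bullet> v) / (norm v)\<^sup>2) + (c\<^sup>2 + c) * \<epsilon>\<^sup>2)"
proof (cases "v = 0")
  case True
  then show ?thesis using x y by simp
next
  case False
  define l where "l = (x \<bullet> v) / (norm v)\<^sup>2"
  have nv: "norm v > 0" using False by simp
  have xv: "x \<bullet> v = l * (norm v)\<^sup>2" using nv by (simp add: l_def)
  have "\<bar>x \<bullet> v\<bar> \<le> (c * norm v) * norm v"
    by (rule order_trans[OF Cauchy_Schwarz_ineq2]) (intro mult_right_mono x norm_ge_zero)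
  then have l: "\<bar>l\<bar> \<le> c" using nv 
    by (simp add: xv abs_mult power2_eq_square)
  have "\<epsilon> * \<bar>l\<bar> \<le> \<epsilon> * c" using l \<epsilon> by (intro mult_left_mono)
  moreover have "\<bar>\<epsilon> * l\<bar> = \<epsilon> * \<bar>l\<bar>" using \<epsilon> by (simp add: abs_mult)
  ultimately have el: "- (c * \<epsilon>) \<le> \<epsilon> * l" by (simp add: mult.commute)
  \<comment> \<open>Needed to extract the square root. It holds without any smallness of \<epsilon>
    because \<open>1 - a + a\<^sup>2\<close> is nonnegative for every real \<open>a\<close>, here
    with \<open>a = c * \<epsilon>\<close>.\<close>
  have pos: "0 \<le> 1 + \<epsilon> * l + c\<^sup>2 * \<epsilon>\<^sup>2"
  proof -
    have "0 \<le> (1 - c * \<epsilon>)\<^sup>2 + 1 + (c * \<epsilon>)\<^sup>2" by simp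
    also have "\<dots> = 2 * (1 - c * \<epsilon> + c\<^sup>2 * \<epsilon>\<^sup>2)" by (simp add: power2_eq_square algebra_simps)
    finally have "0 \<le> 1 - c * \<epsilon> + c\<^sup>2 * \<epsilon>\<^sup>2" by (simp only: zero_le_mult_iff) simp
    then show ?thesis using el by (simp add: algebra_simps)
  qed
  have "(norm x)\<^sup>2 \<le> (c * norm v)\<^sup>2" using x by (intro power_mono) auto
  then have "\<epsilon>\<^sup>2 * (norm x)\<^sup>2 \<le> \<epsilon>\<^sup>2 * (c * norm v)\<^sup>2" by (intro mult_left_mono) auto
  moreover have "(norm (v + \<epsilon> *\<^sub>R x))\<^sup>2 = (norm v)\<^sup>2 + 2 * \<epsilon> * (x \<bullet> v) + \<epsilon>\<^sup>2 * (norm x)\<^sup>2"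
    unfolding power2_norm_eq_inner
    by (simp add: inner_add_left inner_add_right inner_commute[of v x] power2_eq_square algebra_simps)
  ultimately have "(norm (v + \<epsilon> *\<^sub>R x))\<^sup>2 \<le> (norm v)\<^sup>2 + 2 * \<epsilon> * (x \<bullet> v) + \<epsilon>\<^sup>2 * (c * norm v)\<^sup>2" by linarith
  also have "\<dots> = (norm v)\<^sup>2 * (1 + 2 * (\<epsilon> * l) + c\<^sup>2 * \<epsilon>\<^sup>2)"
    by (simp add: xv algebra_simps power_mult_distrib)
  also have "\<dots> \<le> (norm v)\<^sup>2 * (1 + \<epsilon> * l + c\<^sup>2 * \<epsilon>\<^sup>2)\<^sup>2"
  proof (rule mult_left_mono)
    have "(1 + \<epsilon> * l + c\<^sup>2 * \<epsilon>\<^sup>2)\<^sup>2 = 1 + 2 * (\<epsilon> * l) + 2 * (c\<^sup>2 * \<epsilon>\<^sup>2) + (\<epsilon> * l + c\<^sup>2 * \<epsilon>\<^sup>2)\<^sup>2"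
      by (simp add: power2_eq_square algebra_simps)
    moreover have "0 \<le> (\<epsilon> * l + c\<^sup>2 * \<epsilon>\<^sup>2)\<^sup>2" "0 \<le> c\<^sup>2 * \<epsilon>\<^sup>2" by auto
    ultimately show "1 + 2 * (\<epsilon> * l) + c\<^sup>2 * \<epsilon>\<^sup>2 \<le> (1 + \<epsilon> * l + c\<^sup>2 * \<epsilon>\<^sup>2)\<^sup>2" by linarith
  qed simp
  also have "\<dots> = (norm v * (1 + \<epsilon> * l + c\<^sup>2 * \<epsilon>\<^sup>2))\<^sup>2" by (simp add: power_mult_distrib)
  finally have "norm (v + \<epsilon> *\<^sub>R x) \<le> norm v * (1 + \<epsilon> * l + c\<^sup>2 * \<epsilon>\<^sup>2)"
    by (rule power2_le_imp_le) (use pos in auto)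
  then have "norm (v + \<epsilon> *\<^sub>R x + y) \<le> norm v * (1 + \<epsilon> * l + c\<^sup>2 * \<epsilon>\<^sup>2) + c * \<epsilon>\<^sup>2 * norm v"
    using y norm_triangle_ineq[of "v + \<epsilon> *\<^sub>R x" y] by linarith
  also have "\<dots> = norm v * (1 + \<epsilon> * l + (c\<^sup>2 + c) * \<epsilon>\<^sup>2)" by (simp add: distrib_left distrib_right)
  finally show ?thesis unfolding l_def .
qed

text \<open>The first order part \<open>L\<close> is linear in the increment \<open>w\<close>, which
  is where means over edges are taken, while the remainder is relative to the size of
  \<open>v\<close>. Both come from linearizing at the basis vectors and expanding
  \<open>v\<close>.\<close>

lemma (in log_group) Ad_linearization:
  "\<exists>L C. 0 \<le> C \<and> (\<forall>v. linear (\<lambda>w. L w v)) \<and> (\<forall>w v. norm (L w v) \<le> C * norm w * norm v) \<and>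
     (\<forall>w v. norm w \<le> R \<longrightarrow> norm (Ad (- w) v - v - L w v) \<le> C * (norm w)\<^sup>2 * norm v)"
proof -
  have sm: "smooth (\<lambda>w. Ad (- w) b)" for b by (intro smooth_Ad smooth_minus smooth_id smooth_const)
  define D where "D b w = ddir (\<lambda>w. Ad (- w) b) w 0" for b w
  have D: "linear (D b)" for b
    unfolding D_def by (rule frechet_linear[OF smooth_differentiable[OF sm]])
  have "\<exists>C\<ge>0. \<forall>w. norm w \<le> R \<longrightarrow> norm (Ad (- w) b - b - D b w) \<le> C * (norm w)\<^sup>2" for b
    using smooth_linearization_bound[OF sm[of b], of R] by (simp add: D_def)
  then obtain C where C: "\<And>b. 0 \<le> C b" 
    "\<And>b w. norm w \<le> R \<Longrightarrow> norm (Ad (- w) b - b - D b w) \<le> C b * (norm w)\<^sup>2" by metis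
  have "\<exists>B>0. \<forall>w. norm (D b w) \<le> B * norm w" for b using linear_bounded_pos[OF D[of b]] by metis
  then obtain B where B: "\<And>b. 0 < B b" "\<And>b w. norm (D b w) \<le> B b * norm w" by metis
  define L where "L w v = (\<Sum>b\<in>Basis. (v \<bullet> b) *\<^sub>R D b w)" for w v
  define K where "K = (\<Sum>b\<in>Basis. B b + C b)"
  show ?thesis
  proof (intro exI[of _ L] exI[of _ K] conjI allI impI)
    show "0 \<le> K" unfolding K_def by (intro sum_nonneg add_nonneg_nonneg C less_imp_le[OF B(1)])
    show "linear (\<lambda>w. L w v)" for v
      unfolding L_def by (intro linear_compose_sum ballI linear_compose_scale_right D)
    show "norm (L w v) \<le> K * norm w * norm v" for w v
    proof -
      have "norm (L w v) \<le> (\<Sum>b\<in>Basis. norm v * ((B b + C b) * norm w))"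
        unfolding L_def 
        by (rule order_trans[OF norm_sum], rule sum_mono, unfold norm_scaleR, rule mult_mono)
           (use C(1) in \<open>auto simp: Basis_le_norm intro!: order_trans[OF B(2)] mult_right_mono\<close>)
      then show ?thesis by (simp add: K_def sum_distrib_left sum_distrib_right mult_ac)
    qed
    show "norm (Ad (- w) v - v - L w v) \<le> K * (norm w)\<^sup>2 * norm v" if w: "norm w \<le> R" for w v
    proof -
      have "(\<Sum>b\<in>Basis. (v \<bullet> b) *\<^sub>R (Ad (- w) b - b - D b w)) 
          = (\<Sum>b\<in>Basis. (v \<bullet> b) *\<^sub>R Ad (- w) b) - (\<Sum>b\<in>Basis. (v \<bullet> b) *\<^sub>R b) - L w v"
        by (simp only: L_def scaleR_diff_right sum_subtractf)
      also have "(\<Sum>b\<in>Basis. (v \<bullet> b) *\<^sub>R Ad (- w) b) = Ad (- w) v"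
        by (rule linear_expand_Basis[OF linear_Ad, symmetric])
      finally have eq: "Ad (- w) v - v - L w v = (\<Sum>b\<in>Basis. (v \<bullet> b) *\<^sub>R (Ad (- w) b - b - D b w))"
        by (simp only: euclidean_representation)
      have "norm (Ad (- w) v - v - L w v) \<le> (\<Sum>b\<in>Basis. norm v * ((B b + C b) * (norm w)\<^sup>2))"
        unfolding eq
        by (rule order_trans[OF norm_sum], rule sum_mono, unfold norm_scaleR, rule mult_mono)
           (use B(1) in \<open>auto simp: Basis_le_norm less_imp_le intro!: order_trans[OF C(2)[OF w]] mult_right_mono\<close>)
      then show ?thesis by (simp add: K_def sum_distrib_left sum_distrib_right mult_ac)
    qed
  qed
qed

text \<open>The step along the edge \<open>e\<close> at scale \<open>\<epsilon>\<close> is \<open>w \<epsilon> e = \<epsilon> z1 e + \<epsilon>\<^sup>2 z2 e + O(\<epsilon>\<^sup>3)\<close>.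
  The assumption \<open>poisson\<close> is the only consequence of irreducibility that is needed.\<close>

locale log_walk = log_group mul for mul :: "'a::euclidean_space \<Rightarrow> 'a \<Rightarrow> 'a"  (infixl \<open>\<diamondop>\<close> 70) +
  fixes V :: "'v set" and E :: "'e set" and src tgt :: "'e \<Rightarrow> 'v" and p :: "'e \<Rightarrow> real" and m :: "'v \<Rightarrow> real"
    and w :: "real \<Rightarrow> 'e \<Rightarrow> 'a" and z1 z2 :: "'e \<Rightarrow> 'a" and W :: real
  assumes finite_V: "finite V" and finite_E: "finite E"
    and tgt: "e \<in> E \<Longrightarrow> tgt e \<in> V" and src: "e \<in> E \<Longrightarrow> src e \<in> V"
    and p_nonneg: "e \<in> E \<Longrightarrow> 0 \<le> p e"
    and p_sum: "x \<in> V \<Longrightarrow> (\<Sum>e | e \<in> E \<and> src e = x. p e) = 1"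
    and m_nonneg: "x \<in> V \<Longrightarrow> 0 \<le> m x" and m_sum: "(\<Sum>x\<in>V. m x) = 1"
    and stationary: "(\<Sum>e\<in>E. p e * m (src e) * \<phi> (tgt e)) = (\<Sum>x\<in>V. m x * \<phi> x)"
    and poisson: "\<exists>C\<ge>0. \<forall>\<phi> d. (\<forall>x\<in>V. \<bar>(\<Sum>e | e \<in> E \<and> src e = x. p e * \<phi> (tgt e)) - \<phi> x\<bar> \<le> d) \<longrightarrow>
        (\<forall>x\<in>V. \<forall>y\<in>V. \<bar>\<phi> x - \<phi> y\<bar> \<le> C * d)"
    and z1_bound: "e \<in> E \<Longrightarrow> norm (z1 e) \<le> W" and z2_bound: "e \<in> E \<Longrightarrow> norm (z2 e) \<le> W"
    and w_expansion: "e \<in> E \<Longrightarrow> 0 < \<epsilon> \<Longrightarrow> \<epsilon> \<le> 1 \<Longrightarrow> 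
        norm (w \<epsilon> e - \<epsilon> *\<^sub>R z1 e - \<epsilon>\<^sup>2 *\<^sub>R z2 e) \<le> W * \<epsilon> ^ 3"
    and W_nonneg: "0 \<le> W"
    and centered: "x \<in> V \<Longrightarrow> (\<Sum>e | e \<in> E \<and> src e = x. p e *\<^sub>R z1 e) = 0"
begin

definition out :: "'v \<Rightarrow> 'e set" where "out x = {e. e \<in> E \<and> src e = x}"

lemma out: "finite (out x)" "e \<in> out x \<Longrightarrow> e \<in> E" "e \<in> out x \<Longrightarrow> src e = x" "e \<in> out x \<Longrightarrow> tgt e \<in> V"
  using finite_E tgt by (auto simp: out_def)

lemma p_out: "x \<in> V \<Longrightarrow> (\<Sum>e\<in>out x. p e) = 1"
  using p_sum by (simp add: out_def)

lemma centered_out: "x \<in> V \<Longrightarrow> (\<Sum>e\<in>out x. p e *\<^sub>R z1 e) = 0"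
  using centered by (simp add: out_def)

lemma sum_out: "(\<Sum>x\<in>V. \<Sum>e\<in>out x. h e) = (\<Sum>e\<in>E. h e)" for h :: "'e \<Rightarrow> 'b::comm_monoid_add"
  using sum.group[OF finite_E finite_V, of src h] src by (auto simp: out_def)

lemma average_bound: 
  assumes "x \<in> V" "\<And>e. e \<in> out x \<Longrightarrow> \<bar>h e\<bar> \<le> B"
  shows "\<bar>\<Sum>e\<in>out x. p e * h e\<bar> \<le> B"
proof -
  have "\<bar>\<Sum>e\<in>out x. p e * h e\<bar> \<le> (\<Sum>e\<in>out x. p e * B)"
    by (rule order_trans[OF sum_abs], rule sum_mono, unfold abs_mult)
       (use assms p_nonneg out in \<open>auto intro!: mult_mono\<close>)
  also have "\<dots> = B" using p_out[OF assms(1)] by (simp add: sum_distrib_right[symmetric])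
  finally show ?thesis .
qed

lemma average_bound_norm: 
  assumes "x \<in> V" "\<And>e. e \<in> out x \<Longrightarrow> norm (h e) \<le> B"
  shows "norm (\<Sum>e\<in>out x. p e *\<^sub>R h e) \<le> B"
proof -
  have "norm (\<Sum>e\<in>out x. p e *\<^sub>R h e) \<le> (\<Sum>e\<in>out x. p e * B)"
    by (rule order_trans[OF norm_sum], rule sum_mono, unfold norm_scaleR)
       (use assms p_nonneg out in \<open>auto intro!: mult_mono\<close>)
  also have "\<dots> = B" using p_out[OF assms(1)] by (simp add: sum_distrib_right[symmetric])
  finally show ?thesis .
qed

lemma w_first_order: 
  assumes "e \<in> E" "0 < \<epsilon>" "\<epsilon> \<le> 1" shows "norm (w \<epsilon> e - \<epsilon> *\<^sub>R z1 e) \<le> 2 * W * \<epsilon>\<^sup>2"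
proof -
  have "norm (w \<epsilon> e - \<epsilon> *\<^sub>R z1 e) \<le> norm (w \<epsilon> e - \<epsilon> *\<^sub>R z1 e - \<epsilon>\<^sup>2 *\<^sub>R z2 e) + norm (\<epsilon>\<^sup>2 *\<^sub>R z2 e)"
    using norm_triangle_ineq[of "w \<epsilon> e - \<epsilon> *\<^sub>R z1 e - \<epsilon>\<^sup>2 *\<^sub>R z2 e" "\<epsilon>\<^sup>2 *\<^sub>R z2 e"] by simp
  also have "\<dots> \<le> W * \<epsilon> ^ 3 + \<epsilon>\<^sup>2 * W"
    using w_expansion[OF assms] z2_bound[OF assms(1)] by (intro add_mono) (auto intro: mult_left_mono)
  also have "W * \<epsilon> ^ 3 \<le> W * \<epsilon> ^ 2"
    using assms W_nonneg by (intro mult_left_mono power_decreasing) auto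
  finally show ?thesis by simp
qed

lemma w_bound: 
  assumes "e \<in> E" "0 < \<epsilon>" "\<epsilon> \<le> 1" shows "norm (w \<epsilon> e) \<le> 3 * W * \<epsilon>"
proof -
  have "norm (w \<epsilon> e) \<le> norm (w \<epsilon> e - \<epsilon> *\<^sub>R z1 e) + norm (\<epsilon> *\<^sub>R z1 e)"
    using norm_triangle_ineq[of "w \<epsilon> e - \<epsilon> *\<^sub>R z1 e" "\<epsilon> *\<^sub>R z1 e"] by simp
  also have "\<dots> \<le> 2 * W * \<epsilon>\<^sup>2 + \<epsilon> * W"
    using w_first_order[OF assms] z1_bound[OF assms(1)] assms by (intro add_mono) (auto intro: mult_left_mono)
  also have "2 * W * \<epsilon>\<^sup>2 \<le> 2 * W * \<epsilon> ^ 1"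
    using assms W_nonneg by (intro mult_left_mono power_decreasing) auto
  finally show ?thesis by simp
qed

lemma w_bound': 
  assumes "e \<in> E" "0 < \<epsilon>" "\<epsilon> \<le> 1" shows "norm (w \<epsilon> e) \<le> 3 * W"
  using w_bound[OF assms] mult_left_mono[of \<epsilon> 1 "3 * W"] assms W_nonneg by linarith

text \<open>Each increment has size \<epsilon>, but \<open>z1\<close> has mean zero, so only the
  second order part contributes to the mean.\<close>

lemma w_mean_bound: 
  assumes "x \<in> V" "0 < \<epsilon>" "\<epsilon> \<le> 1" shows "norm (\<Sum>e\<in>out x. p e *\<^sub>R w \<epsilon> e) \<le> 2 * W * \<epsilon>\<^sup>2"
proof -
  have "(\<Sum>e\<in>out x. p e *\<^sub>R w \<epsilon> e) = (\<Sum>e\<in>out x. p e *\<^sub>R (w \<epsilon> e - \<epsilon> *\<^sub>R z1 e)) + \<epsilon> *\<^sub>R (\<Sum>e\<in>out x. p e *\<^sub>R z1 e)"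
    by (simp add: scaleR_diff_right sum_subtractf scaleR_sum_right mult.commute)
  then show ?thesis
    using average_bound_norm[OF assms(1), of "\<lambda>e. w \<epsilon> e - \<epsilon> *\<^sub>R z1 e"] w_first_order[OF _ assms(2,3)] out(2)
    by (simp add: centered_out[OF assms(1)])
qed

text \<open>\<open>l e v\<close> is the relative first order change of \<open>norm v\<close> along
  the edge \<open>e\<close>. For fixed \<open>v\<close> it is linear in \<open>z1 e\<close>, hence
  its mean over the outgoing edges is zero although single values are not small.\<close>

lemma norm_Ad_w:
  obtains c l where "0 \<le> c" "\<And>e v. e \<in> E \<Longrightarrow> \<bar>l e v\<bar> \<le> c" 
    "\<And>x v. x \<in> V \<Longrightarrow> (\<Sum>e\<in>out x. p e * l e v) = 0"
    "\<And>e \<epsilon> v. e \<in> E \<Longrightarrow> 0 < \<epsilon> \<Longrightarrow> \<epsilon> \<le> 1 \<Longrightarrow> norm (Ad (- w \<epsilon> e) v) \<le> norm v * (1 + \<epsilon> * l e v + c * \<epsilon>\<^sup>2)"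
proof -
  obtain L C where C: "0 \<le> C" and L: "\<And>v. linear (\<lambda>w. L w v)" "\<And>w v. norm (L w v) \<le> C * norm w * norm v"
    and Ad: "\<And>w v. norm w \<le> 3 * W \<Longrightarrow> norm (Ad (- w) v - v - L w v) \<le> C * (norm w)\<^sup>2 * norm v"
    using Ad_linearization[of "3 * W"] by blast
  define l where "l e v = (L (z1 e) v \<bullet> v) / (norm v)\<^sup>2" for e v
  \<comment> \<open>The three terms bound the linear part at \<open>z1\<close>, the replacement of
    the step by \<open>\<epsilon> *\<^sub>R z1 e\<close>, and the quadratic remainder of
    \<open>Ad\<close>.\<close>
  define c where "c = C * W + C * (2 * W) + C * (3 * W)\<^sup>2"
  have c: "0 \<le> c" unfolding c_def using C W_nonneg by (intro add_nonneg_nonneg mult_nonneg_nonneg) auto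
  have cW: "C * W \<le> c" unfolding c_def using C W_nonneg by simp
  have x: "norm (L (z1 e) v) \<le> c * norm v" if e: "e \<in> E" for e v
  proof -
    have "norm (L (z1 e) v) \<le> C * W * norm v" 
      by (rule order_trans[OF L(2)]) (intro mult_right_mono mult_left_mono z1_bound C e norm_ge_zero)
    also have "\<dots> \<le> c * norm v" using cW by (intro mult_right_mono) auto
    finally show ?thesis .
  qed
  have y: "norm (Ad (- w \<epsilon> e) v - v - \<epsilon> *\<^sub>R L (z1 e) v) \<le> c * \<epsilon>\<^sup>2 * norm v" 
    if e: "e \<in> E" and \<epsilon>: "0 < \<epsilon>" "\<epsilon> \<le> 1" for e v \<epsilon>
  proof -
    have "L (w \<epsilon> e) v - \<epsilon> *\<^sub>R L (z1 e) v = L (w \<epsilon> e - \<epsilon> *\<^sub>R z1 e) v"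
      by (simp add: linear_diff[OF L(1)] linear_scale[OF L(1)])
    then have "norm (L (w \<epsilon> e) v - \<epsilon> *\<^sub>R L (z1 e) v) \<le> C * (2 * W * \<epsilon>\<^sup>2) * norm v"
      using order_trans[OF L(2) mult_right_mono[OF mult_left_mono[OF w_first_order[OF e \<epsilon>] C]]] by simp
    moreover have "norm (Ad (- w \<epsilon> e) v - v - L (w \<epsilon> e) v) \<le> C * (3 * W * \<epsilon>)\<^sup>2 * norm v"
      by (rule order_trans[OF Ad[OF w_bound'[OF e \<epsilon>]]])
         (intro mult_right_mono mult_left_mono power_mono w_bound e \<epsilon> C norm_ge_zero)
    moreover have "Ad (- w \<epsilon> e) v - v - \<epsilon> *\<^sub>R L (z1 e) v = 
        (Ad (- w \<epsilon> e) v - v - L (w \<epsilon> e) v) + (L (w \<epsilon> e) v - \<epsilon> *\<^sub>R L (z1 e) v)" by simp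
    ultimately have "norm (Ad (- w \<epsilon> e) v - v - \<epsilon> *\<^sub>R L (z1 e) v) \<le> 
        C * (3 * W * \<epsilon>)\<^sup>2 * norm v + C * (2 * W * \<epsilon>\<^sup>2) * norm v"
      by (metis add_mono norm_triangle_le)
    also have "\<dots> = (c - C * W) * \<epsilon>\<^sup>2 * norm v"
      by (simp add: c_def algebra_simps power_mult_distrib)
    also have "\<dots> \<le> c * \<epsilon>\<^sup>2 * norm v" using C W_nonneg by (intro mult_right_mono) auto
    finally show ?thesis .
  qed
  show ?thesis
  proof (rule that[of "c\<^sup>2 + c" l])
    show "0 \<le> c\<^sup>2 + c" using c by simp
    show "\<bar>l e v\<bar> \<le> c\<^sup>2 + c" if e: "e \<in> E" for e v
    proof -
      have "\<bar>L (z1 e) v \<bullet> v\<bar> \<le> (c * norm v) * norm v"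
        by (rule order_trans[OF Cauchy_Schwarz_ineq2]) (intro mult_right_mono x e norm_ge_zero)
      then have "\<bar>l e v\<bar> \<le> c" using c 
        by (cases "v = 0") (auto simp: l_def divide_le_eq power2_eq_square mult.assoc)
      then show ?thesis by (simp add: add_increasing)
    qed
    show "(\<Sum>e\<in>out x. p e * l e v) = 0" if "x \<in> V" for x v
    proof -
      have "(\<Sum>e\<in>out x. p e * l e v) = (L (\<Sum>e\<in>out x. p e *\<^sub>R z1 e) v \<bullet> v) / (norm v)\<^sup>2"
        by (simp add: l_def linear_sum[OF L(1)] linear_scale[OF L(1)] inner_sum_left sum_divide_distrib)
      then show ?thesis using centered_out[OF that] by (simp add: linear_0[OF L(1)])
    qed
    show "norm (Ad (- w \<epsilon> e) v) \<le> norm v * (1 + \<epsilon> * l e v + (c\<^sup>2 + c) * \<epsilon>\<^sup>2)"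
      if "e \<in> E" "0 < \<epsilon>" "\<epsilon> \<le> 1" for e v \<epsilon>
    proof -
      have "v + \<epsilon> *\<^sub>R L (z1 e) v + (Ad (- w \<epsilon> e) v - v - \<epsilon> *\<^sub>R L (z1 e) v) = Ad (- w \<epsilon> e) v" by simp
      then show ?thesis
        using norm_perturbation[OF x[OF that(1)] y[OF that] c less_imp_le[OF that(2)], of v] 
        unfolding l_def by (simp only:)
    qed
  qed
qed

text \<open>Along the walk the derivatives of a function are multiplied by matrices whose first order 
  fluctuation has mean zero, so that they grow by a factor \<open>1 + O(\<epsilon>\<^sup>2)\<close> only.\<close>

lemma mean_prod_norm_Ad:
  "\<exists>C\<ge>0. \<forall>\<epsilon> x vs. 0 < \<epsilon> \<longrightarrow> \<epsilon> \<le> 1 \<longrightarrow> x \<in> V \<longrightarrow> length vs = j \<longrightarrow>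
    (\<Sum>e\<in>out x. p e * prod_list (map norm (map (Ad (- w \<epsilon> e)) vs))) \<le> (1 + C * \<epsilon>\<^sup>2) * prod_list (map norm vs)"
proof -
  obtain c l where c: "0 \<le> c" and l: "\<And>e v. e \<in> E \<Longrightarrow> \<bar>l e v\<bar> \<le> c" 
    "\<And>x v. x \<in> V \<Longrightarrow> (\<Sum>e\<in>out x. p e * l e v) = 0"
    and Ad: "\<And>e \<epsilon> v. e \<in> E \<Longrightarrow> 0 < \<epsilon> \<Longrightarrow> \<epsilon> \<le> 1 \<Longrightarrow> norm (Ad (- w \<epsilon> e) v) \<le> norm v * (1 + \<epsilon> * l e v + c * \<epsilon>\<^sup>2)"
    by (rule norm_Ad_w) blast
  have sl: "\<bar>sum_list (map (l e) vs)\<bar> \<le> length vs * c" if "e \<in> E" for e vs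
    by (induction vs) (use l(1)[OF that] in \<open>auto simp: algebra_simps intro: order_trans[OF abs_triangle_ineq] add_mono\<close>)
  \<comment> \<open>For a single edge the first order term is kept as an exact sum over the
    directions; an absolute value at this point would destroy the cancellation.\<close>
  have "\<exists>C\<ge>0. \<forall>\<epsilon> e vs. 0 < \<epsilon> \<longrightarrow> \<epsilon> \<le> 1 \<longrightarrow> e \<in> E \<longrightarrow> length vs = j \<longrightarrow>
    prod_list (map norm (map (Ad (- w \<epsilon> e)) vs)) \<le> prod_list (map norm vs) * (1 + \<epsilon> * sum_list (map (l e) vs) + C * \<epsilon>\<^sup>2)"
  proof (induction j)
    case 0
    then show ?case by (intro exI[of _ 0]) auto
  next
    case (Suc j)
    then obtain C where C: "0 \<le> C" and IH: "\<And>\<epsilon> e vs. 0 < \<epsilon> \<Longrightarrow> \<epsilon> \<le> 1 \<Longrightarrow> e \<in> E \<Longrightarrow> length vs = j \<Longrightarrow>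
      prod_list (map norm (map (Ad (- w \<epsilon> e)) vs)) \<le> prod_list (map norm vs) * (1 + \<epsilon> * sum_list (map (l e) vs) + C * \<epsilon>\<^sup>2)"
      by blast
    \<comment> \<open>Bounds the total coefficient of \<open>\<epsilon>\<^sup>2\<close> in the
      product of the two expansions, higher powers of \<epsilon> being absorbed by
      \<open>\<epsilon> \<le> 1\<close>.\<close>
    define C' where "C' = c + C + 2 * (c * (j * c)) + 2 * c * C"
    show ?case
    proof (intro exI[of _ C'] conjI allI impI)
      show "0 \<le> C'" using c C by (simp add: C'_def)
      fix \<epsilon> :: real and e and vs :: "'a list" 
      assume \<epsilon>: "0 < \<epsilon>" "\<epsilon> \<le> 1" and e: "e \<in> E" and "length vs = Suc j"
      then obtain u us where vs: "vs = u # us" and us: "length us = j" by (cases vs) auto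
      define a where "a = l e u"
      define b where "b = sum_list (map (l e) us)"
      have a: "\<bar>a\<bar> \<le> c" and b: "\<bar>b\<bar> \<le> j * c" using l(1)[OF e] sl[OF e, of us] us by (auto simp: a_def b_def)
      have 1: "norm (Ad (- w \<epsilon> e) u) \<le> norm u * (1 + \<epsilon> * a + c * \<epsilon>\<^sup>2)" using Ad[OF e \<epsilon>] by (simp add: a_def)
      have 2: "prod_list (map norm (map (Ad (- w \<epsilon> e)) us)) \<le> prod_list (map norm us) * (1 + \<epsilon> * b + C * \<epsilon>\<^sup>2)"
        using IH[OF \<epsilon> e us] by (simp add: b_def)
      have "(1 + \<epsilon> * a + c * \<epsilon>\<^sup>2) * (1 + \<epsilon> * b + C * \<epsilon>\<^sup>2) = 1 + \<epsilon> * (a + b) + 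
          \<epsilon>\<^sup>2 * (c + C + a * b + \<epsilon> * (a * C + b * c) + \<epsilon>\<^sup>2 * (c * C))"
        by (simp add: algebra_simps power2_eq_square)
      also have "\<dots> \<le> 1 + \<epsilon> * (a + b) + \<epsilon>\<^sup>2 * C'"
      proof -
        have "a * b \<le> \<bar>a\<bar> * \<bar>b\<bar>" by (simp add: abs_mult[symmetric])
        also have "\<dots> \<le> c * (j * c)" by (rule mult_mono[OF a b c]) simp
        finally have ab: "a * b \<le> c * (j * c)" .
        have "a * C + b * c \<le> c * C + (j * c) * c" 
          by (rule add_mono[OF mult_right_mono[OF abs_le_D1[OF a] C] mult_right_mono[OF abs_le_D1[OF b] c]])
        then have "\<epsilon> * (a * C + b * c) \<le> \<epsilon> * (c * C + (j * c) * c)" using \<epsilon> by (intro mult_left_mono) auto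
        also have "\<dots> \<le> c * C + (j * c) * c" using \<epsilon> c C by (intro mult_left_le_one_le) auto
        finally have 3: "\<epsilon> * (a * C + b * c) \<le> c * C + (j * c) * c" .
        have "\<epsilon>\<^sup>2 * (c * C) \<le> c * C" using \<epsilon> c C by (intro mult_left_le_one_le power_le_one) auto
        with ab 3 have "c + C + a * b + \<epsilon> * (a * C + b * c) + \<epsilon>\<^sup>2 * (c * C) \<le> C'"
          unfolding C'_def by (simp add: mult_ac)
        then show ?thesis by (intro add_left_mono mult_left_mono zero_le_power2)
      qed
      finally have 3: "(1 + \<epsilon> * a + c * \<epsilon>\<^sup>2) * (1 + \<epsilon> * b + C * \<epsilon>\<^sup>2) \<le> 1 + \<epsilon> * (a + b) + C' * \<epsilon>\<^sup>2"
        by (simp add: mult.commute)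
      have "prod_list (map norm (map (Ad (- w \<epsilon> e)) vs)) \<le> 
          (norm u * (1 + \<epsilon> * a + c * \<epsilon>\<^sup>2)) * (prod_list (map norm us) * (1 + \<epsilon> * b + C * \<epsilon>\<^sup>2))"
        unfolding vs list.map prod_list.Cons
        by (rule mult_mono[OF 1 2 order_trans[OF norm_ge_zero 1] prod_list_norm_nonneg])
      also have "\<dots> = prod_list (map norm vs) * ((1 + \<epsilon> * a + c * \<epsilon>\<^sup>2) * (1 + \<epsilon> * b + C * \<epsilon>\<^sup>2))"
        by (simp add: vs mult_ac)
      also have "\<dots> \<le> prod_list (map norm vs) * (1 + \<epsilon> * (a + b) + C' * \<epsilon>\<^sup>2)"
        by (rule mult_left_mono[OF 3 prod_list_norm_nonneg])
      finally show "prod_list (map norm (map (Ad (- w \<epsilon> e)) vs)) \<le> 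
          prod_list (map norm vs) * (1 + \<epsilon> * sum_list (map (l e) vs) + C' * \<epsilon>\<^sup>2)"
        by (simp add: vs a_def b_def)
    qed
  qed
  then obtain C where C: "0 \<le> C" and bd: "\<And>\<epsilon> e vs. 0 < \<epsilon> \<Longrightarrow> \<epsilon> \<le> 1 \<Longrightarrow> e \<in> E \<Longrightarrow> length vs = j \<Longrightarrow>
      prod_list (map norm (map (Ad (- w \<epsilon> e)) vs)) \<le> prod_list (map norm vs) * (1 + \<epsilon> * sum_list (map (l e) vs) + C * \<epsilon>\<^sup>2)"
    by blast
  show ?thesis
  proof (intro exI[of _ C] conjI allI impI C)
    fix \<epsilon> :: real and x and vs :: "'a list"
    assume \<epsilon>: "0 < \<epsilon>" "\<epsilon> \<le> 1" and x: "x \<in> V" and vs: "length vs = j"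
    have zero: "(\<Sum>e\<in>out x. p e * sum_list (map (l e) us)) = 0" for us
      by (induction us) (use l(2)[OF x] in \<open>auto simp: algebra_simps sum.distrib\<close>)
    have "(\<Sum>e\<in>out x. p e * prod_list (map norm (map (Ad (- w \<epsilon> e)) vs))) \<le>
      (\<Sum>e\<in>out x. p e * (prod_list (map norm vs) * (1 + \<epsilon> * sum_list (map (l e) vs) + C * \<epsilon>\<^sup>2)))"
      by (intro sum_mono mult_left_mono bd \<epsilon> vs p_nonneg out(2))
    also have "\<dots> = prod_list (map norm vs) * ((1 + C * \<epsilon>\<^sup>2) * (\<Sum>e\<in>out x. p e) + \<epsilon> * (\<Sum>e\<in>out x. p e * sum_list (map (l e) vs)))"
      by (simp add: algebra_simps sum.distrib sum_distrib_left)
    also have "\<dots> = (1 + C * \<epsilon>\<^sup>2) * prod_list (map norm vs)" by (simp add: zero p_out[OF x])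
    finally show "(\<Sum>e\<in>out x. p e * prod_list (map norm (map (Ad (- w \<epsilon> e)) vs))) 
      \<le> (1 + C * \<epsilon>\<^sup>2) * prod_list (map norm vs)" .
  qed
qed

end

lemma (in log_group) taylor_bound:
  assumes "0 < n"
  obtains T where "0 \<le> T" "\<And>F K w u. smooth F \<Longrightarrow> vbound K n F \<Longrightarrow> 0 \<le> K \<Longrightarrow> norm w \<le> R \<Longrightarrow>
      \<bar>F (u \<diamondop> w) - (\<Sum>m<n. vfs (replicate m w) F u / fact m)\<bar> \<le> T * K * norm w ^ n"
proof -
  obtain T where T: "0 \<le> T" and *: "\<And>F K vs w u. smooth F \<Longrightarrow> vbound K (length vs + n) F \<Longrightarrow> 0 \<le> K \<Longrightarrow> 
      norm w \<le> R \<Longrightarrow> length vs = 0 \<Longrightarrow> 0 < n \<Longrightarrow>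
      \<bar>vfs vs (\<lambda>u. F (u \<diamondop> w)) u - (\<Sum>m<n. vfs (vs @ replicate m w) F u / fact m)\<bar>
       \<le> T * K * prod_list (map norm vs) * norm w ^ n"
    using vfs_taylor_bound[where R=R and j=0 and n=n] by blast
  show ?thesis
    by (rule that[OF T]) (use *[where vs="[]"] assms in simp)
qed

section \<open>The transition operator on functions of vertex and position\<close>

context log_walk begin

text \<open>The covering graph is replaced by pairs of a quotient vertex and a position in the Lie
  algebra. Steps multiply the position on the right, so they combine well with left invariant
  derivatives.\<close>

definition step :: "real \<Rightarrow> ('v \<Rightarrow> 'a \<Rightarrow> real) \<Rightarrow> 'v \<Rightarrow> 'a \<Rightarrow> real" where
  "step \<epsilon> F x u = (\<Sum>e\<in>out x. p e * F (tgt e) (u \<diamondop> w \<epsilon> e))"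

lemma step_test: "(\<And>x. x \<in> V \<Longrightarrow> test (F x)) \<Longrightarrow> test (step \<epsilon> F x)"
  unfolding step_def[abs_def] by (auto intro!: test_sum test_scale test_translate out)

lemma smooth_step: "(\<And>x. x \<in> V \<Longrightarrow> smooth (F x)) \<Longrightarrow> smooth (step \<epsilon> F x)"
  unfolding step_def[abs_def] by (auto intro!: smooth_sum smooth_mult smooth_const smooth_translate out)

lemma vfs_step:
  assumes "\<And>x. x \<in> V \<Longrightarrow> smooth (F x)"
  shows "vfs vs (step \<epsilon> F x) u = (\<Sum>e\<in>out x. p e * vfs vs (\<lambda>u. F (tgt e) (u \<diamondop> w \<epsilon> e)) u)"
  unfolding step_def[abs_def]
  by (subst vfs_sum) (auto intro!: smooth_translate assms out)

lemma step_diff: "step \<epsilon> (\<lambda>x u. F x u - H x u) = (\<lambda>x u. step \<epsilon> F x u - step \<epsilon> H x u)"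
  by (simp add: step_def fun_eq_iff right_diff_distrib sum_subtractf)

definition iter :: "real \<Rightarrow> nat \<Rightarrow> ('v \<Rightarrow> 'a \<Rightarrow> real) \<Rightarrow> 'v \<Rightarrow> 'a \<Rightarrow> real" where
  "iter \<epsilon> k F = (step \<epsilon> ^^ k) F"

lemma iter_0 [simp]: "iter \<epsilon> 0 F = F" and iter_Suc: "iter \<epsilon> (Suc k) F = step \<epsilon> (iter \<epsilon> k F)"
  and iter_Suc': "iter \<epsilon> (Suc k) F = iter \<epsilon> k (step \<epsilon> F)"
  by (simp_all add: iter_def funpow_swap1)

lemma iter_diff: "iter \<epsilon> k (\<lambda>x u. F x u - H x u) = (\<lambda>x u. iter \<epsilon> k F x u - iter \<epsilon> k H x u)"
  by (induction k) (simp_all add: iter_Suc step_diff)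

lemma iter_test: "(\<And>x. x \<in> V \<Longrightarrow> test (F x)) \<Longrightarrow> x \<in> V \<Longrightarrow> test (iter \<epsilon> k F x)"
  by (induction k arbitrary: x) (simp_all add: iter_Suc step_test)

text \<open>The last step translates every iterate, so the bound for \<open>k\<close> is applied to
  conjugated directions, whose mean weight grows by \<open>mean_prod_norm_Ad\<close>.
  \<open>C\<close> is independent of \<open>F\<close>, so the lemma applies to differences of
  iterates too.\<close>

lemma iter_bound_growth:
  "\<exists>C\<ge>0. \<forall>\<epsilon> F K k. 0 < \<epsilon> \<longrightarrow> \<epsilon> \<le> 1 \<longrightarrow> 0 \<le> K \<longrightarrow> (\<forall>x\<in>V. test (F x) \<and> vbound K j (F x)) \<longrightarrow>
     (\<forall>x\<in>V. vbound (K * (1 + C * \<epsilon>\<^sup>2) ^ k) j (iter \<epsilon> k F x))"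
proof -
  obtain C where C: "0 \<le> C" and A: "\<And>\<epsilon> x vs. 0 < \<epsilon> \<Longrightarrow> \<epsilon> \<le> 1 \<Longrightarrow> x \<in> V \<Longrightarrow> length vs = j \<Longrightarrow>
      (\<Sum>e\<in>out x. p e * prod_list (map norm (map (Ad (- w \<epsilon> e)) vs))) \<le> (1 + C * \<epsilon>\<^sup>2) * prod_list (map norm vs)"
    using mean_prod_norm_Ad[of j] by blast
  show ?thesis
  proof (intro exI[of _ C] conjI allI impI C)
    fix \<epsilon> K :: real and F :: "'v \<Rightarrow> 'a \<Rightarrow> real" and k :: nat
    assume \<epsilon>: "0 < \<epsilon>" "\<epsilon> \<le> 1" and K: "0 \<le> K" and F: "\<forall>x\<in>V. test (F x) \<and> vbound K j (F x)"
    have t: "test (iter \<epsilon> k F x)" if "x \<in> V" for x k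
      using that F by (intro iter_test) auto
    show "\<forall>x\<in>V. vbound (K * (1 + C * \<epsilon>\<^sup>2) ^ k) j (iter \<epsilon> k F x)"
    proof (induction k)
      case 0
      then show ?case using F by simp
    next
      case (Suc k)
      let ?B = "K * (1 + C * \<epsilon>\<^sup>2) ^ k"
      have B: "0 \<le> ?B" using K C by simp
      show ?case unfolding vbound_def
      proof (intro ballI allI impI)
        fix x and vs :: "'a list" and u assume x: "x \<in> V" and vs: "length vs = j"
        have "vfs vs (iter \<epsilon> (Suc k) F x) u = 
          (\<Sum>e\<in>out x. p e * vfs (map (Ad (- w \<epsilon> e)) vs) (iter \<epsilon> k F (tgt e)) (u \<diamondop> w \<epsilon> e))"
          unfolding iter_Suc by (subst vfs_step) (auto intro: test_smooth t simp: vfs_translate)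
        also have "\<bar>\<dots>\<bar> \<le> (\<Sum>e\<in>out x. p e * (?B * prod_list (map norm (map (Ad (- w \<epsilon> e)) vs))))"
        proof (rule order_trans[OF sum_abs], rule sum_mono, unfold abs_mult)
          fix e assume e: "e \<in> out x"
          have "\<bar>vfs (map (Ad (- w \<epsilon> e)) vs) (iter \<epsilon> k F (tgt e)) (u \<diamondop> w \<epsilon> e)\<bar> \<le> 
             ?B * prod_list (map norm (map (Ad (- w \<epsilon> e)) vs))"
            by (rule vboundD) (use Suc.IH out(4)[OF e] vs in auto)
          then show "\<bar>p e\<bar> * \<bar>vfs (map (Ad (- w \<epsilon> e)) vs) (iter \<epsilon> k F (tgt e)) (u \<diamondop> w \<epsilon> e)\<bar> \<le> 
             p e * (?B * prod_list (map norm (map (Ad (- w \<epsilon> e)) vs)))"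
            using p_nonneg[OF out(2)[OF e]] by (simp add: mult_left_mono)
        qed
        also have "\<dots> = ?B * (\<Sum>e\<in>out x. p e * prod_list (map norm (map (Ad (- w \<epsilon> e)) vs)))"
          unfolding sum_distrib_left by (simp only: mult_ac)
        also have "\<dots> \<le> ?B * ((1 + C * \<epsilon>\<^sup>2) * prod_list (map norm vs))"
          by (rule mult_left_mono[OF A[OF \<epsilon> x vs] B])
        finally show "\<bar>vfs vs (iter \<epsilon> (Suc k) F x) u\<bar> \<le> K * (1 + C * \<epsilon>\<^sup>2) ^ Suc k * prod_list (map norm vs)"
          by (simp only: power_Suc mult_ac)
      qed
    qed
  qed
qed

lemma power_growth_le_exp:
  assumes "0 \<le> (C::real)" "\<epsilon>\<^sup>2 * real k \<le> \<tau>" shows "(1 + C * \<epsilon>\<^sup>2) ^ k \<le> exp (C * \<tau>)"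
proof -
  have "(1 + C * \<epsilon>\<^sup>2) ^ k \<le> exp (C * \<epsilon>\<^sup>2) ^ k"
    using assms by (intro power_mono exp_ge_add_one_self) auto
  also have "\<dots> = exp (C * (\<epsilon>\<^sup>2 * real k))" by (simp add: exp_of_nat_mult[symmetric] mult_ac)
  also have "\<dots> \<le> exp (C * \<tau>)" using assms by (simp add: mult_left_mono)
  finally show ?thesis .
qed

lemma iter_bound:
  "\<exists>B\<ge>0. \<forall>\<epsilon> F K k. 0 < \<epsilon> \<longrightarrow> \<epsilon> \<le> 1 \<longrightarrow> \<epsilon>\<^sup>2 * real k \<le> \<tau> \<longrightarrow> 0 \<le> K \<longrightarrow> 
     (\<forall>x\<in>V. test (F x) \<and> vbound K j (F x)) \<longrightarrow> (\<forall>x\<in>V. vbound (K * B) j (iter \<epsilon> k F x))"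
proof -
  obtain C where C: "0 \<le> C" and A: "\<And>\<epsilon> F K k. 0 < \<epsilon> \<Longrightarrow> \<epsilon> \<le> 1 \<Longrightarrow> 0 \<le> K \<Longrightarrow> 
     (\<forall>x\<in>V. test (F x) \<and> vbound K j (F x)) \<Longrightarrow> (\<forall>x\<in>V. vbound (K * (1 + C * \<epsilon>\<^sup>2) ^ k) j (iter \<epsilon> k F x))"
    using iter_bound_growth[of j] by blast
  show ?thesis
  proof (intro exI[of _ "exp (C * \<tau>)"] conjI allI impI ballI)
    fix \<epsilon> K :: real and F :: "'v \<Rightarrow> 'a \<Rightarrow> real" and k :: nat and x
    assume *: "0 < \<epsilon>" "\<epsilon> \<le> 1" "\<epsilon>\<^sup>2 * real k \<le> \<tau>" "0 \<le> K" "\<forall>x\<in>V. test (F x) \<and> vbound K j (F x)" "x \<in> V"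
    show "vbound (K * exp (C * \<tau>)) j (iter \<epsilon> k F x)"
      by (rule vbound_mono[OF _ mult_left_mono[OF power_growth_le_exp[OF C *(3)] *(4)]])
         (use A[OF *(1,2,4,5)] *(6) in blast)
  qed simp
qed

text \<open>The first order term of the increment averages to zero up to the oscillation \<open>Q\<close> of the 
  derivatives of one order more.\<close>

lemma step_expansion:
  obtains C where "0 \<le> C" "\<And>\<epsilon> F K Q x vs u. 0 < \<epsilon> \<Longrightarrow> \<epsilon> \<le> 1 \<Longrightarrow> 0 \<le> K \<Longrightarrow> 0 \<le> Q \<Longrightarrow>
     (\<forall>x\<in>V. smooth (F x) \<and> vbound K (Suc j) (F x) \<and> vbound K (j + 2) (F x)) \<Longrightarrow>
     (\<forall>x\<in>V. \<forall>y\<in>V. vbound Q (Suc j) (\<lambda>u. F x u - F y u)) \<Longrightarrow>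
     x \<in> V \<Longrightarrow> length vs = j \<Longrightarrow> 
     \<bar>vfs vs (step \<epsilon> F x) u - (\<Sum>e\<in>out x. p e * vfs vs (F (tgt e)) u)\<bar> \<le> C * (\<epsilon>\<^sup>2 * K + \<epsilon> * Q) * prod_list (map norm vs)"
proof -
  obtain T where T: "0 \<le> T" and taylor: "\<And>F K vs w u. smooth F \<Longrightarrow> vbound K (j + 2) F \<Longrightarrow> 0 \<le> K \<Longrightarrow> 
      norm w \<le> 3 * W \<Longrightarrow> length vs = j \<Longrightarrow> 
      \<bar>vfs vs (\<lambda>u. F (u \<diamondop> w)) u - (\<Sum>m<2. vfs (vs @ replicate m w) F u / fact m)\<bar>
       \<le> T * K * prod_list (map norm vs) * norm w ^ 2"
    using vfs_taylor_bound[where R="3 * W" and j=j and n=2] by auto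
  define C where "C = T * (3 * W)\<^sup>2 + 3 * W + 2 * W"
  show ?thesis
  proof (rule that[of C])
    show "0 \<le> C" unfolding C_def using T W_nonneg by simp
    fix \<epsilon> K Q :: real and F :: "'v \<Rightarrow> 'a \<Rightarrow> real" and x and vs :: "'a list" and u
    assume \<epsilon>: "0 < \<epsilon>" "\<epsilon> \<le> 1" and K: "0 \<le> K" and Q: "0 \<le> Q"
      and F: "\<forall>x\<in>V. smooth (F x) \<and> vbound K (Suc j) (F x) \<and> vbound K (j + 2) (F x)"
      and osc: "\<forall>x\<in>V. \<forall>y\<in>V. vbound Q (Suc j) (\<lambda>u. F x u - F y u)"
      and x: "x \<in> V" and vs: "length vs = j"
    let ?P = "prod_list (map norm vs)"
    have P: "0 \<le> ?P" by (rule prod_list_norm_nonneg)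
    let ?R = "\<lambda>e. vfs vs (\<lambda>u. F (tgt e) (u \<diamondop> w \<epsilon> e)) u"
    let ?D = "\<lambda>y e. vfs (vs @ [w \<epsilon> e]) (F y) u"
    \<comment> \<open>Three sources of error: the second order Taylor remainder, the exchange of the
      target vertex for \<open>x\<close> in the first order term, and the derivative at
      \<open>x\<close> along the mean increment, which is of order
      \<open>\<epsilon>\<^sup>2\<close>.\<close>
    have eq: "vfs vs (step \<epsilon> F x) u - (\<Sum>e\<in>out x. p e * vfs vs (F (tgt e)) u) =
        (\<Sum>e\<in>out x. p e * (?R e - vfs vs (F (tgt e)) u - ?D (tgt e) e)) + 
        (\<Sum>e\<in>out x. p e * (?D (tgt e) e - ?D x e)) + (\<Sum>e\<in>out x. p e * ?D x e)"
      using F by (subst vfs_step) (auto simp: algebra_simps sum.distrib sum_subtractf)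
    have 1: "\<bar>\<Sum>e\<in>out x. p e * (?R e - vfs vs (F (tgt e)) u - ?D (tgt e) e)\<bar> \<le> T * (3 * W)\<^sup>2 * (\<epsilon>\<^sup>2 * K * ?P)"
    proof (rule average_bound[OF x])
      fix e assume e: "e \<in> out x"
      have "\<bar>?R e - (\<Sum>m<2. vfs (vs @ replicate m (w \<epsilon> e)) (F (tgt e)) u / fact m)\<bar> \<le> T * K * ?P * norm (w \<epsilon> e) ^ 2"
        by (rule taylor) (use F out(4)[OF e] K vs w_bound'[OF out(2)[OF e] \<epsilon>] in auto)
      also have "\<dots> \<le> T * K * ?P * (3 * W * \<epsilon>) ^ 2"
        by (intro mult_left_mono power_mono w_bound[OF out(2)[OF e] \<epsilon>] mult_nonneg_nonneg T K P norm_ge_zero)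
      finally show "\<bar>?R e - vfs vs (F (tgt e)) u - ?D (tgt e) e\<bar> \<le> T * (3 * W)\<^sup>2 * (\<epsilon>\<^sup>2 * K * ?P)"
        by (simp add: numeral_2_eq_2 power_mult_distrib mult_ac)
    qed
    have 2: "\<bar>\<Sum>e\<in>out x. p e * (?D (tgt e) e - ?D x e)\<bar> \<le> 3 * W * (\<epsilon> * Q * ?P)"
    proof (rule average_bound[OF x])
      fix e assume e: "e \<in> out x"
      have "vfs (vs @ [w \<epsilon> e]) (\<lambda>u. F (tgt e) u - F x u) u = ?D (tgt e) e - ?D x e"
        using F x out(4)[OF e] by (subst vfs_diff) auto
      moreover have "\<bar>vfs (vs @ [w \<epsilon> e]) (\<lambda>u. F (tgt e) u - F x u) u\<bar> \<le> Q * prod_list (map norm (vs @ [w \<epsilon> e]))"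
        by (rule vboundD) (use osc x out(4)[OF e] vs in auto)
      moreover have "Q * prod_list (map norm (vs @ [w \<epsilon> e])) \<le> Q * (?P * (3 * W * \<epsilon>))"
        using w_bound[OF out(2)[OF e] \<epsilon>] Q P by (auto intro!: mult_left_mono)
      ultimately show "\<bar>?D (tgt e) e - ?D x e\<bar> \<le> 3 * W * (\<epsilon> * Q * ?P)" by (simp add: mult_ac)
    qed
    have "(\<Sum>e\<in>out x. p e * ?D x e) = vfs (vs @ [(\<Sum>e\<in>out x. p e *\<^sub>R w \<epsilon> e)]) (F x) u"
      using F x by (subst vfs_snoc_sum) (auto simp: out)
    also have "\<bar>\<dots>\<bar> \<le> K * prod_list (map norm (vs @ [(\<Sum>e\<in>out x. p e *\<^sub>R w \<epsilon> e)]))"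
      by (rule vboundD) (use F x vs in auto)
    also have "\<dots> \<le> K * (?P * (2 * W * \<epsilon>\<^sup>2))"
      using w_mean_bound[OF x \<epsilon>] K P by (auto intro!: mult_left_mono)
    finally have 3: "\<bar>\<Sum>e\<in>out x. p e * ?D x e\<bar> \<le> 2 * W * (\<epsilon>\<^sup>2 * K * ?P)" by (simp add: mult_ac)
    define a where "a = \<epsilon>\<^sup>2 * K * ?P"
    define b where "b = \<epsilon> * Q * ?P"
    have ab: "0 \<le> a" "0 \<le> b" using K Q P \<epsilon> by (simp_all add: a_def b_def)
    have "C * (\<epsilon>\<^sup>2 * K + \<epsilon> * Q) * ?P = C * a + C * b" by (simp add: a_def b_def algebra_simps)
    moreover have "T * (3 * W)\<^sup>2 * a + 2 * W * a \<le> C * a" 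
      using W_nonneg ab by (simp add: C_def distrib_right[symmetric] mult_right_mono)
    moreover have "3 * W * b \<le> C * b" 
      using W_nonneg ab T by (intro mult_right_mono) (auto simp: C_def)
    ultimately show "\<bar>vfs vs (step \<epsilon> F x) u - (\<Sum>e\<in>out x. p e * vfs vs (F (tgt e)) u)\<bar> \<le> 
        C * (\<epsilon>\<^sup>2 * K + \<epsilon> * Q) * ?P"
      using 1 2 3 unfolding eq a_def[symmetric] b_def[symmetric] by linarith
  qed
qed

section \<open>Stationary averages and the limit generator\<close>

lemma poisson_out:
  obtains P where "0 \<le> P" "\<And>\<phi> d x y. (\<forall>x\<in>V. \<bar>(\<Sum>e\<in>out x. p e * \<phi> (tgt e)) - \<phi> x\<bar> \<le> d) \<Longrightarrow> x \<in> V \<Longrightarrow> y \<in> V \<Longrightarrow> 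
      \<bar>\<phi> x - \<phi> y\<bar> \<le> P * d"
  using poisson unfolding out_def by blast

text \<open>The stationary law of a step of the walk; drift and covariance of the limit are averages
  against it.\<close>

definition q :: "'e \<Rightarrow> real" where "q e = p e * m (src e)"

lemma q_nonneg: "e \<in> E \<Longrightarrow> 0 \<le> q e"
  by (simp add: q_def p_nonneg m_nonneg src)

lemma q_sum: "(\<Sum>e\<in>E. q e) = 1"
  using stationary[of "\<lambda>_. 1"] m_sum by (simp add: q_def)

lemma q_average_bound_norm:
  assumes "\<And>e. e \<in> E \<Longrightarrow> norm (h e) \<le> B"
  shows "norm (\<Sum>e\<in>E. q e *\<^sub>R h e) \<le> B"
proof -
  have "norm (\<Sum>e\<in>E. q e *\<^sub>R h e) \<le> (\<Sum>e\<in>E. q e * B)"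
    by (rule order_trans[OF norm_sum], rule sum_mono, unfold norm_scaleR)
       (use assms q_nonneg in \<open>auto intro!: mult_mono\<close>)
  also have "\<dots> = B" using q_sum by (simp add: sum_distrib_right[symmetric])
  finally show ?thesis .
qed

lemma q_average_bound:
  assumes "\<And>e. e \<in> E \<Longrightarrow> \<bar>h e\<bar> \<le> B"
  shows "\<bar>\<Sum>e\<in>E. q e * h e\<bar> \<le> B"
  using q_average_bound_norm[of h B] assms by simp

lemma q_centered: "(\<Sum>e\<in>E. q e *\<^sub>R z1 e) = 0"
proof -
  have "(\<Sum>e\<in>E. q e *\<^sub>R z1 e) = (\<Sum>x\<in>V. \<Sum>e\<in>out x. q e *\<^sub>R z1 e)" by (rule sum_out[symmetric])
  also have "\<dots> = (\<Sum>x\<in>V. m x *\<^sub>R (\<Sum>e\<in>out x. p e *\<^sub>R z1 e))"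
    by (auto simp: q_def out scaleR_sum_right mult.commute intro!: sum.cong)
  also have "\<dots> = 0" by (simp add: centered_out)
  finally show ?thesis .
qed

definition drift :: 'a where "drift = (\<Sum>e\<in>E. q e *\<^sub>R z2 e)"

text \<open>A form of the limit generator that avoids bases: a sum of squares of fields, one per
  edge, plus the mean second layer. It agrees with the expression in an adapted basis by
  \<open>limit_generator_Log\<close>.\<close>

definition gen :: "('a \<Rightarrow> real) \<Rightarrow> 'a \<Rightarrow> real" where
  "gen F u = vf drift F u + 1 / 2 * (\<Sum>e\<in>E. q e * vf (z1 e) (vf (z1 e) F) u)"

lemma test_gen: "test F \<Longrightarrow> test (gen F)"
  unfolding gen_def[abs_def] by (intro test_add test_vf test_scale test_sum finite_E)

lemma norm_drift: "norm drift \<le> W"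
  unfolding drift_def by (rule q_average_bound_norm[OF z2_bound])

lemma vbound_gen:
  assumes F: "smooth F" "vbound K (Suc j) F" "vbound K (j + 2) F" and K: "0 \<le> K"
  shows "vbound (K * (W + W\<^sup>2)) j (gen F)"
  unfolding vbound_def
proof (intro allI impI)
  fix vs :: "'a list" and u assume vs: "length vs = j"
  let ?P = "prod_list (map norm vs)"
  have P: "0 \<le> ?P" by (rule prod_list_norm_nonneg)
  let ?S = "\<lambda>u. \<Sum>e\<in>E. q e * vf (z1 e) (vf (z1 e) F) u"
  have S: "smooth ?S" by (intro smooth_sum finite_E smooth_mult smooth_const smooth_vf F)
  have "vfs vs (gen F) u = vfs (vs @ [drift]) F u + 1 / 2 * vfs vs ?S u"
    unfolding gen_def[abs_def] 
    by (subst vfs_add) (auto intro!: smooth_vf F smooth_mult smooth_const S simp: vfs_scale[OF S] vfs_append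
        simp del: times_divide_eq_left)
  moreover have "vfs vs ?S u = (\<Sum>e\<in>E. q e * vfs (vs @ [z1 e, z1 e]) F u)"
    by (subst vfs_sum) (auto intro!: finite_E smooth_vf F simp: vfs_append)
  moreover have "\<bar>vfs (vs @ [drift]) F u\<bar> \<le> K * (?P * W)"
  proof (rule order_trans[OF vboundD[OF F(2)]])
    show "K * prod_list (map norm (vs @ [drift])) \<le> K * (?P * W)"
      using norm_drift K P by (auto intro!: mult_left_mono)
  qed (use vs in simp)
  moreover have "\<bar>\<Sum>e\<in>E. q e * vfs (vs @ [z1 e, z1 e]) F u\<bar> \<le> K * (?P * W\<^sup>2)"
  proof (rule q_average_bound)
    fix e assume e: "e \<in> E"
    have "norm (z1 e) * norm (z1 e) \<le> W\<^sup>2"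
      unfolding power2_eq_square by (intro mult_mono z1_bound e W_nonneg norm_ge_zero)
    then have "K * prod_list (map norm (vs @ [z1 e, z1 e])) \<le> K * (?P * W\<^sup>2)"
      using K P by (auto intro!: mult_left_mono)
    then show "\<bar>vfs (vs @ [z1 e, z1 e]) F u\<bar> \<le> K * (?P * W\<^sup>2)"
      using vboundD[OF F(3), of "vs @ [z1 e, z1 e]" u] vs by simp
  qed
  ultimately have "\<bar>vfs vs (gen F) u\<bar> \<le> K * (?P * W) + K * (?P * W\<^sup>2)" by linarith
  then show "\<bar>vfs vs (gen F) u\<bar> \<le> K * (W + W\<^sup>2) * ?P" by (simp add: algebra_simps)
qed

section \<open>Iterates of a fixed test function up to time \<tau>\<close>

context
  fixes f :: "'a \<Rightarrow> real" and \<tau> :: real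
  assumes f: "test f" 
begin

abbreviation it :: "real \<Rightarrow> nat \<Rightarrow> 'v \<Rightarrow> 'a \<Rightarrow> real" where "it \<epsilon> k \<equiv> iter \<epsilon> k (\<lambda>x. f)"

abbreviation admissible :: "real \<Rightarrow> nat \<Rightarrow> bool" where 
  "admissible \<epsilon> k \<equiv> 0 < \<epsilon> \<and> \<epsilon> \<le> 1 \<and> \<epsilon>\<^sup>2 * real k \<le> \<tau>"

lemma test_it: "x \<in> V \<Longrightarrow> test (it \<epsilon> k x)"
  by (rule iter_test) (simp_all add: f)

lemma smooth_it: "x \<in> V \<Longrightarrow> smooth (it \<epsilon> k x)"
  by (rule test_smooth[OF test_it])

lemma it_bound: "\<exists>K\<ge>0. \<forall>\<epsilon> k x. admissible \<epsilon> k \<longrightarrow> x \<in> V \<longrightarrow> vbound K j (it \<epsilon> k x)"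
proof -
  obtain B where B: "0 \<le> B" "\<And>\<epsilon> F K k x. admissible \<epsilon> k \<Longrightarrow> 0 \<le> K \<Longrightarrow> 
     (\<forall>x\<in>V. test (F x) \<and> vbound K j (F x)) \<Longrightarrow> x \<in> V \<Longrightarrow> vbound (K * B) j (iter \<epsilon> k F x)"
    using iter_bound[of \<tau> j] by blast
  obtain K where K: "0 \<le> K" "vbound K j f" using test_vbound[OF f] by blast
  show ?thesis 
    by (intro exI[of _ "K * B"] conjI allI impI B(2)) (use K B f in auto)
qed

text \<open>By \<open>iter_Suc'\<close> the increment at time \<open>k\<close> is the
  \<open>k\<close>-th iterate of the increment at time 0, so a bound for a single step suffices and
  the growth estimate does the rest.\<close>

lemma it_increment: 
  "\<exists>K\<ge>0. \<forall>\<epsilon> k x. admissible \<epsilon> k \<longrightarrow> x \<in> V \<longrightarrow> vbound (K * \<epsilon>\<^sup>2) j (\<lambda>u. it \<epsilon> (Suc k) x u - it \<epsilon> k x u)"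
proof -
  obtain B where B: "0 \<le> B" "\<And>\<epsilon> F K k x. admissible \<epsilon> k \<Longrightarrow> 0 \<le> K \<Longrightarrow> 
     (\<forall>x\<in>V. test (F x) \<and> vbound K j (F x)) \<Longrightarrow> x \<in> V \<Longrightarrow> vbound (K * B) j (iter \<epsilon> k F x)"
    using iter_bound[of \<tau> j] by blast
  obtain K1 where K1: "0 \<le> K1" "vbound K1 (Suc j) f" using test_vbound[OF f] by blast
  obtain K2 where K2: "0 \<le> K2" "vbound K2 (j + 2) f" using test_vbound[OF f] by blast
  define K where "K = max K1 K2"
  have K: "0 \<le> K" "vbound K (Suc j) f" "vbound K (j + 2) f"
    using K1 K2 by (auto simp: K_def intro: vbound_mono)
  obtain C where C: "0 \<le> C" and step: "\<And>\<epsilon> F K Q x vs u. 0 < \<epsilon> \<Longrightarrow> \<epsilon> \<le> 1 \<Longrightarrow> 0 \<le> K \<Longrightarrow> 0 \<le> Q \<Longrightarrow>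
     (\<forall>x\<in>V. smooth (F x) \<and> vbound K (Suc j) (F x) \<and> vbound K (j + 2) (F x)) \<Longrightarrow>
     (\<forall>x\<in>V. \<forall>y\<in>V. vbound Q (Suc j) (\<lambda>u. F x u - F y u)) \<Longrightarrow>
     x \<in> V \<Longrightarrow> length vs = j \<Longrightarrow> 
     \<bar>vfs vs (step \<epsilon> F x) u - (\<Sum>e\<in>out x. p e * vfs vs (F (tgt e)) u)\<bar> \<le> C * (\<epsilon>\<^sup>2 * K + \<epsilon> * Q) * prod_list (map norm vs)"
    by (rule step_expansion[of j]) blast
  show ?thesis
  proof (intro exI[of _ "C * K * B"] conjI allI impI)
    show "0 \<le> C * K * B" using C K B by simp
    fix \<epsilon> k x assume ad: "admissible \<epsilon> k" and x: "x \<in> V"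
    define D where "D x u = step \<epsilon> (\<lambda>x. f) x u - f u" for x u
    have tD: "test (D y)" for y unfolding D_def[abs_def]
      using test_add[OF step_test[OF f] test_scale[OF f, of "-1"]] by simp
    have "\<forall>y\<in>V. test (D y) \<and> vbound (C * K * \<epsilon>\<^sup>2) j (D y)"
    proof (intro ballI conjI tD)
      fix y assume y: "y \<in> V"
      have "\<bar>vfs vs (D y) u\<bar> \<le> C * K * \<epsilon>\<^sup>2 * prod_list (map norm vs)" if "length vs = j" for vs u
      proof -
        \<comment> \<open>At time 0 every vertex carries the same \<open>f\<close>, so the
          oscillation is 0 and no term of order \<epsilon> appears.\<close>
        have "\<bar>vfs vs (step \<epsilon> (\<lambda>x. f) y) u - (\<Sum>e\<in>out y. p e * vfs vs f u)\<bar> \<le> C * (\<epsilon>\<^sup>2 * K + \<epsilon> * 0) * prod_list (map norm vs)"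
          by (rule step) (use ad y that K test_smooth[OF f] in \<open>auto simp: vbound_def vfs_zero\<close>)
        moreover have "(\<Sum>e\<in>out y. p e * vfs vs f u) = vfs vs f u"
          using p_out[OF y] by (simp add: sum_distrib_right[symmetric])
        moreover have "vfs vs (D y) u = vfs vs (step \<epsilon> (\<lambda>x. f) y) u - vfs vs f u"
          unfolding D_def[abs_def] by (subst vfs_diff) (auto intro: smooth_step test_smooth f)
        ultimately show ?thesis by (simp add: mult_ac)
      qed
      then show "vbound (C * K * \<epsilon>\<^sup>2) j (D y)" by (simp add: vbound_def)
    qed
    then have "vbound (C * K * \<epsilon>\<^sup>2 * B) j (iter \<epsilon> k D x)"
      using B(2)[OF ad _ _ x, of "C * K * \<epsilon>\<^sup>2" D] C K by simp
    then show "vbound (C * K * B * \<epsilon>\<^sup>2) j (\<lambda>u. it \<epsilon> (Suc k) x u - it \<epsilon> k x u)"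
      unfolding D_def[abs_def] iter_diff iter_Suc' by (simp only: mult_ac)
  qed
qed

text \<open>By the Poisson estimate, one order of derivatives buys a factor \<open>\<epsilon>\<close> in the oscillation 
  over the vertices, until \<open>\<epsilon>\<^sup>2\<close> is reached.\<close>

lemma it_oscillation_improve:
  assumes "\<exists>C\<ge>0. \<forall>\<epsilon> k x y. admissible \<epsilon> k \<longrightarrow> x \<in> V \<longrightarrow> y \<in> V \<longrightarrow> 
      vbound (C * \<epsilon> ^ a) (Suc j) (\<lambda>u. it \<epsilon> k x u - it \<epsilon> k y u)" and a: "a \<le> 1"
  shows "\<exists>C\<ge>0. \<forall>\<epsilon> k x y. admissible \<epsilon> k \<longrightarrow> x \<in> V \<longrightarrow> y \<in> V \<longrightarrow> 
      vbound (C * \<epsilon> ^ Suc a) j (\<lambda>u. it \<epsilon> k x u - it \<epsilon> k y u)"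
proof -
  obtain Q where Q: "0 \<le> Q" "\<And>\<epsilon> k x y. admissible \<epsilon> k \<Longrightarrow> x \<in> V \<Longrightarrow> y \<in> V \<Longrightarrow> 
      vbound (Q * \<epsilon> ^ a) (Suc j) (\<lambda>u. it \<epsilon> k x u - it \<epsilon> k y u)" using assms by blast
  obtain K1 where K1: "0 \<le> K1" "\<And>\<epsilon> k x. admissible \<epsilon> k \<Longrightarrow> x \<in> V \<Longrightarrow> vbound K1 (Suc j) (it \<epsilon> k x)"
    using it_bound[of "Suc j"] by blast
  obtain K2 where K2: "0 \<le> K2" "\<And>\<epsilon> k x. admissible \<epsilon> k \<Longrightarrow> x \<in> V \<Longrightarrow> vbound K2 (j + 2) (it \<epsilon> k x)"
    using it_bound[of "j + 2"] by blast
  define K where "K = max K1 K2"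
  have K: "0 \<le> K" "\<And>\<epsilon> k x. admissible \<epsilon> k \<Longrightarrow> x \<in> V \<Longrightarrow> vbound K (Suc j) (it \<epsilon> k x) \<and> vbound K (j + 2) (it \<epsilon> k x)"
    using K1(1) vbound_mono[OF K1(2) max.cobounded1] vbound_mono[OF K2(2) max.cobounded2]
    by (simp_all add: K_def)
  obtain C where C: "0 \<le> C" and step: "\<And>\<epsilon> F K Q x vs u. 0 < \<epsilon> \<Longrightarrow> \<epsilon> \<le> 1 \<Longrightarrow> 0 \<le> K \<Longrightarrow> 0 \<le> Q \<Longrightarrow>
     (\<forall>x\<in>V. smooth (F x) \<and> vbound K (Suc j) (F x) \<and> vbound K (j + 2) (F x)) \<Longrightarrow>
     (\<forall>x\<in>V. \<forall>y\<in>V. vbound Q (Suc j) (\<lambda>u. F x u - F y u)) \<Longrightarrow>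
     x \<in> V \<Longrightarrow> length vs = j \<Longrightarrow> 
     \<bar>vfs vs (step \<epsilon> F x) u - (\<Sum>e\<in>out x. p e * vfs vs (F (tgt e)) u)\<bar> \<le> C * (\<epsilon>\<^sup>2 * K + \<epsilon> * Q) * prod_list (map norm vs)"
    by (rule step_expansion[of j]) blast
  obtain I where I: "0 \<le> I" "\<And>\<epsilon> k x. admissible \<epsilon> k \<Longrightarrow> x \<in> V \<Longrightarrow> vbound (I * \<epsilon>\<^sup>2) j (\<lambda>u. it \<epsilon> (Suc k) x u - it \<epsilon> k x u)"
    using it_increment[of j] by blast
  obtain P where P: "0 \<le> P" "\<And>\<phi> d x y. (\<forall>x\<in>V. \<bar>(\<Sum>e\<in>out x. p e * \<phi> (tgt e)) - \<phi> x\<bar> \<le> d) \<Longrightarrow> x \<in> V \<Longrightarrow> y \<in> V \<Longrightarrow> 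
      \<bar>\<phi> x - \<phi> y\<bar> \<le> P * d" by (rule poisson_out) blast
  show ?thesis
  proof (intro exI[of _ "P * (I + C * (K + Q))"] conjI allI impI)
    show "0 \<le> P * (I + C * (K + Q))" using P I C K Q by simp
    fix \<epsilon> k x y assume ad: "admissible \<epsilon> k" and xy: "x \<in> V" "y \<in> V"
    then have \<epsilon>: "0 < \<epsilon>" "\<epsilon> \<le> 1" by auto
    show "vbound (P * (I + C * (K + Q)) * \<epsilon> ^ Suc a) j (\<lambda>u. it \<epsilon> k x u - it \<epsilon> k y u)"
      unfolding vbound_def
    proof (intro allI impI)
      fix vs :: "'a list" and u assume vs: "length vs = j"
      let ?P = "prod_list (map norm vs)"
      have P0: "0 \<le> ?P" by (rule prod_list_norm_nonneg)
      \<comment> \<open>Measures how far the derivative, as a function of the vertex, is from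
        harmonic: the change over one time step plus the error of expanding that step.\<close>
      define d where "d = (I * \<epsilon>\<^sup>2 + C * (\<epsilon>\<^sup>2 * K + \<epsilon> * (Q * \<epsilon> ^ a))) * ?P"
      have "\<bar>vfs vs (it \<epsilon> k x) u - vfs vs (it \<epsilon> k y) u\<bar> \<le> P * d"
      proof (rule P(2)[of "\<lambda>x. vfs vs (it \<epsilon> k x) u", OF _ xy], rule ballI)
        fix x assume x: "x \<in> V"
        have "\<bar>vfs vs (step \<epsilon> (it \<epsilon> k) x) u - (\<Sum>e\<in>out x. p e * vfs vs (it \<epsilon> k (tgt e)) u)\<bar> 
            \<le> C * (\<epsilon>\<^sup>2 * K + \<epsilon> * (Q * \<epsilon> ^ a)) * ?P"
          by (rule step) (use \<epsilon> K(1) K(2)[OF ad] Q(1) Q(2)[OF ad] x vs smooth_it in auto)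
        moreover have "\<bar>vfs vs (\<lambda>u. it \<epsilon> (Suc k) x u - it \<epsilon> k x u) u\<bar> \<le> I * \<epsilon>\<^sup>2 * ?P"
          by (rule vboundD[OF I(2)[OF ad x] vs])
        moreover have "vfs vs (\<lambda>u. it \<epsilon> (Suc k) x u - it \<epsilon> k x u) u = vfs vs (step \<epsilon> (it \<epsilon> k) x) u - vfs vs (it \<epsilon> k x) u"
          using vfs_diff[OF smooth_it[OF x] smooth_it[OF x], of vs \<epsilon> "Suc k" \<epsilon> k] by (simp add: iter_Suc)
        ultimately show "\<bar>(\<Sum>e\<in>out x. p e * vfs vs (it \<epsilon> k (tgt e)) u) - vfs vs (it \<epsilon> k x) u\<bar> \<le> d"
          unfolding d_def distrib_right[of "I * \<epsilon>\<^sup>2"] by linarith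
      qed
      also have "P * d \<le> P * ((I + C * (K + Q)) * \<epsilon> ^ Suc a * ?P)"
      proof (rule mult_left_mono[OF _ P(1)], unfold d_def, rule mult_right_mono[OF _ P0])
        \<comment> \<open>The increment and the Taylor terms are of order
          \<open>\<epsilon>\<^sup>2\<close> whatever the oscillation is; this limits the gain and is
          the reason for \<open>a \<le> 1\<close>.\<close>
        have e2: "\<epsilon>\<^sup>2 \<le> \<epsilon> ^ Suc a" using \<epsilon> a by (intro power_decreasing) auto
        have "I * \<epsilon>\<^sup>2 + C * (\<epsilon>\<^sup>2 * K + \<epsilon> * (Q * \<epsilon> ^ a)) = (I + C * K) * \<epsilon>\<^sup>2 + C * Q * \<epsilon> ^ Suc a"
          by (simp add: algebra_simps)
        also have "\<dots> \<le> (I + C * K) * \<epsilon> ^ Suc a + C * Q * \<epsilon> ^ Suc a"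
          using I C K by (intro add_right_mono mult_left_mono e2) auto
        finally show "I * \<epsilon>\<^sup>2 + C * (\<epsilon>\<^sup>2 * K + \<epsilon> * (Q * \<epsilon> ^ a)) \<le> (I + C * (K + Q)) * \<epsilon> ^ Suc a"
          by (simp add: algebra_simps)
      qed
      finally show "\<bar>vfs vs (\<lambda>u. it \<epsilon> k x u - it \<epsilon> k y u) u\<bar> \<le> P * (I + C * (K + Q)) * \<epsilon> ^ Suc a * ?P"
        using vfs_diff[OF smooth_it[OF xy(1)] smooth_it[OF xy(2)], of vs \<epsilon> k \<epsilon> k] by (simp only: mult_ac)
    qed
  qed
qed

text \<open>Two rounds of the improvement start from the trivial bound for derivatives of order
  \<open>j + 2\<close>, where nothing is gained yet.\<close>

lemma it_oscillation:
  "\<exists>C\<ge>0. \<forall>\<epsilon> k x y. admissible \<epsilon> k \<longrightarrow> x \<in> V \<longrightarrow> y \<in> V \<longrightarrow> 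
      vbound (C * \<epsilon>\<^sup>2) j (\<lambda>u. it \<epsilon> k x u - it \<epsilon> k y u)"
proof -
  have "\<exists>C\<ge>0. \<forall>\<epsilon> k x y. admissible \<epsilon> k \<longrightarrow> x \<in> V \<longrightarrow> y \<in> V \<longrightarrow> 
      vbound (C * \<epsilon> ^ 0) (Suc (Suc j)) (\<lambda>u. it \<epsilon> k x u - it \<epsilon> k y u)"
  proof -
    obtain K where K: "0 \<le> K" "\<And>\<epsilon> k x. admissible \<epsilon> k \<Longrightarrow> x \<in> V \<Longrightarrow> vbound K (Suc (Suc j)) (it \<epsilon> k x)"
      using it_bound[of "Suc (Suc j)"] by blast
    show ?thesis
    proof (intro exI[of _ "2 * K"] conjI allI impI)
      fix \<epsilon> k x y assume ad: "admissible \<epsilon> k" and x: "x \<in> V" and y: "y \<in> V"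
      show "vbound (2 * K * \<epsilon> ^ 0) (Suc (Suc j)) (\<lambda>u. it \<epsilon> k x u - it \<epsilon> k y u)"
        unfolding vbound_def
      proof (intro allI impI)
        fix vs :: "'a list" and u assume vs: "length vs = Suc (Suc j)"
        show "\<bar>vfs vs (\<lambda>u. it \<epsilon> k x u - it \<epsilon> k y u) u\<bar> \<le> 2 * K * \<epsilon> ^ 0 * prod_list (map norm vs)"
          using vboundD[OF K(2)[OF ad x] vs, of u] vboundD[OF K(2)[OF ad y] vs, of u]
            vfs_diff[OF smooth_it[OF x] smooth_it[OF y], of vs \<epsilon> k \<epsilon> k] 
          by (simp add: algebra_simps)
      qed
    qed (use K in simp)
  qed
  from it_oscillation_improve[OF it_oscillation_improve[OF this]]
  show ?thesis by (simp add: numeral_2_eq_2)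
qed

text \<open>Averaging against the stationary measure removes the vertex. Only the averaged function
  has a recursion with the coefficients of \<open>gen\<close>.\<close>

definition mean :: "real \<Rightarrow> nat \<Rightarrow> 'a \<Rightarrow> real" where
  "mean \<epsilon> k u = (\<Sum>x\<in>V. m x * it \<epsilon> k x u)"

lemma mean_0: "mean \<epsilon> 0 = f"
  using m_sum by (simp add: mean_def fun_eq_iff sum_distrib_right[symmetric])

lemma test_mean: "test (mean \<epsilon> k)"
  unfolding mean_def[abs_def] by (intro test_sum test_scale test_it finite_V)

lemma vfs_mean: "vfs vs (mean \<epsilon> k) u = (\<Sum>x\<in>V. m x * vfs vs (it \<epsilon> k x) u)"
  unfolding mean_def[abs_def] by (subst vfs_sum) (auto intro!: finite_V smooth_it)

lemma m_average_bound:
  assumes "\<And>x. x \<in> V \<Longrightarrow> \<bar>h x\<bar> \<le> B"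
  shows "\<bar>\<Sum>x\<in>V. m x * h x\<bar> \<le> B"
proof -
  have "\<bar>\<Sum>x\<in>V. m x * h x\<bar> \<le> (\<Sum>x\<in>V. m x * B)"
    by (rule order_trans[OF sum_abs], rule sum_mono, unfold abs_mult)
       (use assms m_nonneg in \<open>auto intro!: mult_mono\<close>)
  also have "\<dots> = B" using m_sum by (simp add: sum_distrib_right[symmetric])
  finally show ?thesis .
qed

lemma mean_bound: "\<exists>K\<ge>0. \<forall>\<epsilon> k. admissible \<epsilon> k \<longrightarrow> vbound K j (mean \<epsilon> k)"
proof -
  obtain K where K: "0 \<le> K" "\<And>\<epsilon> k x. admissible \<epsilon> k \<Longrightarrow> x \<in> V \<Longrightarrow> vbound K j (it \<epsilon> k x)"
    using it_bound[of j] by blast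
  have "vbound K j (mean \<epsilon> k)" if "admissible \<epsilon> k" for \<epsilon> k
    unfolding vbound_def vfs_mean by (intro allI impI m_average_bound vboundD[OF K(2)[OF that]])
  with K(1) show ?thesis by blast
qed

lemma mean_oscillation: 
  "\<exists>C\<ge>0. \<forall>\<epsilon> k x vs u. admissible \<epsilon> k \<longrightarrow> x \<in> V \<longrightarrow> length vs = j \<longrightarrow>
     \<bar>vfs vs (it \<epsilon> k x) u - vfs vs (mean \<epsilon> k) u\<bar> \<le> C * \<epsilon>\<^sup>2 * prod_list (map norm vs)"
proof -
  obtain C where C: "0 \<le> C" "\<And>\<epsilon> k x y. admissible \<epsilon> k \<Longrightarrow> x \<in> V \<Longrightarrow> y \<in> V \<Longrightarrow> 
      vbound (C * \<epsilon>\<^sup>2) j (\<lambda>u. it \<epsilon> k x u - it \<epsilon> k y u)" using it_oscillation[of j] by blast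
  show ?thesis
  proof (intro exI[of _ C] conjI allI impI C(1))
    fix \<epsilon> k x and vs :: "'a list" and u assume ad: "admissible \<epsilon> k" and x: "x \<in> V" and vs: "length vs = j"
    have "vfs vs (it \<epsilon> k x) u - vfs vs (mean \<epsilon> k) u = (\<Sum>y\<in>V. m y * (vfs vs (it \<epsilon> k x) u - vfs vs (it \<epsilon> k y) u))"
      using m_sum by (simp add: vfs_mean right_diff_distrib sum_subtractf sum_distrib_right[symmetric])
    also have "\<bar>\<dots>\<bar> \<le> C * \<epsilon>\<^sup>2 * prod_list (map norm vs)"
    proof (rule m_average_bound)
      fix y assume y: "y \<in> V"
      show "\<bar>vfs vs (it \<epsilon> k x) u - vfs vs (it \<epsilon> k y) u\<bar> \<le> C * \<epsilon>\<^sup>2 * prod_list (map norm vs)"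
        using vboundD[OF C(2)[OF ad x y] vs, of u] vfs_diff[OF smooth_it[OF x] smooth_it[OF y], of vs \<epsilon> k \<epsilon> k] by simp
    qed
    finally show "\<bar>vfs vs (it \<epsilon> k x) u - vfs vs (mean \<epsilon> k) u\<bar> \<le> C * \<epsilon>\<^sup>2 * prod_list (map norm vs)" .
  qed
qed

lemma mean_Suc: "mean \<epsilon> (Suc k) u = (\<Sum>e\<in>E. q e * it \<epsilon> k (tgt e) (u \<diamondop> w \<epsilon> e))"
proof -
  have "mean \<epsilon> (Suc k) u = (\<Sum>x\<in>V. \<Sum>e\<in>out x. q e * it \<epsilon> k (tgt e) (u \<diamondop> w \<epsilon> e))"
    unfolding mean_def iter_Suc step_def
    by (auto simp: q_def out sum_distrib_left mult_ac intro!: sum.cong)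
  then show ?thesis by (simp only: sum_out)
qed

text \<open>Telescoping: one of the two directions is exchanged at a time.\<close>

lemma vf2_perturbation:
  assumes F: "smooth F" "vbound K 2 F" and K: "0 \<le> K"
  shows "\<bar>vf a (vf a F) u - vf b (vf b F) u\<bar> \<le> K * (norm (a - b) * norm a + norm b * norm (a - b))"
proof -
  have "vf a F = (\<lambda>u. vf (a - b) F u + vf b F u)"
    using linear_add[OF linear_vf[OF F(1)], of "a - b" b] by (simp add: fun_eq_iff)
  then have "vf b (vf a F) u = vf b (vf (a - b) F) u + vf b (vf b F) u"
    using vf_add[OF smooth_vf[OF F(1)] smooth_vf[OF F(1)], of b "a - b" b u] by simp
  moreover have "vf a (vf a F) u = vf (a - b) (vf a F) u + vf b (vf a F) u"
    using linear_add[OF linear_vf[OF smooth_vf[OF F(1)]], of "a - b" b a u] by simp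
  ultimately have "vf a (vf a F) u - vf b (vf b F) u = vfs [a - b, a] F u + vfs [b, a - b] F u" by simp
  moreover have "\<bar>vfs [a - b, a] F u\<bar> \<le> K * (norm (a - b) * norm a)" 
    "\<bar>vfs [b, a - b] F u\<bar> \<le> K * (norm b * norm (a - b))"
    using vboundD[OF F(2), of "[a - b, a]" u] vboundD[OF F(2), of "[b, a - b]" u] by simp_all
  ultimately show ?thesis unfolding distrib_left by linarith
qed

text \<open>Each edge is expanded to third order. Iterates are replaced by their average only under
  derivatives along the step, which costs \<open>\<epsilon> * \<epsilon>\<^sup>2\<close> or less,
  and the step is replaced by its first layer only in the second derivative. The undifferentiated
  terms sum exactly to the average.\<close>

lemma mean_consistency:
  "\<exists>C\<ge>0. \<forall>\<epsilon> k u. admissible \<epsilon> k \<longrightarrow> 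
     \<bar>mean \<epsilon> (Suc k) u - mean \<epsilon> k u - \<epsilon>\<^sup>2 * gen (mean \<epsilon> k) u\<bar> \<le> C * \<epsilon> ^ 3"
proof -
  obtain T where T: "0 \<le> T" and taylor: "\<And>F K w u. smooth F \<Longrightarrow> vbound K 3 F \<Longrightarrow> 0 \<le> K \<Longrightarrow> norm w \<le> 3 * W \<Longrightarrow>
      \<bar>F (u \<diamondop> w) - (\<Sum>m<3. vfs (replicate m w) F u / fact m)\<bar> \<le> T * K * norm w ^ 3"
    by (rule taylor_bound[of 3 "3 * W"]) (simp, blast)
  obtain K1 where K1: "0 \<le> K1" "\<And>\<epsilon> k. admissible \<epsilon> k \<Longrightarrow> vbound K1 1 (mean \<epsilon> k)" using mean_bound[of 1] by blast
  obtain K2 where K2: "0 \<le> K2" "\<And>\<epsilon> k. admissible \<epsilon> k \<Longrightarrow> vbound K2 2 (mean \<epsilon> k)" using mean_bound[of 2] by blast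
  obtain K3 where K3: "0 \<le> K3" "\<And>\<epsilon> k x. admissible \<epsilon> k \<Longrightarrow> x \<in> V \<Longrightarrow> vbound K3 3 (it \<epsilon> k x)" using it_bound[of 3] by blast
  obtain C1 where C1: "0 \<le> C1" "\<And>\<epsilon> k x vs u. admissible \<epsilon> k \<Longrightarrow> x \<in> V \<Longrightarrow> length vs = 1 \<Longrightarrow>
     \<bar>vfs vs (it \<epsilon> k x) u - vfs vs (mean \<epsilon> k) u\<bar> \<le> C1 * \<epsilon>\<^sup>2 * prod_list (map norm vs)" using mean_oscillation[of 1] by blast
  obtain C2 where C2: "0 \<le> C2" "\<And>\<epsilon> k x vs u. admissible \<epsilon> k \<Longrightarrow> x \<in> V \<Longrightarrow> length vs = 2 \<Longrightarrow>
     \<bar>vfs vs (it \<epsilon> k x) u - vfs vs (mean \<epsilon> k) u\<bar> \<le> C2 * \<epsilon>\<^sup>2 * prod_list (map norm vs)" using mean_oscillation[of 2] by blast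
  \<comment> \<open>The summands belong to the estimates 1 to 4 below; the 8 in the last one is 2 *
    3 + 1 * 2, from the two terms of \<open>vf2_perturbation\<close>.\<close>
  define C where "C = T * K3 * (3 * W) ^ 3 + C1 * (3 * W) + C2 * (3 * W)\<^sup>2 + K2 * (8 * W\<^sup>2)"
  have C: "0 \<le> C" using T K3 C1 C2 K2 W_nonneg by (simp add: C_def)
  show ?thesis
  proof (intro exI[of _ "C + K1 * W"] conjI allI impI)
    show "0 \<le> C + K1 * W" using C K1 W_nonneg by simp
    fix \<epsilon> k u assume ad: "admissible \<epsilon> k"
    then have \<epsilon>: "0 < \<epsilon>" "\<epsilon> \<le> 1" by auto
    let ?M = "mean \<epsilon> k"
    have sM: "smooth ?M" by (rule test_smooth[OF test_mean])
    define r where "r e = it \<epsilon> k (tgt e) (u \<diamondop> w \<epsilon> e) - it \<epsilon> k (tgt e) u - vf (w \<epsilon> e) ?M u 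
        - \<epsilon>\<^sup>2 * (1 / 2 * vf (z1 e) (vf (z1 e) ?M) u)" for e
    have r: "\<bar>r e\<bar> \<le> C * \<epsilon> ^ 3" if e: "e \<in> E" for e
    proof -
      let ?w = "w \<epsilon> e" and ?F = "it \<epsilon> k (tgt e)"
      have t: "tgt e \<in> V" by (rule tgt[OF e])
      have nw: "norm ?w \<le> 3 * W * \<epsilon>" by (rule w_bound[OF e \<epsilon>])
      have "\<bar>?F (u \<diamondop> ?w) - (\<Sum>m<3. vfs (replicate m ?w) ?F u / fact m)\<bar> \<le> T * K3 * norm ?w ^ 3"
        by (rule taylor) (use smooth_it[OF t] K3(1) K3(2)[OF ad t] w_bound'[OF e \<epsilon>] in auto)
      also have "\<dots> \<le> T * K3 * (3 * W * \<epsilon>) ^ 3"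
        using T K3 nw by (auto intro!: mult_left_mono power_mono)
      finally have 1: "\<bar>?F (u \<diamondop> ?w) - ?F u - vf ?w ?F u - 1 / 2 * vf ?w (vf ?w ?F) u\<bar> \<le> T * K3 * (3 * W) ^ 3 * \<epsilon> ^ 3"
        by (simp add: eval_nat_numeral power_mult_distrib mult_ac algebra_simps)
      have "\<bar>vf ?w ?F u - vf ?w ?M u\<bar> \<le> C1 * \<epsilon>\<^sup>2 * norm ?w"
        using C1(2)[OF ad t, of "[?w]" u] by simp
      also have "\<dots> \<le> C1 * \<epsilon>\<^sup>2 * (3 * W * \<epsilon>)" by (intro mult_left_mono nw) (use C1 in simp)
      finally have 2: "\<bar>vf ?w ?F u - vf ?w ?M u\<bar> \<le> C1 * (3 * W) * \<epsilon> ^ 3"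
        by (simp add: power2_eq_square power3_eq_cube mult_ac)
      have "\<bar>vf ?w (vf ?w ?F) u - vf ?w (vf ?w ?M) u\<bar> \<le> C2 * \<epsilon>\<^sup>2 * (norm ?w * norm ?w)"
        using C2(2)[OF ad t, of "[?w, ?w]" u] by simp
      \<comment> \<open>One of the two steps is bounded by a constant only: the available fourth
        power of \<epsilon> is weakened to the third.\<close>
      also have "\<dots> \<le> C2 * \<epsilon>\<^sup>2 * ((3 * W * \<epsilon>) * (3 * W * 1))"
        using nw w_bound'[OF e \<epsilon>] C2 \<epsilon> W_nonneg by (intro mult_left_mono mult_mono) auto
      finally have 3: "\<bar>vf ?w (vf ?w ?F) u - vf ?w (vf ?w ?M) u\<bar> \<le> C2 * (3 * W)\<^sup>2 * \<epsilon> ^ 3"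
        by (simp add: power2_eq_square power3_eq_cube mult_ac)
      let ?z = "\<epsilon> *\<^sub>R z1 e"
      have nz: "norm ?z \<le> W * \<epsilon>" using z1_bound[OF e] \<epsilon> by (simp add: mult.commute mult_right_mono)
      have "\<bar>vf ?w (vf ?w ?M) u - vf ?z (vf ?z ?M) u\<bar> \<le> K2 * (norm (?w - ?z) * norm ?w + norm ?z * norm (?w - ?z))"
        by (rule vf2_perturbation[OF sM K2(2)[OF ad] K2(1)])
      also have "\<dots> \<le> K2 * ((2 * W * \<epsilon>\<^sup>2) * (3 * W * \<epsilon>) + (W * \<epsilon>) * (2 * W * \<epsilon>\<^sup>2))"
        using w_first_order[OF e \<epsilon>] nw nz K2(1) W_nonneg \<epsilon>
        by (intro mult_left_mono add_mono mult_mono) auto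
      finally have 4: "\<bar>vf ?w (vf ?w ?M) u - vf ?z (vf ?z ?M) u\<bar> \<le> K2 * (8 * W\<^sup>2) * \<epsilon> ^ 3"
        by (simp add: power2_eq_square power3_eq_cube algebra_simps)
      have z: "vf ?z (vf ?z ?M) u = \<epsilon>\<^sup>2 * vf (z1 e) (vf (z1 e) ?M) u"
      proof -
        have "vf ?z ?M = (\<lambda>u. \<epsilon> * vf (z1 e) ?M u)" 
          using linear_scale[OF linear_vf[OF sM], of \<epsilon> "z1 e"] by (simp add: fun_eq_iff)
        then show ?thesis
          using linear_scale[OF linear_vf[OF smooth_vf[OF sM]], of \<epsilon> "z1 e" "z1 e" u] 
          by (simp add: vf_scale smooth_vf sM power2_eq_square)
      qed
      have req: "r e = (?F (u \<diamondop> ?w) - ?F u - vf ?w ?F u - 1 / 2 * vf ?w (vf ?w ?F) u) + (vf ?w ?F u - vf ?w ?M u)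
         + 1 / 2 * (vf ?w (vf ?w ?F) u - vf ?w (vf ?w ?M) u) + 1 / 2 * (vf ?w (vf ?w ?M) u - vf ?z (vf ?z ?M) u)"
        unfolding r_def z by (simp add: algebra_simps)
      have sum4: "\<And>a b c d A B C D :: real. \<bar>a\<bar> \<le> A \<Longrightarrow> \<bar>b\<bar> \<le> B \<Longrightarrow> \<bar>c\<bar> \<le> C \<Longrightarrow> \<bar>d\<bar> \<le> D \<Longrightarrow> 
          \<bar>a + b + 1 / 2 * c + 1 / 2 * d\<bar> \<le> A + B + C + D" by linarith
      have "\<bar>r e\<bar> \<le> T * K3 * (3 * W) ^ 3 * \<epsilon> ^ 3 + C1 * (3 * W) * \<epsilon> ^ 3 + C2 * (3 * W)\<^sup>2 * \<epsilon> ^ 3 + K2 * (8 * W\<^sup>2) * \<epsilon> ^ 3"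
        unfolding req by (rule sum4[OF 1 2 3 4])
      then show ?thesis unfolding C_def by (simp only: distrib_right)
    qed
    \<comment> \<open>The first layer has mean zero, so the mean step is the drift at order
      \<open>\<epsilon>\<^sup>2\<close> up to an error of order
      \<open>\<epsilon> ^ 3\<close>.\<close>
    have "(\<Sum>e\<in>E. q e *\<^sub>R w \<epsilon> e) = \<epsilon>\<^sup>2 *\<^sub>R drift + (\<Sum>e\<in>E. q e *\<^sub>R (w \<epsilon> e - \<epsilon> *\<^sub>R z1 e - \<epsilon>\<^sup>2 *\<^sub>R z2 e))"
    proof -
      have "(\<Sum>e\<in>E. q e *\<^sub>R (w \<epsilon> e - \<epsilon> *\<^sub>R z1 e - \<epsilon>\<^sup>2 *\<^sub>R z2 e)) = 
        (\<Sum>e\<in>E. q e *\<^sub>R w \<epsilon> e) - \<epsilon> *\<^sub>R (\<Sum>e\<in>E. q e *\<^sub>R z1 e) - \<epsilon>\<^sup>2 *\<^sub>R drift"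
        by (simp add: scaleR_diff_right sum_subtractf scaleR_sum_right drift_def mult.commute)
      then show ?thesis by (simp add: q_centered)
    qed
    moreover have "(\<Sum>e\<in>E. q e * vf (w \<epsilon> e) ?M u) = vf (\<Sum>e\<in>E. q e *\<^sub>R w \<epsilon> e) ?M u"
      by (simp add: linear_sum[OF linear_vf[OF sM]] linear_scale[OF linear_vf[OF sM]])
    ultimately have d: "(\<Sum>e\<in>E. q e * vf (w \<epsilon> e) ?M u) = 
        \<epsilon>\<^sup>2 * vf drift ?M u + vf (\<Sum>e\<in>E. q e *\<^sub>R (w \<epsilon> e - \<epsilon> *\<^sub>R z1 e - \<epsilon>\<^sup>2 *\<^sub>R z2 e)) ?M u" (is "_ = _ + vf ?d ?M u")
      by (simp add: linear_add[OF linear_vf[OF sM]] linear_scale[OF linear_vf[OF sM]])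
    have "\<bar>vf ?d ?M u\<bar> \<le> K1 * norm ?d" using vboundD[OF K1(2)[OF ad], of "[?d]" u] by simp
    also have "\<dots> \<le> K1 * (W * \<epsilon> ^ 3)"
      by (intro mult_left_mono q_average_bound_norm w_expansion \<epsilon> K1)
    finally have d': "\<bar>vf ?d ?M u\<bar> \<le> K1 * W * \<epsilon> ^ 3" by (simp only: mult.assoc)
    have "mean \<epsilon> (Suc k) u = (\<Sum>e\<in>E. q e * (r e + it \<epsilon> k (tgt e) u + vf (w \<epsilon> e) ?M u 
        + \<epsilon>\<^sup>2 * (1 / 2 * vf (z1 e) (vf (z1 e) ?M) u)))"
      unfolding mean_Suc r_def by simp
    also have "\<dots> = (\<Sum>e\<in>E. q e * r e) + (\<Sum>e\<in>E. q e * it \<epsilon> k (tgt e) u) + (\<Sum>e\<in>E. q e * vf (w \<epsilon> e) ?M u)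
        + \<epsilon>\<^sup>2 * (1 / 2 * (\<Sum>e\<in>E. q e * vf (z1 e) (vf (z1 e) ?M) u))"
      by (simp add: distrib_left sum.distrib sum_distrib_left mult_ac)
    \<comment> \<open>Stationarity gives this without error. Bounding the oscillation here would
      cost \<open>\<epsilon>\<^sup>2\<close> in each step, which is too much.\<close>
    also have "(\<Sum>e\<in>E. q e * it \<epsilon> k (tgt e) u) = ?M u"
      using stationary[of "\<lambda>x. it \<epsilon> k x u"] by (simp add: q_def mean_def)
    finally have "mean \<epsilon> (Suc k) u - ?M u - \<epsilon>\<^sup>2 * gen ?M u = (\<Sum>e\<in>E. q e * r e) + vf ?d ?M u"
      unfolding d gen_def by (simp add: algebra_simps)
    moreover have "\<bar>\<Sum>e\<in>E. q e * r e\<bar> \<le> C * \<epsilon> ^ 3" by (rule q_average_bound[OF r])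
    ultimately show "\<bar>mean \<epsilon> (Suc k) u - ?M u - \<epsilon>\<^sup>2 * gen ?M u\<bar> \<le> (C + K1 * W) * \<epsilon> ^ 3"
      using d' unfolding distrib_right by linarith
  qed
qed

text \<open>Controls the second order remainder of the semigroup at the averaged iterates. Each
  \<open>gen\<close> uses one or two derivatives, so orders 2 to 4 occur.\<close>

lemma gen_gen_mean_bound: "\<exists>K\<ge>0. \<forall>\<epsilon> k u. admissible \<epsilon> k \<longrightarrow> \<bar>gen (gen (mean \<epsilon> k)) u\<bar> \<le> K"
proof -
  obtain B where B: "\<And>j. 0 \<le> B j" "\<And>j \<epsilon> k. admissible \<epsilon> k \<Longrightarrow> vbound (B j) j (mean \<epsilon> k)" using mean_bound by metis
  define K where "K = B 2 + B 3 + B 4"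
  have K: "0 \<le> K" "B 2 \<le> K" "B 3 \<le> K" "B 4 \<le> K" using B(1)[of 2] B(1)[of 3] B(1)[of 4] by (simp_all add: K_def)
  show ?thesis
  proof (intro exI[of _ "K * (W + W\<^sup>2) * (W + W\<^sup>2)"] conjI allI impI)
    show "0 \<le> K * (W + W\<^sup>2) * (W + W\<^sup>2)" using K W_nonneg by simp
    fix \<epsilon> k u assume ad: "admissible \<epsilon> k"
    have sM: "smooth (mean \<epsilon> k)" by (rule test_smooth[OF test_mean])
    have b: "vbound K 2 (mean \<epsilon> k)" "vbound K 3 (mean \<epsilon> k)" "vbound K 4 (mean \<epsilon> k)"
      using vbound_mono[OF B(2)[OF ad]] K by blast+
    have "vbound (K * (W + W\<^sup>2)) 1 (gen (mean \<epsilon> k))" "vbound (K * (W + W\<^sup>2)) 2 (gen (mean \<epsilon> k))"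
      using vbound_gen[OF sM, of K 1] vbound_gen[OF sM, of K 2] b K by (simp_all add: eval_nat_numeral)
    then have "vbound (K * (W + W\<^sup>2) * (W + W\<^sup>2)) 0 (gen (gen (mean \<epsilon> k)))"
      using vbound_gen[OF test_smooth[OF test_gen[OF test_mean]], of "K * (W + W\<^sup>2)" 0 \<epsilon> k] K W_nonneg 
      by (simp add: eval_nat_numeral)
    from vboundD[OF this, of "[]" u] show "\<bar>gen (gen (mean \<epsilon> k)) u\<bar> \<le> K * (W + W\<^sup>2) * (W + W\<^sup>2)" by simp
  qed
qed

text \<open>Allows a bounded right factor in the position, as it arises when \<open>\<Phi>\<close>
  takes the place of \<open>\<Phi>\<^sub>0\<close>.\<close>

lemma it_lipschitz:
  "\<exists>C\<ge>0. \<forall>\<epsilon> k x u v. admissible \<epsilon> k \<longrightarrow> x \<in> V \<longrightarrow> norm v \<le> R \<longrightarrow> \<bar>it \<epsilon> k x (u \<diamondop> v) - it \<epsilon> k x u\<bar> \<le> C * norm v"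
proof -
  obtain T where T: "0 \<le> T" and taylor: "\<And>F K w u. smooth F \<Longrightarrow> vbound K 1 F \<Longrightarrow> 0 \<le> K \<Longrightarrow> norm w \<le> R \<Longrightarrow>
      \<bar>F (u \<diamondop> w) - (\<Sum>m<1. vfs (replicate m w) F u / fact m)\<bar> \<le> T * K * norm w ^ 1"
    by (rule taylor_bound[of 1 R]) (simp, blast)
  obtain K where K: "0 \<le> K" "\<And>\<epsilon> k x. admissible \<epsilon> k \<Longrightarrow> x \<in> V \<Longrightarrow> vbound K 1 (it \<epsilon> k x)"
    using it_bound[of 1] by blast
  show ?thesis
  proof (intro exI[of _ "T * K"] conjI allI impI)
    fix \<epsilon> k x and u v :: 'a assume ad: "admissible \<epsilon> k" and x: "x \<in> V" and v: "norm v \<le> R"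
    show "\<bar>it \<epsilon> k x (u \<diamondop> v) - it \<epsilon> k x u\<bar> \<le> T * K * norm v"
      using taylor[OF smooth_it[OF x] K(2)[OF ad x] K(1) v, of u] by simp
  qed (use T K in simp)
qed

end

end

section \<open>Contraction semigroups\<close>

text \<open>\<open>M\<close> will be the bounded Borel functions, on which the operators are defined
  and contract; \<open>D\<close> the test functions. \<open>D\<close> is not assumed invariant under
  \<open>T\<close>, so the generator is only ever applied at time 0 and all later times are handled
  by contraction.\<close>

locale generated_semigroup =
  fixes T :: "real \<Rightarrow> ('g \<Rightarrow> real) \<Rightarrow> 'g \<Rightarrow> real" and M D :: "('g \<Rightarrow> real) set" 
    and A :: "('g \<Rightarrow> real) \<Rightarrow> 'g \<Rightarrow> real"
  assumes T_M: "\<phi> \<in> M \<Longrightarrow> 0 \<le> t \<Longrightarrow> T t \<phi> \<in> M"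
    and M_diff: "\<phi> \<in> M \<Longrightarrow> \<psi> \<in> M \<Longrightarrow> (\<lambda>x. \<phi> x - \<psi> x) \<in> M"
    and M_scale: "\<phi> \<in> M \<Longrightarrow> (\<lambda>x. c * \<phi> x) \<in> M"
    and T_diff: "\<phi> \<in> M \<Longrightarrow> \<psi> \<in> M \<Longrightarrow> 0 \<le> t \<Longrightarrow> T t (\<lambda>x. \<phi> x - \<psi> x) x = T t \<phi> x - T t \<psi> x"
    and T_scale: "\<phi> \<in> M \<Longrightarrow> 0 \<le> t \<Longrightarrow> T t (\<lambda>x. c * \<phi> x) x = c * T t \<phi> x"
    and T_contraction: "\<phi> \<in> M \<Longrightarrow> 0 \<le> t \<Longrightarrow> (\<And>x. \<bar>\<phi> x\<bar> \<le> B) \<Longrightarrow> \<bar>T t \<phi> x\<bar> \<le> B"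
    and T_add: "\<phi> \<in> M \<Longrightarrow> 0 \<le> s \<Longrightarrow> 0 \<le> t \<Longrightarrow> T (s + t) \<phi> = T s (T t \<phi>)"
    and T_0: "\<phi> \<in> M \<Longrightarrow> T 0 \<phi> = \<phi>"
    and D_M: "D \<subseteq> M" and A_D: "\<phi> \<in> D \<Longrightarrow> A \<phi> \<in> D"
    and generator: "\<phi> \<in> D \<Longrightarrow> uniform_limit UNIV (\<lambda>t x. (T t \<phi> x - \<phi> x) / t) (A \<phi>) (at_right 0)"
begin

text \<open>The limit defining the generator comes without a rate. Any prescribed accuracy is
  reached after cutting the interval of length \<open>h\<close> into \<open>n\<close> equal pieces
  that are short enough.\<close>

lemma generator_bound:
  assumes \<phi>: "\<phi> \<in> D" and \<eta>: "0 < \<eta>" and h: "0 < h"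
  obtains s n where "0 < s" "h = real n * s" "\<And>x. \<bar>T s \<phi> x - \<phi> x - s * A \<phi> x\<bar> \<le> s * \<eta>"
proof -
  have "\<forall>\<^sub>F t in at_right 0. \<forall>x\<in>UNIV. dist ((T t \<phi> x - \<phi> x) / t) (A \<phi> x) < \<eta>"
    using uniform_limitD[OF generator[OF \<phi>] \<eta>] .
  then obtain \<delta> where \<delta>: "0 < \<delta>" "\<And>t x. 0 < t \<Longrightarrow> t < \<delta> \<Longrightarrow> dist ((T t \<phi> x - \<phi> x) / t) (A \<phi> x) < \<eta>"
    by (auto simp: eventually_at_right_field)
  obtain n where n: "h / \<delta> < real n" using reals_Archimedean2 by blast
  have n0: "0 < real n" using n h \<delta>(1) by (metis divide_pos_pos order_less_trans)
  define s where "s = h / n"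
  have s: "0 < s" "s < \<delta>" using n n0 h \<delta>(1) by (auto simp: s_def divide_simps mult.commute)
  show ?thesis
  proof (rule that[of s n])
    fix x
    have "\<bar>(T s \<phi> x - \<phi> x) / s - A \<phi> x\<bar> \<le> \<eta>" using \<delta>(2)[OF s, of x] by (simp add: dist_real_def)
    then have "s * \<bar>(T s \<phi> x - \<phi> x) / s - A \<phi> x\<bar> \<le> s * \<eta>" using s by (intro mult_left_mono) auto
    moreover have "s * \<bar>(T s \<phi> x - \<phi> x) / s - A \<phi> x\<bar> = \<bar>s * ((T s \<phi> x - \<phi> x) / s - A \<phi> x)\<bar>"
      using s by (simp add: abs_mult)
    moreover have "s * ((T s \<phi> x - \<phi> x) / s - A \<phi> x) = T s \<phi> x - \<phi> x - s * A \<phi> x"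
      using s by (simp add: field_simps)
    ultimately show "\<bar>T s \<phi> x - \<phi> x - s * A \<phi> x\<bar> \<le> s * \<eta>" by simp
  qed (use s n0 in \<open>auto simp: s_def\<close>)
qed

text \<open>The discrete form of writing the increment as the integral of
  \<open>T s (A \<phi>)\<close>: the interval is partitioned, contraction bounds each piece, and the
  accuracy \<eta> is arbitrary.\<close>

lemma first_order:
  assumes \<phi>: "\<phi> \<in> D" and a: "\<And>x. \<bar>A \<phi> x\<bar> \<le> a" and h: "0 \<le> h"
  shows "\<bar>T h \<phi> x - \<phi> x\<bar> \<le> h * a"
proof (cases "h = 0")
  case True
  then show ?thesis using T_0 \<phi> D_M by auto
next
  case False
  then have h: "0 < h" using h by simp
  have M: "\<phi> \<in> M" using \<phi> D_M by auto
  show ?thesis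
  proof (rule field_le_epsilon)
    fix \<eta> :: real assume \<eta>: "0 < \<eta>"
    then obtain s n where s: "0 < s" and hn: "h = real n * s" 
      and g: "\<And>x. \<bar>T s \<phi> x - \<phi> x - s * A \<phi> x\<bar> \<le> s * (\<eta> / h)"
      using generator_bound[OF \<phi>, of "\<eta> / h" h] h by auto
    have s1: "\<bar>T s \<phi> x - \<phi> x\<bar> \<le> s * (a + \<eta> / h)" for x
    proof -
      have "\<bar>s * A \<phi> x\<bar> \<le> s * a" using a[of x] s by (simp add: abs_mult mult_left_mono)
      then show ?thesis using g[of x] by (simp only: distrib_left)
    qed
    have "\<bar>T (real k * s) \<phi> x - \<phi> x\<bar> \<le> real k * (s * (a + \<eta> / h))" for k x
    proof (induction k arbitrary: x)
      case 0
      then show ?case using T_0[OF M] by simp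
    next
      case (Suc k)
      have eq: "T (real (Suc k) * s) \<phi> x - T (real k * s) \<phi> x = T (real k * s) (\<lambda>x. T s \<phi> x - \<phi> x) x"
        using T_add[OF M, of "real k * s" s] T_diff[OF T_M[OF M, of s] M, of "real k * s" x] s
        by (simp add: distrib_right add.commute)
      have "\<bar>T (real k * s) (\<lambda>x. T s \<phi> x - \<phi> x) x\<bar> \<le> s * (a + \<eta> / h)"
        by (rule T_contraction) (use s s1 T_M M M_diff in auto)
      then have "\<bar>T (real (Suc k) * s) \<phi> x - \<phi> x\<bar> \<le> s * (a + \<eta> / h) + real k * (s * (a + \<eta> / h))"
        using Suc.IH[of x] eq by linarith
      then show ?case by (simp add: distrib_right)
    qed
    from this[of n x] have "\<bar>T h \<phi> x - \<phi> x\<bar> \<le> h * (a + \<eta> / h)" 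
      unfolding hn by (simp only: mult.assoc)
    also have "\<dots> = h * a + \<eta>" using h by (simp add: distrib_left)
    finally show "\<bar>T h \<phi> x - \<phi> x\<bar> \<le> h * a + \<eta>" .
  qed
qed

text \<open>The same partition, with \<open>A \<phi>\<close> subtracted from each piece. The
  deviation of \<open>T t (A \<phi>)\<close> from \<open>A \<phi>\<close> is bounded by
  \<open>first_order\<close>, since \<open>A\<close> maps \<open>D\<close> into itself.\<close>

lemma second_order:
  assumes \<phi>: "\<phi> \<in> D" and b: "\<And>x. \<bar>A (A \<phi>) x\<bar> \<le> b" and h: "0 \<le> h"
  shows "\<bar>T h \<phi> x - \<phi> x - h * A \<phi> x\<bar> \<le> h\<^sup>2 * b"
proof (cases "h = 0")
  case True
  then show ?thesis using T_0 \<phi> D_M by auto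
next
  case False
  then have h: "0 < h" using h by simp
  have M: "\<phi> \<in> M" "A \<phi> \<in> M" using \<phi> D_M A_D by auto
  have b0: "0 \<le> b" using b[of x] by linarith
  show ?thesis
  proof (rule field_le_epsilon)
    fix \<eta> :: real assume \<eta>: "0 < \<eta>"
    then obtain s n where s: "0 < s" and hn: "h = real n * s" 
      and g: "\<And>x. \<bar>T s \<phi> x - \<phi> x - s * A \<phi> x\<bar> \<le> s * (\<eta> / h)"
      using generator_bound[OF \<phi>, of "\<eta> / h" h] h by auto
    have "\<bar>T (real k * s) \<phi> x - \<phi> x - real k * s * A \<phi> x\<bar> \<le> real k * s * (\<eta> / h) + (real k * s)\<^sup>2 * b" for k x
    proof (induction k arbitrary: x)
      case 0
      then show ?case using T_0[OF M(1)] by simp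
    next
      case (Suc k)
      define t where "t = real k * s"
      have t: "0 \<le> t" "real (Suc k) * s = t + s" using s by (auto simp: t_def distrib_right)
      let ?r = "\<lambda>x. T s \<phi> x - \<phi> x - s * A \<phi> x"
      have mr: "(\<lambda>x. T s \<phi> x - \<phi> x) \<in> M" using s by (intro M_diff T_M M) auto
      \<comment> \<open>Error of the new short piece carried by \<open>T t\<close>, motion of
        \<open>A \<phi>\<close> up to time \<open>t\<close>, and the error already
        accumulated.\<close>
      have eq: "T (t + s) \<phi> x - \<phi> x - (t + s) * A \<phi> x = 
          T t ?r x + s * (T t (A \<phi>) x - A \<phi> x) + (T t \<phi> x - \<phi> x - t * A \<phi> x)"
        using T_add[OF M(1) t(1), of s] T_diff[OF T_M[OF M(1), of s] M(1) t(1), of x] s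
          T_diff[OF mr M_scale[OF M(2), of s] t(1), of x] T_scale[OF M(2) t(1), of s x]
        by (simp add: algebra_simps)
      have 1: "\<bar>T t ?r x\<bar> \<le> s * (\<eta> / h)"
        by (rule T_contraction[OF M_diff[OF mr M_scale[OF M(2)]] t(1) g])
      have "\<bar>T t (A \<phi>) x - A \<phi> x\<bar> \<le> t * b"
        by (rule first_order[OF A_D[OF \<phi>] b t(1)])
      then have 2: "\<bar>s * (T t (A \<phi>) x - A \<phi> x)\<bar> \<le> s * (t * b)"
        using s by (simp add: abs_mult mult_left_mono)
      have 3: "\<bar>T t \<phi> x - \<phi> x - t * A \<phi> x\<bar> \<le> t * (\<eta> / h) + t\<^sup>2 * b"
        using Suc.IH[of x] by (simp only: t_def)
      have "s * (t * b) + t\<^sup>2 * b \<le> (t + s)\<^sup>2 * b"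
      proof -
        have "0 \<le> (s * t + s\<^sup>2) * b" using s t b0 by simp
        then show ?thesis by (simp add: power2_eq_square algebra_simps)
      qed
      then have "\<bar>T (t + s) \<phi> x - \<phi> x - (t + s) * A \<phi> x\<bar> \<le> (t + s) * (\<eta> / h) + (t + s)\<^sup>2 * b"
        using 1 2 3 unfolding eq distrib_right[of t s "\<eta> / h"] by linarith
      then show ?case by (simp only: t(2))
    qed
    from this[of n x] have "\<bar>T h \<phi> x - \<phi> x - h * A \<phi> x\<bar> \<le> h * (\<eta> / h) + h\<^sup>2 * b" 
      by (simp only: hn)
    then show "\<bar>T h \<phi> x - \<phi> x - h * A \<phi> x\<bar> \<le> h\<^sup>2 * b + \<eta>" using h by simp
  qed
qed

text \<open>Stability and consistency: the error so far is carried on by the contraction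
  \<open>T h\<close>, and each step adds its local error. Expansions are made at
  \<open>\<psi> k\<close>, which lies in \<open>D\<close>, never at the evolved function.\<close>

lemma approximation_chain:
  assumes \<psi>: "\<And>k. k \<le> N \<Longrightarrow> \<psi> k \<in> D" and h: "0 \<le> h"
    and c: "\<And>k x. k < N \<Longrightarrow> \<bar>\<psi> (Suc k) x - \<psi> k x - h * A (\<psi> k) x\<bar> \<le> c"
    and b: "\<And>k x. k < N \<Longrightarrow> \<bar>A (A (\<psi> k)) x\<bar> \<le> b"
  shows "\<bar>T (real N * h) (\<psi> 0) x - \<psi> N x\<bar> \<le> real N * (c + h\<^sup>2 * b)"
proof -
  have "\<bar>T (real k * h) (\<psi> 0) x - \<psi> k x\<bar> \<le> real k * (c + h\<^sup>2 * b)" if "k \<le> N" for k x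
    using that
  proof (induction k arbitrary: x)
    case 0
    then show ?case using T_0[of "\<psi> 0"] \<psi>[of 0] D_M by auto
  next
    case (Suc k)
    then have k: "k < N" "k \<le> N" by auto
    have M: "\<psi> 0 \<in> M" "\<psi> k \<in> M" using \<psi> D_M k by auto
    have T: "T (real k * h) (\<psi> 0) \<in> M" using M h by (intro T_M) auto
    have eq: "T (real (Suc k) * h) (\<psi> 0) x - \<psi> (Suc k) x = 
      T h (\<lambda>x. T (real k * h) (\<psi> 0) x - \<psi> k x) x + (T h (\<psi> k) x - \<psi> k x - h * A (\<psi> k) x) - 
      (\<psi> (Suc k) x - \<psi> k x - h * A (\<psi> k) x)"
      using T_add[OF M(1) h, of "real k * h"] T_diff[OF T M(2) h, of x] h by (simp add: algebra_simps)
    have "\<bar>T h (\<lambda>x. T (real k * h) (\<psi> 0) x - \<psi> k x) x\<bar> \<le> real k * (c + h\<^sup>2 * b)"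
      by (rule T_contraction[OF M_diff[OF T M(2)] h Suc.IH[OF k(2)]])
    moreover have "\<bar>T h (\<psi> k) x - \<psi> k x - h * A (\<psi> k) x\<bar> \<le> h\<^sup>2 * b"
      by (rule second_order[OF \<psi>[OF k(2)] b[OF k(1)] h])
    ultimately have "\<bar>T (real (Suc k) * h) (\<psi> 0) x - \<psi> (Suc k) x\<bar> \<le> real k * (c + h\<^sup>2 * b) + h\<^sup>2 * b + c"
      using c[OF k(1), of x] unfolding eq by linarith
    then show ?case by (simp add: algebra_simps)
  qed
  then show ?thesis by simp
qed

end

section \<open>The heat semigroup on bounded Borel functions\<close>

lemma heat_generated_semigroup:
  fixes G :: "('g::{t2_space,second_countable_topology}, 'a::euclidean_space) lie_data"
  assumes G: "group G" "carrier G = UNIV"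
    and cont: "continuous_on UNIV (\<lambda>(x, y). x \<otimes>\<^bsub>G\<^esub> y)"
    and conv: "convolution_semigroup G \<nu>" and gen: "has_generator G \<nu> A"
    and A: "\<And>\<phi>. \<phi> \<in> test_functions G \<Longrightarrow> A \<phi> \<in> test_functions G"
    and tf: "\<And>\<phi>. \<phi> \<in> test_functions G \<Longrightarrow> continuous_on UNIV \<phi> \<and> (\<exists>B. \<forall>x. \<bar>\<phi> x\<bar> \<le> B)"
  shows "generated_semigroup (heat_semigroup G \<nu>) 
     {\<phi>. \<phi> \<in> borel_measurable borel \<and> (\<exists>B. \<forall>x. \<bar>\<phi> x\<bar> \<le> B)} (test_functions G) A"
proof -
  interpret group G by (rule G)
  let ?M = "{\<phi>::'g \<Rightarrow> real. \<phi> \<in> borel_measurable borel \<and> (\<exists>B. \<forall>x. \<bar>\<phi> x\<bar> \<le> B)}"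
  let ?T = "heat_semigroup G \<nu>"
  have prob: "prob_space (\<nu> t)" and sets [measurable_cong]: "sets (\<nu> t) = sets borel" if "0 \<le> t" for t
    using conv that by (auto simp: convolution_semigroup_def)
  \<comment> \<open>By second countability the product of the Borel algebras is the Borel algebra of
    the product, so the continuous multiplication is measurable for it.\<close>
  have sets_pair: "sets (borel \<Otimes>\<^sub>M borel) = sets (borel :: ('g \<times> 'g) measure)" unfolding borel_prod ..
  have mult [measurable]: "(\<lambda>(x, y). x \<otimes>\<^bsub>G\<^esub> y) \<in> borel_measurable (borel \<Otimes>\<^sub>M borel)"
    using borel_measurable_continuous_onI[OF cont] by (simp add: borel_prod)
  have left [measurable]: "(\<lambda>y. x \<otimes>\<^bsub>G\<^esub> y) \<in> borel_measurable borel" for x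
    using measurable_compose[OF measurable_Pair1'[of x borel borel] mult] by simp
  have int: "integrable (\<nu> t) (\<lambda>y. \<phi> (x \<otimes>\<^bsub>G\<^esub> y))" if \<phi>M: "\<phi> \<in> ?M" and t: "0 \<le> t" for \<phi> t x
  proof -
    interpret prob_space "\<nu> t" by (rule prob[OF t])
    obtain B where "\<forall>x. \<bar>\<phi> x\<bar> \<le> B" using \<phi>M by blast
    moreover have "(\<lambda>y. \<phi> (x \<otimes>\<^bsub>G\<^esub> y)) \<in> borel_measurable borel"
      using measurable_compose[OF left] \<phi>M by auto
    then have "(\<lambda>y. \<phi> (x \<otimes>\<^bsub>G\<^esub> y)) \<in> borel_measurable (\<nu> t)" 
      using measurable_cong_sets[OF sets[OF t] refl] by auto
    ultimately show ?thesis by (intro integrable_const_bound[of _ B]) auto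
  qed
  have contr: "\<bar>?T t \<phi> x\<bar> \<le> B" if "\<phi> \<in> ?M" "0 \<le> t" "\<And>x. \<bar>\<phi> x\<bar> \<le> B" for \<phi> t x B
  proof -
    interpret prob_space "\<nu> t" by (rule prob[OF that(2)])
    have "\<bar>?T t \<phi> x\<bar> \<le> (LINT y|\<nu> t. \<bar>\<phi> (x \<otimes>\<^bsub>G\<^esub> y)\<bar>)"
      unfolding heat_semigroup_def by (rule integral_abs_bound)
    also have "\<dots> \<le> (LINT y|\<nu> t. B)"
      by (intro integral_mono integrable_abs int that) auto
    finally show ?thesis by (simp add: prob_space)
  qed
  have meas: "?T t \<phi> \<in> borel_measurable borel" if "\<phi> \<in> ?M" "0 \<le> t" for \<phi> t
  proof -
    interpret prob_space "\<nu> t" by (rule prob[OF that(2)])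
    have "(\<lambda>z. \<phi> ((\<lambda>(x, y). x \<otimes>\<^bsub>G\<^esub> y) z)) \<in> borel_measurable (borel \<Otimes>\<^sub>M borel)"
      using measurable_compose[OF mult] that(1) by auto
    then have "(\<lambda>(x, y). \<phi> (x \<otimes>\<^bsub>G\<^esub> y)) \<in> borel_measurable (borel \<Otimes>\<^sub>M \<nu> t)"
      using measurable_cong_sets[OF sets_pair_measure_cong[OF refl sets[OF that(2)]] refl] by (auto simp: split_def)
    then show ?thesis unfolding heat_semigroup_def[abs_def]
      by (rule borel_measurable_lebesgue_integral)
  qed
  show ?thesis
  proof
    show "?T t \<phi> \<in> ?M" if "\<phi> \<in> ?M" "0 \<le> t" for \<phi> t
      using meas[OF that] contr[OF that] that(1) by blast
    show "(\<lambda>x. \<phi> x - \<psi> x) \<in> ?M" if \<phi>\<psi>: "\<phi> \<in> ?M" "\<psi> \<in> ?M" for \<phi> \<psi>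
    proof -
      obtain B C where "\<forall>x. \<bar>\<phi> x\<bar> \<le> B" "\<forall>x. \<bar>\<psi> x\<bar> \<le> C" using \<phi>\<psi> by blast
      then have "\<bar>\<phi> x - \<psi> x\<bar> \<le> B + C" for x
        by (meson abs_triangle_ineq4 add_mono order_trans)
      with \<phi>\<psi> show ?thesis by auto
    qed
    show "(\<lambda>x. c * \<phi> x) \<in> ?M" if \<phi>M: "\<phi> \<in> ?M" for \<phi> c
    proof -
      obtain B where "\<forall>x. \<bar>\<phi> x\<bar> \<le> B" using \<phi>M by blast
      then have "\<bar>c * \<phi> x\<bar> \<le> \<bar>c\<bar> * B" for x by (simp add: abs_mult mult_left_mono)
      with \<phi>M show ?thesis by auto
    qed
    show "?T t (\<lambda>x. \<phi> x - \<psi> x) x = ?T t \<phi> x - ?T t \<psi> x" if "\<phi> \<in> ?M" "\<psi> \<in> ?M" "0 \<le> t" for \<phi> \<psi> t x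
      unfolding heat_semigroup_def by (intro Bochner_Integration.integral_diff int that)
    show "?T t (\<lambda>x. c * \<phi> x) x = c * ?T t \<phi> x" for \<phi> t c x
      unfolding heat_semigroup_def by simp
    show "\<bar>?T t \<phi> x\<bar> \<le> B" if "\<phi> \<in> ?M" "0 \<le> t" "\<And>x. \<bar>\<phi> x\<bar> \<le> B" for \<phi> t x B
      by (rule contr[OF that])
    show "?T (s + t) \<phi> = ?T s (?T t \<phi>)" if \<phi>: "\<phi> \<in> ?M" and s: "0 \<le> s" and t: "0 \<le> t" for \<phi> s t
    proof
      fix x
      interpret S: prob_space "\<nu> s" by (rule prob[OF s])
      interpret T: prob_space "\<nu> t" by (rule prob[OF t])
      interpret P: pair_prob_space "\<nu> s" "\<nu> t" ..
      obtain B where B: "\<forall>x. \<bar>\<phi> x\<bar> \<le> B" using \<phi> by blast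
      have sp: "sets (\<nu> s \<Otimes>\<^sub>M \<nu> t) = sets (borel \<Otimes>\<^sub>M borel)"
        by (rule sets_pair_measure_cong[OF sets[OF s] sets[OF t]])
      have mult': "(\<lambda>(x, y). x \<otimes>\<^bsub>G\<^esub> y) \<in> measurable (\<nu> s \<Otimes>\<^sub>M \<nu> t) borel"
        unfolding measurable_cong_sets[OF sp refl] by (rule mult)
      have \<phi>x: "(\<lambda>y. \<phi> (x \<otimes>\<^bsub>G\<^esub> y)) \<in> borel_measurable borel"
        using measurable_compose[OF left] \<phi> by auto
      have "\<nu> (s + t) = distr (\<nu> s \<Otimes>\<^sub>M \<nu> t) borel (\<lambda>(x, y). x \<otimes>\<^bsub>G\<^esub> y)"
        using conv s t by (simp add: convolution_semigroup_def)
      then have "?T (s + t) \<phi> x = (LINT z|(\<nu> s \<Otimes>\<^sub>M \<nu> t). \<phi> (x \<otimes>\<^bsub>G\<^esub> (\<lambda>(x, y). x \<otimes>\<^bsub>G\<^esub> y) z))"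
        unfolding heat_semigroup_def using integral_distr[OF mult' \<phi>x] by simp
      also have "\<dots> = (LINT z|(\<nu> s \<Otimes>\<^sub>M \<nu> t). (\<lambda>(y, z). \<phi> (x \<otimes>\<^bsub>G\<^esub> (y \<otimes>\<^bsub>G\<^esub> z))) z)"
        by (simp add: split_def)
      \<comment> \<open>Fubini's theorem: a bounded measurable function is integrable on a product
        of probability measures.\<close>
      also have "\<dots> = (LINT y|\<nu> s. LINT z|\<nu> t. \<phi> (x \<otimes>\<^bsub>G\<^esub> (y \<otimes>\<^bsub>G\<^esub> z)))"
      proof (rule P.integral_fst'[symmetric, of "\<lambda>(y, z). \<phi> (x \<otimes>\<^bsub>G\<^esub> (y \<otimes>\<^bsub>G\<^esub> z))", simplified split_conv])
        have "(\<lambda>z. \<phi> (x \<otimes>\<^bsub>G\<^esub> (\<lambda>(x, y). x \<otimes>\<^bsub>G\<^esub> y) z)) \<in> borel_measurable (\<nu> s \<Otimes>\<^sub>M \<nu> t)"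
          by (rule measurable_compose[OF mult' \<phi>x])
        then show "integrable (\<nu> s \<Otimes>\<^sub>M \<nu> t) (\<lambda>(y, z). \<phi> (x \<otimes>\<^bsub>G\<^esub> (y \<otimes>\<^bsub>G\<^esub> z)))"
          by (intro P.integrable_const_bound[of _ B]) (auto simp: B split_def)
      qed
      also have "\<dots> = ?T s (?T t \<phi>) x"
        unfolding heat_semigroup_def using G(2) by (simp add: m_assoc)
      finally show "?T (s + t) \<phi> x = ?T s (?T t \<phi>) x" .
    qed
    show "?T 0 \<phi> = \<phi>" if "\<phi> \<in> ?M" for \<phi>
    proof
      fix x
      have "(\<lambda>y. \<phi> (x \<otimes>\<^bsub>G\<^esub> y)) \<in> borel_measurable borel"
        using measurable_compose[OF left] that by auto
      then show "?T 0 \<phi> x = \<phi> x" using conv G(2)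
        by (simp add: heat_semigroup_def convolution_semigroup_def integral_return)
    qed
    show "test_functions G \<subseteq> ?M" using tf borel_measurable_continuous_onI by auto
    show "A \<phi> \<in> test_functions G" if "\<phi> \<in> test_functions G" for \<phi> by (rule A[OF that])
    show "uniform_limit UNIV (\<lambda>t x. (?T t \<phi> x - \<phi> x) / t) (A \<phi>) (at_right 0)" 
      if "\<phi> \<in> test_functions G" for \<phi> using gen that by (simp add: has_generator_def)
  qed
qed

section \<open>The mean increment of a random walk\<close>

text \<open>Paths up to time \<open>n\<close>, extended by the starting point so that each is listed once.\<close>

primrec walk_paths :: "('v, 'e) pre_digraph \<Rightarrow> 'v \<Rightarrow> nat \<Rightarrow> (nat \<Rightarrow> 'v) set" where
  "walk_paths X x0 0 = {\<lambda>_. x0}"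
| "walk_paths X x0 (Suc n) = (\<lambda>(y, v). y(Suc n := v)) ` (SIGMA y:walk_paths X x0 n. head X ` out_arcs X (y n))"

lemma walk_paths_default: "y \<in> walk_paths X x0 n \<Longrightarrow> n < i \<Longrightarrow> y i = x0"
  by (induction n arbitrary: y) auto

lemma inj_walk_extend: 
  "inj_on (\<lambda>(y, v). y(Suc n := v)) (SIGMA y:walk_paths X x0 n. S y)"
proof (rule inj_onI, clarify)
  fix y v y' v' assume y: "y \<in> walk_paths X x0 n" "y' \<in> walk_paths X x0 n" and eq: "y(Suc n := v) = y'(Suc n := v')"
  have "y i = y' i" for i
    using fun_cong[OF eq, of i] walk_paths_default[OF y(1), of "Suc n"] walk_paths_default[OF y(2), of "Suc n"]
    by (cases "i = Suc n") auto
  moreover have "v = v'" using fun_cong[OF eq, of "Suc n"] by simp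
  ultimately show "y = y' \<and> v = v'" by auto
qed

text \<open>Turns the almost sure form of (A2) into a statement about single steps. The mean of
  \<open>L (w n)\<close> grows exactly by \<open>c\<close> per step, while bounded increments permit
  dominated convergence of \<open>L (w n) / n\<close> to 0.\<close>

lemma random_walk_mean_increment:
  fixes X :: "('v, 'e) pre_digraph" and L :: "'v \<Rightarrow> 'a::euclidean_space"
  assumes wf: "wf_digraph X" and rw: "random_walk X p x0 M w" 
    and psum: "\<And>x. x \<in> verts X \<Longrightarrow> (\<Sum>e\<in>out_arcs X x. p e) = 1"
    and incr: "\<And>x. x \<in> verts X \<Longrightarrow> (\<Sum>e\<in>out_arcs X x. p e *\<^sub>R (L (head X e) - L x)) = c"
    and bound: "\<And>e. e \<in> arcs X \<Longrightarrow> norm (L (head X e) - L (tail X e)) \<le> R"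
    and lim: "AE \<omega> in M. (\<lambda>n. (1 / real n) *\<^sub>R L (w n \<omega>)) \<longlonglongrightarrow> 0"
  shows "c = 0"
proof -
  interpret wf_digraph X by (rule wf)
  interpret prob_space M using rw by (simp add: random_walk_def)
  have x0: "x0 \<in> verts X" and w0: "AE \<omega> in M. w 0 \<omega> = x0"
    and wm [measurable]: "\<And>n. w n \<in> measurable M (count_space (verts X))"
    and markov: "\<And>n y. (\<forall>i\<le>Suc n. y i \<in> verts X) \<Longrightarrow>
        measure M {\<omega>\<in>space M. \<forall>i\<le>Suc n. w i \<omega> = y i} =
        measure M {\<omega>\<in>space M. \<forall>i\<le>n. w i \<omega> = y i} *
          (\<Sum>e\<in>{e \<in> out_arcs X (y n). head X e = y (Suc n)}. p e)"
    using rw unfolding random_walk_def by blast+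
  \<comment> \<open>A sum over an infinite set is 0 by convention, so the value 1 forces finitely
    many outgoing edges.\<close>
  have fin: "finite (out_arcs X x)" if "x \<in> verts X" for x
    using psum[OF that] by (metis sum.infinite zero_neq_one)
  define P where "P n = walk_paths X x0 n" for n
  define Ev where "Ev n y = {\<omega>\<in>space M. \<forall>i\<le>n. w i \<omega> = y i}" for n y
  have verts: "y i \<in> verts X" if "y \<in> P n" for y n i
    using that unfolding P_def
    by (induction n arbitrary: y i) (auto simp: x0 wellformed)
  have finP: "finite (P n)" for n
    unfolding P_def
  proof (induction n)
    case (Suc n)
    then show ?case using verts fin by (auto simp: P_def intro!: finite_imageI finite_SigmaI)
  qed simp
  have Ev [measurable]: "Ev n y \<in> sets M" if "y \<in> P k" for n y k
  proof -
    have "Ev n y = (\<Inter>i\<in>{..n}. w i -` {y i} \<inter> space M)" by (auto simp: Ev_def)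
    moreover have "w i -` {y i} \<inter> space M \<in> sets M" for i
      by (rule measurable_sets[OF wm]) (use verts[OF that] in auto)
    ultimately show ?thesis by (simp only:) (intro sets.finite_INT, auto)
  qed
  have extend: "measure M (Ev (Suc n) (y(Suc n := v))) = 
      measure M (Ev n y) * (\<Sum>e\<in>{e \<in> out_arcs X (y n). head X e = v}. p e)"
    if "y \<in> P n" "v \<in> verts X" for n y v
  proof -
    have "{\<omega>\<in>space M. \<forall>i\<le>n. w i \<omega> = (y(Suc n := v)) i} = Ev n y" by (auto simp: Ev_def)
    then show ?thesis using markov[of n "y(Suc n := v)"] verts[OF that(1)] that(2) by (simp add: Ev_def)
  qed
  have recursion: "(\<Sum>y\<in>P (Suc n). measure M (Ev (Suc n) y) *\<^sub>R h (y (Suc n))) =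
      (\<Sum>y\<in>P n. measure M (Ev n y) *\<^sub>R (\<Sum>e\<in>out_arcs X (y n). p e *\<^sub>R h (head X e)))" 
    for n and h :: "'v \<Rightarrow> 'a"
  proof -
    have "(\<Sum>y\<in>P (Suc n). measure M (Ev (Suc n) y) *\<^sub>R h (y (Suc n))) =
      (\<Sum>(y, v)\<in>(SIGMA y:P n. head X ` out_arcs X (y n)). measure M (Ev (Suc n) (y(Suc n := v))) *\<^sub>R h v)"
      unfolding P_def walk_paths.simps
      by (subst sum.reindex[OF inj_walk_extend]) (simp add: split_def)
    also have "\<dots> = (\<Sum>y\<in>P n. \<Sum>v\<in>head X ` out_arcs X (y n). measure M (Ev (Suc n) (y(Suc n := v))) *\<^sub>R h v)"
      using finP fin verts by (subst sum.Sigma) auto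
    also have "\<dots> = (\<Sum>y\<in>P n. measure M (Ev n y) *\<^sub>R (\<Sum>e\<in>out_arcs X (y n). p e *\<^sub>R h (head X e)))"
    proof (rule sum.cong[OF refl])
      fix y assume y: "y \<in> P n"
      have f: "finite (out_arcs X (y n))" using fin verts[OF y] by simp
      have "(\<Sum>v\<in>head X ` out_arcs X (y n). measure M (Ev (Suc n) (y(Suc n := v))) *\<^sub>R h v) = 
        (\<Sum>v\<in>head X ` out_arcs X (y n). measure M (Ev n y) *\<^sub>R (\<Sum>e\<in>{e \<in> out_arcs X (y n). head X e = v}. p e *\<^sub>R h (head X e)))"
        using y by (intro sum.cong) (auto simp: extend scaleR_sum_left scaleR_sum_right wellformed sum_distrib_left)
      also have "\<dots> = measure M (Ev n y) *\<^sub>R (\<Sum>e\<in>out_arcs X (y n). p e *\<^sub>R h (head X e))"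
        unfolding scaleR_sum_right[symmetric] using sum.image_gen[OF f, of "\<lambda>e. p e *\<^sub>R h (head X e)" "head X"] by simp
      finally show "(\<Sum>v\<in>head X ` out_arcs X (y n). measure M (Ev (Suc n) (y(Suc n := v))) *\<^sub>R h v) = 
        measure M (Ev n y) *\<^sub>R (\<Sum>e\<in>out_arcs X (y n). p e *\<^sub>R h (head X e))" .
    qed
    finally show ?thesis .
  qed
  have start: "measure M (Ev 0 (\<lambda>_. x0)) = 1"
  proof -
    have "{\<omega>\<in>space M. w 0 \<omega> = x0} \<in> events"
      using Ev[of "\<lambda>_. x0" 0 0] by (simp add: Ev_def P_def)
    then show ?thesis using w0 by (simp add: Ev_def prob_Collect_eq_1)
  qed
  have total: "(\<Sum>y\<in>P n. measure M (Ev n y)) = 1" for n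
  proof (induction n)
    case 0
    then show ?case by (simp add: P_def start)
  next
    case (Suc n)
    have "(\<Sum>y\<in>P (Suc n). measure M (Ev (Suc n) y)) = (\<Sum>y\<in>P n. measure M (Ev n y) * (\<Sum>e\<in>out_arcs X (y n). p e))"
    proof -
      \<comment> \<open>\<open>recursion\<close> is stated for vector valued functions; a constant
        nonzero vector extracts its scalar content.\<close>
      obtain b :: 'a where b: "b \<noteq> 0" using nonzero_Basis nonempty_Basis by blast
      have "(\<Sum>y\<in>P (Suc n). measure M (Ev (Suc n) y)) *\<^sub>R b = 
          (\<Sum>y\<in>P n. measure M (Ev n y) * (\<Sum>e\<in>out_arcs X (y n). p e)) *\<^sub>R b"
        using recursion[of n "\<lambda>_. b"] by (simp add: scaleR_sum_left scaleR_sum_right sum_distrib_left)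
      then show ?thesis using b by simp
    qed
    then show ?case using Suc verts psum by simp
  qed
  have mean: "(\<Sum>y\<in>P n. measure M (Ev n y) *\<^sub>R L (y n)) = L x0 + real n *\<^sub>R c" for n
  proof (induction n)
    case 0
    then show ?case by (simp add: P_def start)
  next
    case (Suc n)
    have s: "(\<Sum>e\<in>out_arcs X x. p e *\<^sub>R L (head X e)) = L x + c" if "x \<in> verts X" for x
      using incr[OF that] psum[OF that] by (simp add: scaleR_diff_right sum_subtractf scaleR_sum_left[symmetric] algebra_simps)
    have "(\<Sum>y\<in>P (Suc n). measure M (Ev (Suc n) y) *\<^sub>R L (y (Suc n))) = 
       (\<Sum>y\<in>P n. measure M (Ev n y) *\<^sub>R (L (y n) + c))"
      unfolding recursion using s verts by (intro sum.cong) auto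
    also have "\<dots> = L x0 + real n *\<^sub>R c + c"
      using Suc total[of n] by (simp add: scaleR_add_right sum.distrib scaleR_sum_left[symmetric])
    finally show ?case by (simp add: algebra_simps)
  qed
  have pbound: "norm (L (y n) - L x0) \<le> real n * R" if "y \<in> P n" for y n
    using that unfolding P_def
  proof (induction n arbitrary: y)
    case (Suc n)
    then obtain z e where z: "z \<in> walk_paths X x0 n" "e \<in> out_arcs X (z n)" "y = z(Suc n := head X e)" by auto
    have "norm (L (y (Suc n)) - L x0) \<le> norm (L (head X e) - L (tail X e)) + norm (L (z n) - L x0)"
      using norm_triangle_ineq[of "L (head X e) - L (tail X e)" "L (z n) - L x0"] z by simp
    also have "\<dots> \<le> R + real n * R" using Suc.IH[OF z(1)] bound[of e] z(2) by (intro add_mono) auto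
    finally show ?case by (simp add: algebra_simps)
  qed simp
  have disj: "disjoint_family_on (Ev n) (P n)" for n
    unfolding disjoint_family_on_def
  proof (intro ballI impI)
    fix y z assume yz: "y \<in> P n" "z \<in> P n" "y \<noteq> z"
    then obtain i where i: "y i \<noteq> z i" by auto
    then have "i \<le> n" using yz walk_paths_default by (metis P_def not_le)
    then show "Ev n y \<inter> Ev n z = {}" using i by (auto simp: Ev_def)
  qed
  have AEP: "AE \<omega> in M. \<exists>y\<in>P n. \<omega> \<in> Ev n y" for n
  proof -
    have "Ev n ` P n \<subseteq> events" using Ev by blast
    then have "measure M (\<Union>y\<in>P n. Ev n y) = 1"
      using finite_measure_finite_Union[OF finP _ disj, of n] total by simp
    then show ?thesis using finP Ev by (subst (asm) prob_eq_1) auto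
  qed
  \<comment> \<open>Almost surely the walk follows exactly one of finitely many paths, so
    \<open>L (w n)\<close> is a simple function and its expectation a finite sum.\<close>
  have AEw: "AE \<omega> in M. L (w n \<omega>) = (\<Sum>y\<in>P n. indicator (Ev n y) \<omega> *\<^sub>R L (y n))" for n
    using AEP[of n]
  proof eventually_elim
    case (elim \<omega>)
    then obtain y where y: "y \<in> P n" "\<omega> \<in> Ev n y" by auto
    have "(\<Sum>z\<in>P n. indicator (Ev n z) \<omega> *\<^sub>R L (z n)) = (\<Sum>z\<in>P n. if z = y then L (y n) else 0)"
    proof (rule sum.cong[OF refl])
      fix z assume z: "z \<in> P n"
      show "indicator (Ev n z) \<omega> *\<^sub>R L (z n) = (if z = y then L (y n) else 0)"
        using disj[of n] z y by (cases "z = y") (auto simp: disjoint_family_on_def indicator_def)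
    qed
    then show ?case using y finP by (simp add: Ev_def)
  qed
  have Lm [measurable]: "(\<lambda>\<omega>. L (w n \<omega>)) \<in> borel_measurable M" for n
    by (rule measurable_compose[OF wm]) simp
  have expect: "(LINT \<omega>|M. L (w n \<omega>)) = L x0 + real n *\<^sub>R c" for n
  proof -
    have [measurable]: "(\<lambda>\<omega>. indicat_real (Ev n y) \<omega> *\<^sub>R L (y n)) \<in> borel_measurable M" if "y \<in> P n" for y
      using Ev[OF that] by measurable
    have "(LINT \<omega>|M. L (w n \<omega>)) = (LINT \<omega>|M. (\<Sum>y\<in>P n. indicator (Ev n y) \<omega> *\<^sub>R L (y n)))"
      by (rule integral_cong_AE[OF Lm borel_measurable_sum AEw]) simp
    also have "\<dots> = (\<Sum>y\<in>P n. LINT \<omega>|M. indicator (Ev n y) \<omega> *\<^sub>R L (y n))"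
      using Ev by (intro Bochner_Integration.integral_sum integrable_scaleR_left integrable_real_indicator) (auto simp: less_top[symmetric])
    also have "\<dots> = (\<Sum>y\<in>P n. measure M (Ev n y) *\<^sub>R L (y n))"
    proof (rule sum.cong[OF refl])
      fix y assume "y \<in> P n"
      then have "Ev n y \<in> events" by (rule Ev)
      moreover from this have "integrable M (indicat_real (Ev n y))"
        by (intro integrable_real_indicator) (auto simp: less_top[symmetric])
      ultimately show "(LINT \<omega>|M. indicat_real (Ev n y) \<omega> *\<^sub>R L (y n)) = measure M (Ev n y) *\<^sub>R L (y n)"
        by simp
    qed
    finally show ?thesis by (simp add: mean)
  qed
  have R: "0 \<le> R"
  proof -
    have "out_arcs X x0 \<noteq> {}" using psum[OF x0] by auto
    then obtain e where "e \<in> arcs X" by (auto simp: out_arcs_def)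
    from order_trans[OF norm_ge_zero bound[OF this]] show ?thesis .
  qed
  have "(\<lambda>n. LINT \<omega>|M. (1 / real n) *\<^sub>R L (w n \<omega>)) \<longlonglongrightarrow> (LINT \<omega>|M. 0)"
  proof (rule integral_dominated_convergence[where w="\<lambda>_. norm (L x0) + R"])
    show "AE \<omega> in M. norm ((1 / real n) *\<^sub>R L (w n \<omega>)) \<le> norm (L x0) + R" for n
      using AEP[of n]
    proof eventually_elim
      case (elim \<omega>)
      then obtain y where y: "y \<in> P n" "w n \<omega> = y n" by (auto simp: Ev_def)
      show ?case
      proof (cases "n = 0")
        case False
        have "norm (L (w n \<omega>)) \<le> norm (L x0) + real n * R"
          using pbound[OF y(1)] norm_triangle_ineq2[of "L (y n)" "L x0"] y(2) by simp
        also have "\<dots> \<le> real n * (norm (L x0) + R)"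
          using False by (simp add: distrib_left mult_le_cancel_right1)
        finally show ?thesis using False by (simp add: divide_simps mult.commute)
      qed (use R in simp)
    qed
  qed (use lim in auto)
  \<comment> \<open>At \<open>n = 0\<close> the factor \<open>1 / real n\<close> is 0 by convention,
    so this term of the sequence has to be separated.\<close>
  moreover have "(LINT \<omega>|M. (1 / real n) *\<^sub>R L (w n \<omega>)) = (1 / real n) *\<^sub>R L x0 + (if n = 0 then 0 else c)" for n
    by (simp add: expect scaleR_add_right)
  ultimately have "(\<lambda>n. (1 / real n) *\<^sub>R L x0 + (if n = 0 then 0 else c)) \<longlonglongrightarrow> 0" by simp
  moreover have "(\<lambda>n. (1 / real n) *\<^sub>R L x0 + (if n = 0 then 0 else c)) \<longlonglongrightarrow> 0 *\<^sub>R L x0 + c"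
  proof (intro tendsto_add tendsto_scaleR tendsto_const)
    show "(\<lambda>n. 1 / real n) \<longlonglongrightarrow> 0" by (rule lim_1_over_n)
    show "(\<lambda>n. if n = 0 then 0 else c) \<longlonglongrightarrow> c"
      by (rule tendsto_eventually) (auto simp: eventually_sequentially intro!: exI[of _ 1])
  qed
  ultimately show ?thesis using LIMSEQ_unique by fastforce
qed

section \<open>The Poisson estimate for a finite irreducible chain\<close>

text \<open>If \<open>\<phi>\<close> is almost harmonic, then near a maximum it is almost maximal at the neighbours too;
  this propagates along paths of positive probability.\<close>

lemma poisson_path:
  fixes p :: "'e \<Rightarrow> real"
  assumes E: "finite E" and p: "\<And>e. e \<in> E \<Longrightarrow> 0 \<le> p e"
    and psum: "\<And>x. x \<in> V \<Longrightarrow> (\<Sum>e | e \<in> E \<and> src e = x. p e) = 1"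
    and st: "\<And>e. e \<in> E \<Longrightarrow> src e \<in> V \<and> tgt e \<in> V"
    and xy: "(x, y) \<in> {(src e, tgt e) | e. e \<in> E \<and> 0 < p e}\<^sup>*"
  shows "\<exists>C\<ge>0. \<forall>\<phi> d S. (\<forall>z\<in>V. \<phi> z \<le> S) \<longrightarrow> 0 \<le> d \<longrightarrow>
      (\<forall>x\<in>V. \<bar>(\<Sum>e | e \<in> E \<and> src e = x. p e * \<phi> (tgt e)) - \<phi> x\<bar> \<le> d) \<longrightarrow> S - \<phi> y \<le> C * (d + (S - \<phi> x))"
  using xy
proof (induction rule: rtrancl_induct)
  case base
  then show ?case by (intro exI[of _ 1]) auto
next
  case (step y z)
  then obtain e where e: "e \<in> E" "0 < p e" "y = src e" "z = tgt e" by auto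
  obtain C where C: "0 \<le> C" and IH: "\<And>\<phi> d S. (\<forall>z\<in>V. \<phi> z \<le> S) \<Longrightarrow> 0 \<le> d \<Longrightarrow>
      (\<forall>x\<in>V. \<bar>(\<Sum>e | e \<in> E \<and> src e = x. p e * \<phi> (tgt e)) - \<phi> x\<bar> \<le> d) \<Longrightarrow> S - \<phi> y \<le> C * (d + (S - \<phi> x))"
    using step.IH by blast
  show ?case
  \<comment> \<open>The edge \<open>e\<close> has weight \<open>p e\<close> in the average at
    \<open>y\<close>, so the defect at its target exceeds that at \<open>y\<close> by at most a
    factor \<open>1 / p e\<close>, up to \<open>d\<close>.\<close>
  proof (intro exI[of _ "(C + 1 + 1) / p e"] conjI allI impI)
    show "0 \<le> (C + 1 + 1) / p e" using C e by simp
    fix \<phi> :: "'a \<Rightarrow> real" and d S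
    assume S: "\<forall>z\<in>V. \<phi> z \<le> S" and d: "0 \<le> d"
      and h: "\<forall>x\<in>V. \<bar>(\<Sum>e | e \<in> E \<and> src e = x. p e * \<phi> (tgt e)) - \<phi> x\<bar> \<le> d"
    have y: "y \<in> V" using e st by simp
    let ?O = "{e. e \<in> E \<and> src e = y}"
    have "p e * (S - \<phi> z) \<le> (\<Sum>e\<in>?O. p e * (S - \<phi> (tgt e)))"
      unfolding e(4)
      by (rule member_le_sum[where f="\<lambda>e. p e * (S - \<phi> (tgt e))"]) (use e E p S st in auto)
    also have "\<dots> = S - (\<Sum>e\<in>?O. p e * \<phi> (tgt e))"
      using psum[OF y] by (simp add: right_diff_distrib sum_subtractf sum_distrib_right[symmetric])
    also have "\<dots> \<le> S - \<phi> y + d" using bspec[OF h y] by (simp add: abs_le_iff)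
    also have "\<dots> \<le> C * (d + (S - \<phi> x)) + d" using IH[OF S d h] by simp
    also have "\<dots> \<le> (C + 1 + 1) * (d + (S - \<phi> x))"
    proof (cases "x \<in> V")
      case True
      then have "0 \<le> S - \<phi> x" using S by auto
      with d show ?thesis by (simp add: algebra_simps)
    next
      \<comment> \<open>A nonempty path starts in \<open>V\<close>; hence the path from
        \<open>x\<close> is empty and \<open>x = y\<close>, which contradicts
        \<open>y \<in> V\<close>.\<close>
      case False
      have "x = y" using \<open>(x, y) \<in> _\<close> False st by (auto elim: converse_rtranclE)
      with y False show ?thesis by simp
    qed
    finally show "S - \<phi> z \<le> (C + 1 + 1) / p e * (d + (S - \<phi> x))"
      using e(2) by (simp add: field_simps)
  qed
qed

text \<open>At a maximum point the defect is 0, and every vertex can be reached from it, so all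
  values lie within a multiple of \<open>d\<close> below the maximum. Summing the constants over all
  pairs makes the multiple independent of the function.\<close>

lemma poisson_estimate:
  fixes p :: "'e \<Rightarrow> real"
  assumes V: "finite V" and E: "finite E" and p: "\<And>e. e \<in> E \<Longrightarrow> 0 \<le> p e"
    and psum: "\<And>x. x \<in> V \<Longrightarrow> (\<Sum>e | e \<in> E \<and> src e = x. p e) = 1"
    and st: "\<And>e. e \<in> E \<Longrightarrow> src e \<in> V \<and> tgt e \<in> V"
    and irr: "\<And>x y. x \<in> V \<Longrightarrow> y \<in> V \<Longrightarrow> (x, y) \<in> {(src e, tgt e) | e. e \<in> E \<and> 0 < p e}\<^sup>*"
  shows "\<exists>C\<ge>0. \<forall>\<phi> d. (\<forall>x\<in>V. \<bar>(\<Sum>e | e \<in> E \<and> src e = x. p e * \<phi> (tgt e)) - \<phi> x\<bar> \<le> d) \<longrightarrow>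
        (\<forall>x\<in>V. \<forall>y\<in>V. \<bar>\<phi> x - \<phi> y\<bar> \<le> C * d)"
proof -
  define good where "good C x y \<longleftrightarrow> (\<forall>\<phi> d S. (\<forall>z\<in>V. \<phi> z \<le> S) \<longrightarrow> 0 \<le> d \<longrightarrow>
      (\<forall>x\<in>V. \<bar>(\<Sum>e | e \<in> E \<and> src e = x. p e * \<phi> (tgt e)) - \<phi> x\<bar> \<le> d) \<longrightarrow> S - \<phi> y \<le> C * (d + (S - \<phi> x)))" 
    for C :: real and x y
  have "\<exists>C\<ge>0. x \<in> V \<longrightarrow> y \<in> V \<longrightarrow> good C x y" for x y
  proof (cases "x \<in> V \<and> y \<in> V")
    case True
    then have xy: "(x, y) \<in> {(src e, tgt e) | e. e \<in> E \<and> 0 < p e}\<^sup>*" using irr by blast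
    have "\<exists>C\<ge>0. good C x y"
      unfolding good_def by (rule poisson_path[OF E p psum st xy])
    then show ?thesis by blast
  next
    case False
    then show ?thesis by (intro exI[of _ 0]) simp
  qed
  then obtain C where C0: "\<And>x y. 0 \<le> C x y" and good: "\<And>x y. x \<in> V \<Longrightarrow> y \<in> V \<Longrightarrow> good (C x y) x y"
    by metis
  have C: "\<And>x y \<phi> d S. x \<in> V \<Longrightarrow> y \<in> V \<Longrightarrow> (\<forall>z\<in>V. \<phi> z \<le> S) \<Longrightarrow> 0 \<le> d \<Longrightarrow>
      (\<forall>x\<in>V. \<bar>(\<Sum>e | e \<in> E \<and> src e = x. p e * \<phi> (tgt e)) - \<phi> x\<bar> \<le> d) \<Longrightarrow> S - \<phi> y \<le> C x y * (d + (S - \<phi> x))"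
    using good unfolding good_def by blast
  define K where "K = (\<Sum>x\<in>V. \<Sum>y\<in>V. C x y)"
  have K: "C x y \<le> K" if "x \<in> V" "y \<in> V" for x y
  proof -
    have "C x y \<le> (\<Sum>y\<in>V. C x y)" by (rule member_le_sum) (use that V C0 in auto)
    also have "\<dots> \<le> K" unfolding K_def
      by (rule member_le_sum[where f="\<lambda>x. \<Sum>y\<in>V. C x y"]) (use that V C0 in \<open>auto intro: sum_nonneg\<close>)
    finally show ?thesis .
  qed
  show ?thesis
  proof (intro exI[of _ K] conjI allI impI ballI)
    show "0 \<le> K" unfolding K_def using C0 by (intro sum_nonneg) auto
    fix \<phi> :: "'a \<Rightarrow> real" and d x y
    assume h: "\<forall>x\<in>V. \<bar>(\<Sum>e | e \<in> E \<and> src e = x. p e * \<phi> (tgt e)) - \<phi> x\<bar> \<le> d" and xy: "x \<in> V" "y \<in> V"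
    have d: "0 \<le> d" using bspec[OF h xy(1)] abs_ge_zero order_trans by blast
    obtain s where s: "s \<in> V" "\<And>z. z \<in> V \<Longrightarrow> \<phi> z \<le> \<phi> s"
    proof -
      have "Max (\<phi> ` V) \<in> \<phi> ` V" using V xy by (intro Max_in) auto
      then obtain s where "s \<in> V" "\<phi> s = Max (\<phi> ` V)" by auto
      with that V show ?thesis by simp
    qed
    have b: "\<phi> s - \<phi> z \<le> K * d" if z: "z \<in> V" for z
    proof -
      have "\<phi> s - \<phi> z \<le> C s z * (d + (\<phi> s - \<phi> s))" by (rule C) (use s z d h in auto)
      also have "\<dots> \<le> K * d" using mult_right_mono[OF K[OF s(1) z] d] by simp
      finally show ?thesis .
    qed
    show "\<bar>\<phi> x - \<phi> y\<bar> \<le> K * d"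
      using b[OF xy(1)] b[OF xy(2)] s(2)[OF xy(1)] s(2)[OF xy(2)] by linarith
  qed
qed

section \<open>Stratified Lie groups in logarithmic coordinates\<close>

context simply_connected_nilpotent_lie_group
begin

lemma Log_Exp [simp]: "Log G (Exp G a) = a" and Exp_Log [simp]: "Exp G (Log G x) = x"
  using Exp_homeomorphism by (auto simp: homeomorphism_def)

lemma continuous_Exp: "continuous_on S (Exp G)" and continuous_Log: "continuous_on S' (Log G)"
  using Exp_homeomorphism by (auto simp: homeomorphism_def intro: continuous_on_subset)

lemma Exp_zero: "Exp G 0 = \<one>"
proof -
  have "Exp G 0 \<otimes> Exp G 0 = Exp G 0"
    using one_parameter_subgroup[of 0 0] by simp
  then show ?thesis using l_cancel_one[of "Exp G 0" "Exp G 0"] carrier_UNIV by simp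
qed

definition lmul :: "'a \<Rightarrow> 'a \<Rightarrow> 'a" where "lmul a b = Log G (Exp G a \<otimes> Exp G b)"

lemma Log_mult: "Log G (x \<otimes> y) = lmul (Log G x) (Log G y)"
  by (simp add: lmul_def)

lemma log_group_lmul: "log_group lmul"
proof
  show "smooth (\<lambda>(a, b). lmul a b)" using smooth_mult by (simp add: lmul_def)
qed (simp_all add: lmul_def m_assoc carrier_UNIV Exp_zero one_parameter_subgroup[symmetric])

sublocale log: log_group lmul by (rule log_group_lmul)

lemma smooth_on_group_Log: "smooth_on_group G (\<lambda>x. F (Log G x)) \<longleftrightarrow> smooth F"
  by (simp add: smooth_on_group_def)

lemma vector_field_Log: "vector_field G a (\<lambda>x. F (Log G x)) = (\<lambda>x. log.vf a F (Log G x))"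
  by (simp add: vector_field_def log.vf_def Log_mult fun_eq_iff)

lemma test_functions_Log: "(\<lambda>x. F (Log G x)) \<in> test_functions G \<longleftrightarrow> test F"
proof
  assume "(\<lambda>x. F (Log G x)) \<in> test_functions G"
  then obtain K where F: "smooth F" and K: "compact K" "\<And>x. x \<notin> K \<Longrightarrow> F (Log G x) = 0"
    by (auto simp: test_functions_def smooth_on_group_Log)
  have "compact (Log G ` K)" by (intro compact_continuous_image continuous_Log K)
  moreover have "F u = 0" if "u \<notin> Log G ` K" for u
    using K(2)[of "Exp G u"] that by (metis Log_Exp image_eqI)
  ultimately show "test F" using F by (auto simp: test_def)
next
  assume "test F"
  then obtain K where F: "smooth F" and K: "compact K" "\<And>u. u \<notin> K \<Longrightarrow> F u = 0" by (auto simp: test_def)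
  have "compact (Exp G ` K)" by (intro compact_continuous_image continuous_Exp K)
  moreover have "F (Log G x) = 0" if "x \<notin> Exp G ` K" for x
    using K(2)[of "Log G x"] that by (metis Exp_Log image_eqI)
  ultimately show "(\<lambda>x. F (Log G x)) \<in> test_functions G" using F 
    by (auto simp: test_functions_def smooth_on_group_Log)
qed

lemma continuous_mult: "continuous_on UNIV (\<lambda>(x, y). x \<otimes> y)"
proof -
  have "(\<lambda>(x, y). x \<otimes> y) = (\<lambda>z. Exp G ((\<lambda>(a, b). lmul a b) (Log G (fst z), Log G (snd z))))"
    by (simp add: fun_eq_iff lmul_def)
  moreover have "continuous_on UNIV \<dots>"
    by (intro continuous_on_compose2[OF continuous_Exp[of UNIV]] 
        continuous_on_compose2[OF smooth_continuous_on[OF log.smooth_mul, of UNIV]]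
        continuous_on_Pair continuous_on_compose2[OF continuous_Log[of UNIV]] continuous_on_fst continuous_on_snd
        continuous_on_id) auto
  ultimately show ?thesis by simp
qed

text \<open>The commutator identity for left invariant fields is evaluated at the unit, where it
  determines the derivative of \<open>Ad\<close>.\<close>

lemma log_lie_group_lmul: "log_lie_group lmul (bracket G)"
proof
  show "bilinear (bracket G)" by (rule bracket_bilinear)
  fix a b
  show "((\<lambda>s. log.Ad (s *\<^sub>R a) b) has_vector_derivative bracket G a b) (at 0)"
  proof (rule log.Ad_derivative_bracket)
    fix F :: "'a \<Rightarrow> real" assume "smooth F"
    then have "vector_field G (bracket G a b) (\<lambda>x. F (Log G x)) (Exp G 0) = 
       vector_field G a (vector_field G b (\<lambda>x. F (Log G x))) (Exp G 0) 
       - vector_field G b (vector_field G a (\<lambda>x. F (Log G x))) (Exp G 0)"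
      by (intro bracket_vector_fields) (simp add: smooth_on_group_Log)
    then show "log.vf (bracket G a b) F 0 = log.vf a (log.vf b F) 0 - log.vf b (log.vf a F) 0"
      by (simp add: vector_field_Log)
  qed
qed

sublocale lie: log_lie_group lmul "bracket G" by (rule log_lie_group_lmul)

end

section \<open>Layers and dilations\<close>

locale stratified_lie_group = simply_connected_nilpotent_lie_group G
  for G :: "('g::{t2_space,second_countable_topology}, 'a::euclidean_space) lie_data" (structure) +
  fixes r :: nat and g :: "nat \<Rightarrow> 'a set"
  assumes strat: "stratification G r g"
begin

abbreviation lc :: "nat \<Rightarrow> 'a \<Rightarrow> 'a" where "lc \<equiv> layer_component r g"

lemma r_pos: "1 \<le> r" and subspace_layer: "k \<in> {1..r} \<Longrightarrow> subspace (g k)" and layer_zero: "r < k \<Longrightarrow> g k = {0}"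
  and bracket_layer: "1 \<le> k \<Longrightarrow> 1 \<le> l \<Longrightarrow> a \<in> g k \<Longrightarrow> b \<in> g l \<Longrightarrow> bracket G a b \<in> g (k + l)"
  using strat by (auto simp: stratification_def)

lemma decomposition: "\<exists>!u. u \<in> (\<Pi>\<^sub>E k\<in>{1..r}. g k) \<and> v = (\<Sum>k=1..r. u k)"
  using strat by (auto simp: stratification_def)

lemma lc_layer: "k \<in> {1..r} \<Longrightarrow> lc k v \<in> g k" and sum_lc: "(\<Sum>k=1..r. lc k v) = v"
  using theI'[OF decomposition[of v]] by (auto simp: layer_component_def PiE_def Pi_def)

lemma lc_unique:
  assumes u: "\<And>k. k \<in> {1..r} \<Longrightarrow> u k \<in> g k" and v: "v = (\<Sum>k=1..r. u k)" and k: "k \<in> {1..r}"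
  shows "lc k v = u k"
proof -
  have "(THE u. u \<in> (\<Pi>\<^sub>E k\<in>{1..r}. g k) \<and> v = (\<Sum>k=1..r. u k)) = restrict u {1..r}"
    by (rule the1_equality[OF decomposition]) (use u v in auto)
  then show ?thesis using k by (simp add: layer_component_def)
qed

lemma linear_lc: "k \<in> {1..r} \<Longrightarrow> linear (lc k)"
proof (rule linearI)
  fix x y c assume k: "k \<in> {1..r}"
  show "lc k (x + y) = lc k x + lc k y"
    by (rule lc_unique[OF _ _ k]) (auto intro!: subspace_add subspace_layer lc_layer simp: sum.distrib sum_lc[simplified])
  show "lc k (c *\<^sub>R x) = c *\<^sub>R lc k x"
    by (rule lc_unique[OF _ _ k]) (auto intro!: subspace_scale subspace_layer lc_layer simp: scaleR_sum_right[symmetric] sum_lc[simplified])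
qed

definition dil :: "real \<Rightarrow> 'a \<Rightarrow> 'a" where "dil \<epsilon> v = (\<Sum>k=1..r. \<epsilon> ^ k *\<^sub>R lc k v)"

lemma dilation_Log: "dilation G r g \<epsilon> x = Exp G (dil \<epsilon> (Log G x))"
  by (simp add: dilation_def dil_def)

lemma linear_dil: "linear (dil \<epsilon>)"
  unfolding dil_def by (intro linear_compose_sum ballI linear_compose_scale_right linear_lc)

text \<open>The case \<open>l > r\<close> is included, with layer \<open>{0}\<close>, because
  brackets of two layers may land beyond the last one.\<close>

lemma dil_layer: assumes "1 \<le> l" "c \<in> g l" shows "dil \<epsilon> c = \<epsilon> ^ l *\<^sub>R c"
proof (cases "l \<le> r")
  case True
  have l: "lc k c = (if k = l then c else 0)" if "k \<in> {1..r}" for k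
  proof (rule lc_unique[OF _ _ that])
    show "c = (\<Sum>k=1..r. if k = l then c else 0)" using assms True by simp
  qed (use assms subspace_0[OF subspace_layer] in auto)
  have "dil \<epsilon> c = (\<Sum>k=1..r. if k = l then \<epsilon> ^ l *\<^sub>R c else 0)"
    unfolding dil_def by (rule sum.cong) (auto simp: l)
  then show ?thesis using assms True by simp
next
  case False
  then have "c = 0" using layer_zero assms by auto
  then show ?thesis by (simp add: linear_0[OF linear_dil])
qed

lemma dil_bracket: "dil \<epsilon> (bracket G a b) = bracket G (dil \<epsilon> a) (dil \<epsilon> b)"
proof -
  have lin: "linear (\<lambda>x. bracket G x y)" "linear (bracket G x)" for x y
    using bracket_bilinear by (auto simp: bilinear_def)
  have ex: "bracket G (\<Sum>k=1..r. x k) (\<Sum>l=1..r. y l) = (\<Sum>k=1..r. \<Sum>l=1..r. bracket G (x k) (y l))" for x y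
    by (subst linear_sum[OF lin(1)], subst linear_sum[OF lin(2)]) simp
  have "bracket G a b = (\<Sum>k=1..r. \<Sum>l=1..r. bracket G (lc k a) (lc l b))"
    using ex[of "\<lambda>k. lc k a" "\<lambda>k. lc k b"] by (simp add: sum_lc[simplified])
  then have "dil \<epsilon> (bracket G a b) = (\<Sum>k=1..r. \<Sum>l=1..r. dil \<epsilon> (bracket G (lc k a) (lc l b)))"
    by (simp add: linear_sum[OF linear_dil])
  also have "\<dots> = (\<Sum>k=1..r. \<Sum>l=1..r. bracket G (\<epsilon> ^ k *\<^sub>R lc k a) (\<epsilon> ^ l *\<^sub>R lc l b))"
  proof (intro sum.cong refl)
    fix k l assume "k \<in> {1..r}" "l \<in> {1..r}"
    then show "dil \<epsilon> (bracket G (lc k a) (lc l b)) = bracket G (\<epsilon> ^ k *\<^sub>R lc k a) (\<epsilon> ^ l *\<^sub>R lc l b)"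
      using dil_layer[of "k + l" "bracket G (lc k a) (lc l b)" \<epsilon>] bracket_layer[of k l "lc k a" "lc l b"] lc_layer
      by (simp add: linear_scale[OF lin(1)] linear_scale[OF lin(2)] power_add mult.commute)
  qed
  also have "\<dots> = bracket G (dil \<epsilon> a) (dil \<epsilon> b)" unfolding dil_def by (rule ex[symmetric])
  finally show ?thesis .
qed

text \<open>A dilation respects the bracket, and a linear map that does so respects the group law by
  \<open>hom_mul\<close>.\<close>

lemma dil_lmul: "dil \<epsilon> (lmul a b) = lmul (dil \<epsilon> a) (dil \<epsilon> b)"
  by (rule lie.hom_mul[OF linear_dil dil_bracket])

lemma dil_zero_left: "dil 0 v = 0"
  unfolding dil_def by (intro sum.neutral) auto

lemma dil_derivative: "((\<lambda>\<epsilon>. dil \<epsilon> v) has_vector_derivative lc 1 v) (at 0)"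
proof -
  have "((\<lambda>\<epsilon>. dil \<epsilon> v) has_vector_derivative (\<Sum>k=1..r. (real k * 0 ^ (k - 1)) *\<^sub>R lc k v)) (at 0)"
    unfolding dil_def by (auto intro!: derivative_eq_intros has_vector_derivative_sum)
  also have "(\<Sum>k=1..r. (real k * 0 ^ (k - 1)) *\<^sub>R lc k v) = (\<Sum>k=1..r. if k = 1 then lc 1 v else 0)"
    by (intro sum.cong) auto
  also have "\<dots> = lc 1 v" using r_pos by simp
  finally show ?thesis .
qed

text \<open>The first layer is read off from the dilations as \<open>\<epsilon> \<rightarrow> 0\<close>.\<close>

lemma lc_1_lmul: "lc 1 (lmul a b) = lc 1 a + lc 1 b"
proof (rule vector_derivative_unique[OF dil_derivative])
  show "((\<lambda>\<epsilon>. dil \<epsilon> (lmul a b)) has_vector_derivative lc 1 a + lc 1 b) (at 0)"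
    unfolding dil_lmul by (intro log.mul_curve_derivative dil_derivative dil_zero_left)
qed

text \<open>For \<open>r = 1\<close> the index 2 lies outside the range of
  \<open>layer_component\<close>, whose value there is unspecified; the second layer is then
  0.\<close>

definition lc2 :: "'a \<Rightarrow> 'a" where "lc2 v = (if 2 \<le> r then lc 2 v else 0)"

text \<open>The layers need not be orthogonal for the given inner product. This sum bounds every
  component at once, hence also all dilated vectors.\<close>

definition layer_norm :: "'a \<Rightarrow> real" where "layer_norm v = (\<Sum>k=1..r. norm (lc k v))"

lemma layer_norm_nonneg: "0 \<le> layer_norm v"
  by (simp add: layer_norm_def sum_nonneg)

lemma norm_lc: "k \<in> {1..r} \<Longrightarrow> norm (lc k v) \<le> layer_norm v"
  unfolding layer_norm_def by (rule member_le_sum) auto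

lemma norm_lc_1: "norm (lc 1 v) \<le> layer_norm v" and norm_lc2: "norm (lc2 v) \<le> layer_norm v"
  using r_pos norm_lc[of 1 v] norm_lc[of 2 v] layer_norm_nonneg[of v] by (auto simp: lc2_def)

lemma norm_dil: assumes "0 \<le> \<epsilon>" "\<epsilon> \<le> 1" shows "norm (dil \<epsilon> v) \<le> \<epsilon> * layer_norm v"
proof -
  have "norm (dil \<epsilon> v) \<le> (\<Sum>k=1..r. \<epsilon> * norm (lc k v))"
    unfolding dil_def 
  proof (rule order_trans[OF norm_sum], rule sum_mono)
    fix k assume "k \<in> {1..r}"
    then have "\<epsilon> ^ k \<le> \<epsilon> ^ 1" using assms by (intro power_decreasing) auto
    then show "norm (\<epsilon> ^ k *\<^sub>R lc k v) \<le> \<epsilon> * norm (lc k v)" using assms by (simp add: mult_right_mono)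
  qed
  then show ?thesis by (simp add: layer_norm_def sum_distrib_left)
qed

lemma dil_expansion: 
  assumes "0 \<le> \<epsilon>" "\<epsilon> \<le> 1" 
  shows "norm (dil \<epsilon> v - \<epsilon> *\<^sub>R lc 1 v - \<epsilon>\<^sup>2 *\<^sub>R lc2 v) \<le> layer_norm v * \<epsilon> ^ 3"
proof -
  have 1: "(\<Sum>k=1..r. if k = 1 then \<epsilon> *\<^sub>R lc 1 v else 0) = \<epsilon> *\<^sub>R lc 1 v" using r_pos by simp
  have 2: "(\<Sum>k=1..r. if k = 2 then \<epsilon>\<^sup>2 *\<^sub>R lc2 v else 0) = \<epsilon>\<^sup>2 *\<^sub>R lc2 v" by (simp add: lc2_def)
  have "dil \<epsilon> v - \<epsilon> *\<^sub>R lc 1 v - \<epsilon>\<^sup>2 *\<^sub>R lc2 v = 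
    (\<Sum>k=1..r. \<epsilon> ^ k *\<^sub>R lc k v - (if k = 1 then \<epsilon> *\<^sub>R lc 1 v else 0) - (if k = 2 then \<epsilon>\<^sup>2 *\<^sub>R lc2 v else 0))"
    by (simp only: sum_subtractf 1 2 dil_def)
  also have "norm \<dots> \<le> (\<Sum>k=1..r. \<epsilon> ^ 3 * norm (lc k v))"
  proof (rule order_trans[OF norm_sum], rule sum_mono)
    fix k assume k: "k \<in> {1..r}"
    consider "k = 1" | "k = 2" | "3 \<le> k" using k by fastforce
    then show "norm (\<epsilon> ^ k *\<^sub>R lc k v - (if k = 1 then \<epsilon> *\<^sub>R lc 1 v else 0) - (if k = 2 then \<epsilon>\<^sup>2 *\<^sub>R lc2 v else 0))
        \<le> \<epsilon> ^ 3 * norm (lc k v)"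
    proof cases
      case 3
      then have "\<epsilon> ^ k \<le> \<epsilon> ^ 3" using assms by (intro power_decreasing) auto
      then show ?thesis using 3 assms by (simp add: mult_right_mono)
    qed (use k assms in \<open>auto simp: lc2_def\<close>)
  qed
  finally show ?thesis by (simp add: layer_norm_def sum_distrib_left mult.commute)
qed

end

lemma sum_blocks:
  fixes d :: "nat \<Rightarrow> nat"
  assumes "d 0 = 0" "\<And>k. d k \<le> d (Suc k)"
  shows "(\<Sum>i=1..d r. h i) = (\<Sum>k=1..r. \<Sum>i=d (k - 1) + 1..d k. h i)"
proof (induction r)
  case (Suc r)
  have "{1..d (Suc r)} = {1..d r} \<union> {d r + 1..d (Suc r)}" using assms(2)[of r] by auto
  then have "(\<Sum>i=1..d (Suc r). h i) = (\<Sum>i=1..d r. h i) + (\<Sum>i=d r + 1..d (Suc r). h i)"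
    by (simp only:) (rule sum.union_disjoint, auto)
  with Suc.IH show ?case by simp
qed (use assms in simp)

section \<open>Adapted bases\<close>

locale stratified_lie_group_basis = stratified_lie_group G r g
  for G :: "('g::{t2_space,second_countable_topology}, 'a::euclidean_space) lie_data" (structure) and r g +
  fixes \<aa> :: "nat \<Rightarrow> 'a"
  assumes basis: "adapted_basis r g \<aa>"
begin

abbreviation "block k \<equiv> {dims_upto g (k - 1) + 1..dims_upto g k}"

lemma inj_basis: "inj_on \<aa> {1..dims_upto g r}"
  and independent_block: "k \<in> {1..r} \<Longrightarrow> independent (\<aa> ` block k)"
  and span_block: "k \<in> {1..r} \<Longrightarrow> span (\<aa> ` block k) = g k"
  using basis by (auto simp: adapted_basis_def)

lemma sum_basis: "(\<Sum>i=1..dims_upto g r. h i) = (\<Sum>k=1..r. \<Sum>i\<in>block k. h i)"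
  by (rule sum_blocks) (simp_all add: dims_upto_def)

lemma block_subset: "k \<in> {1..r} \<Longrightarrow> block k \<subseteq> {1..dims_upto g r}"
  using sum_mono2[of "{1..r}" "{1..k}" "\<lambda>j. dim (g j)"] by (auto simp: dims_upto_def)

lemma block_sum_layer: "k \<in> {1..r} \<Longrightarrow> (\<Sum>i\<in>block k. c i *\<^sub>R \<aa> i) \<in> g k"
  unfolding span_block[symmetric] by (intro span_sum span_scale span_base) auto

lemma lc_block:
  assumes "v = (\<Sum>i=1..dims_upto g r. c i *\<^sub>R \<aa> i)" and k: "k \<in> {1..r}"
  shows "lc k v = (\<Sum>i\<in>block k. c i *\<^sub>R \<aa> i)"
  by (rule lc_unique[OF block_sum_layer _ k]) (use assms in \<open>simp_all add: sum_basis[simplified]\<close>)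

text \<open>Independence is given within each block. A vanishing combination vanishes block by block
  because the decomposition into layers is unique.\<close>

lemma independent_basis: "independent (\<aa> ` {1..dims_upto g r})"
proof (rule independent_if_scalars_zero)
  fix c x assume sum: "(\<Sum>x\<in>\<aa> ` {1..dims_upto g r}. c x *\<^sub>R x) = 0" and "x \<in> \<aa> ` {1..dims_upto g r}"
  then obtain i where i: "i \<in> {1..dims_upto g r}" "x = \<aa> i" by auto
  have "0 = (\<Sum>i=1..dims_upto g r. c (\<aa> i) *\<^sub>R \<aa> i)"
    using sum unfolding sum.reindex[OF inj_basis] by simp
  then have zero: "(\<Sum>i\<in>block k. c (\<aa> i) *\<^sub>R \<aa> i) = 0" if "k \<in> {1..r}" for k
    using lc_block[of 0 "\<lambda>i. c (\<aa> i)" k] that by (simp add: linear_0[OF linear_lc])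
  \<comment> \<open>By counting: the indicator of \<open>i\<close> sums to 1 over the whole range,
    hence cannot vanish on every block.\<close>
  have "\<exists>k\<in>{1..r}. i \<in> block k"
  proof (rule ccontr)
    assume "\<not> (\<exists>k\<in>{1..r}. i \<in> block k)"
    then have "(\<Sum>k=1..r. \<Sum>j\<in>block k. of_bool (j = i)) = (0 :: nat)" by (intro sum.neutral ballI) auto
    moreover have "(\<Sum>j=1..dims_upto g r. of_bool (j = i)) = (1 :: nat)" using i by (simp add: of_bool_def)
    ultimately show False using sum_basis[of "\<lambda>j. of_bool (j = i) :: nat"] by simp
  qed
  then obtain k where k: "k \<in> {1..r}" "i \<in> block k" by auto
  have "(\<Sum>x\<in>\<aa> ` block k. c x *\<^sub>R x) = 0"
    using zero[OF k(1)] inj_on_subset[OF inj_basis block_subset[OF k(1)]] by (simp add: sum.reindex)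
  then show "c x = 0"
    using independent_block[OF k(1)] k(2) i(2) by (auto simp: independent_explicit_finite_subsets independent_explicit)
qed simp

lemma sum_coord: "(\<Sum>i=1..dims_upto g r. coord r g \<aa> i v *\<^sub>R \<aa> i) = v"
proof -
  have "lc k v \<in> span (\<aa> ` {1..dims_upto g r})" if "k \<in> {1..r}" for k
    using lc_layer[OF that, of v] span_block[OF that] span_mono[OF image_mono[OF block_subset[OF that]]] by blast
  then have "(\<Sum>k=1..r. lc k v) \<in> span (\<aa> ` {1..dims_upto g r})" by (intro span_sum)
  then have "v \<in> span (\<aa> ` {1..dims_upto g r})" by (simp add: sum_lc[simplified])
  from sum_representation_eq[OF independent_basis this finite_imageI[OF finite_atLeastAtMost] order_refl]
  show ?thesis unfolding sum.reindex[OF inj_basis] coord_def o_def .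
qed

lemma lc_coord: "k \<in> {1..r} \<Longrightarrow> lc k v = (\<Sum>i\<in>block k. coord r g \<aa> i v *\<^sub>R \<aa> i)"
  by (rule lc_block[OF sum_coord[symmetric]])

lemma lc_1_coord: "lc 1 v = (\<Sum>i=1..dims_upto g 1. coord r g \<aa> i v *\<^sub>R \<aa> i)"
  using lc_coord[of 1 v] r_pos by (simp add: dims_upto_def)

lemma lc2_coord: "lc2 v = (\<Sum>i=dims_upto g 1 + 1..dims_upto g 2. coord r g \<aa> i v *\<^sub>R \<aa> i)"
proof (cases "2 \<le> r")
  case True
  then show ?thesis using lc_coord[of 2 v] by (simp add: lc2_def)
next
  case False
  \<comment> \<open>For \<open>r = 1\<close> the second layer is \<open>{0}\<close> and its block of
    indices is empty, in accordance with \<open>lc2\<close>.\<close>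
  then have "dims_upto g 2 = dims_upto g 1" using layer_zero[of 2] by (simp add: dims_upto_def numeral_2_eq_2)
  then show ?thesis using False by (simp add: lc2_def)
qed

end

section \<open>The quotient graph\<close>

lemma bounded_via_finite_range:
  fixes f :: "'b \<Rightarrow> real"
  assumes fin: "finite (h ` S)" and f: "\<And>x. x \<in> S \<Longrightarrow> f x = k (h x)"
  shows "\<exists>D\<ge>0. \<forall>x\<in>S. f x \<le> D"
proof -
  have "finite (f ` S)"
    by (rule finite_subset[OF _ finite_imageI[OF fin, of k]]) (use f in auto)
  then have "f x \<le> (\<Sum>y\<in>f ` S. \<bar>y\<bar>)" if "x \<in> S" for x
    using member_le_sum[of "f x" "f ` S" abs] that abs_ge_self[of "f x"] by force
  then show ?thesis by (intro exI[of _ "\<Sum>y\<in>f ` S. \<bar>y\<bar>"]) (auto intro: sum_nonneg)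
qed

context free_graph_action
begin

abbreviation quotient :: "('v set, 'e set) pre_digraph" where "quotient \<equiv> quotient_graph X H \<phi> \<psi>"
abbreviation vo :: "'v \<Rightarrow> 'v set" where "vo \<equiv> orbit H \<phi>"
abbreviation eo :: "'e \<Rightarrow> 'e set" where "eo \<equiv> orbit H \<psi>"

lemma verts_quotient: "verts quotient = vo ` verts X" and arcs_quotient: "arcs quotient = eo ` arcs X"
  by (auto simp: quotient_graph_def orbits_def)

lemma tail_quotient: "e \<in> arcs X \<Longrightarrow> tail quotient (eo e) = vo (tail X e)"
  and head_quotient: "e \<in> arcs X \<Longrightarrow> head quotient (eo e) = vo (head X e)"
  and rv_quotient: "e \<in> arcs X \<Longrightarrow> rv ` eo e = eo (rv e)"
  by (force simp: quotient_graph_def orbit_def tail_action head_action rev_action image_iff)+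

lemma group_H: "group H"
  using V.group_hom by (simp add: group_hom_def)

lemma orbit_action:
  assumes act: "group_action H S \<theta>" and "\<gamma> \<in> carrier H" "x \<in> S" shows "orbit H \<theta> (\<theta> \<gamma> x) = orbit H \<theta> x"
proof -
  interpret H: group H by (rule group_H)
  have "\<theta> g (\<theta> \<gamma> x) = \<theta> (g \<otimes>\<^bsub>H\<^esub> \<gamma>) x" if "g \<in> carrier H" for g
    using group_action.composition_rule[OF act assms(3) that assms(2)] by simp
  moreover have "\<theta> g x = \<theta> (g \<otimes>\<^bsub>H\<^esub> inv\<^bsub>H\<^esub> \<gamma>) (\<theta> \<gamma> x)" if "g \<in> carrier H" for g
    using group_action.composition_rule[OF act assms(3), of "g \<otimes>\<^bsub>H\<^esub> inv\<^bsub>H\<^esub> \<gamma>" \<gamma>] that assms(2)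
    by (simp add: H.m_assoc)
  ultimately show ?thesis using assms(2) unfolding orbit_def
    by (safe; metis H.m_closed H.inv_closed)
qed

lemma eo_action: "\<gamma> \<in> carrier H \<Longrightarrow> e \<in> arcs X \<Longrightarrow> eo (\<psi> \<gamma> e) = eo e"
  by (rule orbit_action[OF E.group_action_axioms])

lemma vo_eq: "x \<in> verts X \<Longrightarrow> y \<in> verts X \<Longrightarrow> vo x = vo y \<Longrightarrow> \<exists>\<gamma>\<in>carrier H. x = \<phi> \<gamma> y"
  using V.orbit_refl[of x] by (auto simp: orbit_def)

lemma eo_eq: "e \<in> arcs X \<Longrightarrow> e' \<in> arcs X \<Longrightarrow> eo e = eo e' \<Longrightarrow> \<exists>\<gamma>\<in>carrier H. e = \<psi> \<gamma> e'"
  using E.orbit_refl[of e] by (auto simp: orbit_def)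

lemma action_arcs: "\<gamma> \<in> carrier H \<Longrightarrow> e \<in> arcs X \<Longrightarrow> \<psi> \<gamma> e \<in> arcs X"
  using E.element_image by blast

lemma lift_eo: assumes "e \<in> arcs X" shows "\<exists>\<gamma>\<in>carrier H. lift (eo e) = \<psi> \<gamma> e"
proof -
  have "lift (eo e) \<in> eo e" unfolding lift_def by (rule someI) (rule E.orbit_refl[OF assms])
  then show ?thesis by (auto simp: orbit_def)
qed

text \<open>Two edges at \<open>x\<close> in one orbit differ by an element fixing \<open>x\<close>,
  which is trivial as the action is free; conversely an orbit of edges over the orbit of
  \<open>x\<close> can be moved to start at \<open>x\<close>. Sums over outgoing edges thus descend
  to the quotient.\<close>

lemma bij_betw_out:
  assumes x: "x \<in> verts X" shows "bij_betw eo (out_arcs X x) (out_arcs quotient (vo x))"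
proof (rule bij_betw_imageI)
  show "inj_on eo (out_arcs X x)"
  proof (rule inj_onI)
    fix e e' assume e: "e \<in> out_arcs X x" "e' \<in> out_arcs X x" "eo e = eo e'"
    from eo_eq[OF _ _ e(3)] e(1,2) obtain \<gamma> where \<gamma>: "\<gamma> \<in> carrier H" "e = \<psi> \<gamma> e'" by auto
    then have "\<phi> \<gamma> x = x" using e tail_action by auto
    then have "\<gamma> = \<one>\<^bsub>H\<^esub>" using free \<gamma> x by blast
    then show "e = e'" using \<gamma>(2) e E.id_eq_one by (metis in_out_arcs_conv restrict_apply')
  qed
  show "eo ` out_arcs X x = out_arcs quotient (vo x)"
  proof safe
    fix e assume "e \<in> out_arcs X x"
    then show "eo e \<in> out_arcs quotient (vo x)" by (auto simp: arcs_quotient tail_quotient)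
  next
    fix E assume "E \<in> out_arcs quotient (vo x)"
    then obtain e where e: "e \<in> arcs X" "E = eo e" "vo (tail X e) = vo x" by (auto simp: arcs_quotient tail_quotient)
    then obtain \<gamma> where \<gamma>: "\<gamma> \<in> carrier H" "x = \<phi> \<gamma> (tail X e)" using vo_eq[of x "tail X e"] x by auto
    then have "\<psi> \<gamma> e \<in> out_arcs X x" using action_arcs e tail_action by auto
    then show "E \<in> eo ` out_arcs X x" using eo_action[OF \<gamma>(1) e(1)] e(2) by (metis image_eqI)
  qed
qed

lemma sum_out_quotient: 
  "x \<in> verts X \<Longrightarrow> (\<Sum>E\<in>out_arcs quotient (vo x). h E) = (\<Sum>e\<in>out_arcs X x. h (eo e))"
  using sum.reindex_bij_betw[OF bij_betw_out] by metis

end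

context invariant_transition_probability
begin

lemma p_lift: "e \<in> arcs X \<Longrightarrow> p (lift (eo e)) = p e"
  using lift_eo[of e] p_invariant by force

text \<open>A change of the realization alters only the function that is iterated; averaging does
  not enlarge the error.\<close>

lemma transition_operator_contraction:
  assumes "\<And>y. y \<in> verts X \<Longrightarrow> \<bar>h y - h' y\<bar> \<le> B" "x \<in> verts X"
  shows "\<bar>(transition_operator X p ^^ k) h x - (transition_operator X p ^^ k) h' x\<bar> \<le> B"
  using assms(2)
proof (induction k arbitrary: x)
  case (Suc k)
  let ?L = "transition_operator X p ^^ k"
  have "\<bar>(transition_operator X p ^^ Suc k) h x - (transition_operator X p ^^ Suc k) h' x\<bar> = 
     \<bar>\<Sum>e\<in>out_arcs X x. p e * (?L h (head X e) - ?L h' (head X e))\<bar>"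
    by (simp add: transition_operator_def right_diff_distrib sum_subtractf)
  also have "\<dots> \<le> (\<Sum>e\<in>out_arcs X x. p e * B)"
  proof (rule order_trans[OF sum_abs], rule sum_mono, unfold abs_mult)
    fix e assume e: "e \<in> out_arcs X x"
    then have "\<bar>p e\<bar> = p e" using p_range[of e] by simp
    then show "\<bar>p e\<bar> * \<bar>?L h (head X e) - ?L h' (head X e)\<bar> \<le> p e * B"
      using Suc.IH[of "head X e"] e p_range[of e] by (auto intro!: mult_left_mono)
  qed
  also have "\<dots> = B" using p_sum[OF Suc.prems] by (simp add: sum_distrib_right[symmetric])
  finally show ?case .
qed (use assms in simp)

end

section \<open>Equivariant realizations of the covering graph\<close>

locale covering_walk = 
  stratified_lie_group_basis G r g \<aa> + nilpotent_covering_graph G \<Gamma> X rv \<phi> \<psi> +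
  invariant_transition_probability X rv "G\<lparr>carrier := \<Gamma>\<rparr>" \<phi> \<psi> p
  for G :: "('g::{t2_space,second_countable_topology}, 'a::euclidean_space) lie_data" (structure)
    and r g and \<aa> :: "nat \<Rightarrow> 'a" and \<Gamma> :: "'g set"
    and X :: "('v, 'e) pre_digraph" and rv :: "'e \<Rightarrow> 'e"
    and \<phi> :: "'g \<Rightarrow> 'v \<Rightarrow> 'v" and \<psi> :: "'g \<Rightarrow> 'e \<Rightarrow> 'e" and p :: "'e \<Rightarrow> real" +
  fixes \<Phi>\<^sub>0 :: "'v \<Rightarrow> 'g"
  assumes equivariant: "equivariant_realization G \<Gamma> X \<phi> \<Phi>\<^sub>0"
begin

definition incr :: "'e \<Rightarrow> 'a" where "incr e = Log G (edge_increment G X \<Phi>\<^sub>0 e)"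

lemma \<Phi>0_action: "\<gamma> \<in> \<Gamma> \<Longrightarrow> x \<in> verts X \<Longrightarrow> \<Phi>\<^sub>0 (\<phi> \<gamma> x) = \<gamma> \<otimes> \<Phi>\<^sub>0 x"
  using equivariant by (simp add: equivariant_realization_def)

lemma cancel_action: "inv (\<gamma> \<otimes> a) \<otimes> (\<gamma> \<otimes> b) = inv a \<otimes> b"
  by (simp add: inv_mult_group carrier_UNIV m_assoc) (metis UNIV_I carrier_UNIV inv_closed l_inv l_one m_assoc)

lemma incr_action: "\<gamma> \<in> \<Gamma> \<Longrightarrow> e \<in> arcs X \<Longrightarrow> incr (\<psi> \<gamma> e) = incr e"
  by (simp add: incr_def edge_increment_def tail_action head_action \<Phi>0_action cancel_action)

lemma incr_lift: "e \<in> arcs X \<Longrightarrow> incr (lift (eo e)) = incr e"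
  using lift_eo[of e] incr_action by force

lemma Log_\<Phi>0_head: "Log G (\<Phi>\<^sub>0 (head X e)) = lmul (Log G (\<Phi>\<^sub>0 (tail X e))) (incr e)"
proof -
  have "\<Phi>\<^sub>0 (head X e) = \<Phi>\<^sub>0 (tail X e) \<otimes> edge_increment G X \<Phi>\<^sub>0 e"
    by (simp add: edge_increment_def carrier_UNIV m_assoc[symmetric])
  then show ?thesis by (simp add: Log_mult incr_def)
qed

text \<open>Finiteness of the quotient makes increments bounded, as they depend on the orbit of the
  edge only; a sum dominates each of them.\<close>

definition W :: real where "W = (\<Sum>E\<in>arcs quotient. layer_norm (incr (lift E)))"

lemma W: "E \<in> arcs quotient \<Longrightarrow> layer_norm (incr (lift E)) \<le> W" and W_nonneg: "0 \<le> W"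
  unfolding W_def using finite_quotient(2)
  by (auto intro!: member_le_sum[where f="\<lambda>E. layer_norm (incr (lift E))"] sum_nonneg layer_norm_nonneg)

lemma W_incr: "e \<in> arcs X \<Longrightarrow> layer_norm (incr e) \<le> W"
  using W[of "eo e"] by (simp add: arcs_quotient incr_lift)

text \<open>The first layer is additive on products, so modified harmonicity says that its mean
  increment is one and the same vector at every vertex. By (A2) and
  \<open>random_walk_mean_increment\<close> that vector is 0.\<close>

lemma modified_harmonic_centered:
  fixes M :: "'w measure"
  assumes harm: "modified_harmonic G \<Gamma> r g X rv \<phi> \<psi> p m \<rho> \<Phi>\<^sub>0" and rw: "random_walk X p x0 M w"
    and lim: "AE \<omega> in M. (\<lambda>n. (1 / real n) *\<^sub>R lc 1 (Log G (\<Phi>\<^sub>0 (w n \<omega>)))) \<longlonglongrightarrow> 0"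
    and x: "x \<in> verts X"
  shows "(\<Sum>e\<in>out_arcs X x. p e *\<^sub>R lc 1 (incr e)) = 0"
proof -
  define c where "c = \<rho> (homological_direction quotient ((`) rv) (p \<circ> lift) m)"
  have c: "(\<Sum>e\<in>out_arcs X x. p e *\<^sub>R lc 1 (incr e)) = c" if "x \<in> verts X" for x
    using harm that by (simp add: modified_harmonic_def incr_def c_def)
  have d: "lc 1 (Log G (\<Phi>\<^sub>0 (head X e))) - lc 1 (Log G (\<Phi>\<^sub>0 (tail X e))) = lc 1 (incr e)" for e
    unfolding Log_\<Phi>0_head lc_1_lmul by simp
  have "c = 0"
  proof (rule random_walk_mean_increment[OF wf_digraph_axioms rw p_sum _ _ lim])
    show "(\<Sum>e\<in>out_arcs X x. p e *\<^sub>R (lc 1 (Log G (\<Phi>\<^sub>0 (head X e))) - lc 1 (Log G (\<Phi>\<^sub>0 x)))) = c" 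
      if "x \<in> verts X" for x
      unfolding c[OF that, symmetric] by (rule sum.cong) (auto simp: d[unfolded One_nat_def])
    show "norm (lc 1 (Log G (\<Phi>\<^sub>0 (head X e))) - lc 1 (Log G (\<Phi>\<^sub>0 (tail X e)))) \<le> W" if "e \<in> arcs X" for e
      unfolding d by (rule order_trans[OF norm_lc_1 W_incr[OF that]])
  qed
  then show ?thesis using c[OF x] by simp
qed

text \<open>Both realizations are equivariant, so the group element between them is constant on
  orbits and takes finitely many values.\<close>

lemma realization_distance:
  assumes \<Phi>: "equivariant_realization G \<Gamma> X \<phi> \<Phi>"
  shows "\<exists>D\<ge>0. \<forall>x\<in>verts X. layer_norm (Log G (inv (\<Phi>\<^sub>0 x) \<otimes> \<Phi> x)) \<le> D"
proof -
  define f where "f x = layer_norm (Log G (inv (\<Phi>\<^sub>0 x) \<otimes> \<Phi> x))" for x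
  have f_action: "f (\<phi> \<gamma> x) = f x" if "\<gamma> \<in> \<Gamma>" "x \<in> verts X" for \<gamma> x
    using \<Phi> that by (simp add: f_def \<Phi>0_action equivariant_realization_def cancel_action)
  have "f x = f (SOME y. y \<in> verts X \<and> vo y = vo x)" if x: "x \<in> verts X" for x
  proof -
    have "(SOME y. y \<in> verts X \<and> vo y = vo x) \<in> verts X \<and> vo (SOME y. y \<in> verts X \<and> vo y = vo x) = vo x"
      by (rule someI[of _ x]) (use x in simp)
    then obtain \<gamma> where "\<gamma> \<in> \<Gamma>" "(SOME y. y \<in> verts X \<and> vo y = vo x) = \<phi> \<gamma> x"
      using vo_eq[of "SOME y. y \<in> verts X \<and> vo y = vo x" x] x by auto
    then show ?thesis using f_action x by simp
  qed
  from bounded_via_finite_range[of vo "verts X" f "\<lambda>A. f (SOME y. y \<in> verts X \<and> vo y = A)", OF _ this]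
  show ?thesis using finite_quotient(1) by (simp add: verts_quotient f_def)
qed

end

section \<open>The centered walk over the quotient graph\<close>

locale centered_covering_walk = covering_walk G r g \<aa> \<Gamma> X rv \<phi> \<psi> p \<Phi>\<^sub>0
  for G :: "('g::{t2_space,second_countable_topology}, 'a::euclidean_space) lie_data" (structure)
    and r g and \<aa> :: "nat \<Rightarrow> 'a" and \<Gamma> :: "'g set"
    and X :: "('v, 'e) pre_digraph" and rv :: "'e \<Rightarrow> 'e"
    and \<phi> :: "'g \<Rightarrow> 'v \<Rightarrow> 'v" and \<psi> :: "'g \<Rightarrow> 'e \<Rightarrow> 'e" and p :: "'e \<Rightarrow> real" and \<Phi>\<^sub>0 :: "'v \<Rightarrow> 'g" +
  fixes m :: "'v set \<Rightarrow> real"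
  assumes irreducible: "irreducible_walk (quotient_graph X (G\<lparr>carrier := \<Gamma>\<rparr>) \<phi> \<psi>) (p \<circ> lift)"
    and inv_measure: "invariant_measure (quotient_graph X (G\<lparr>carrier := \<Gamma>\<rparr>) \<phi> \<psi>) ((`) rv) (p \<circ> lift) m"
    and incr_centered: "x \<in> verts X \<Longrightarrow> (\<Sum>e\<in>out_arcs X x. p e *\<^sub>R layer_component r g 1 (Log G (edge_increment G X \<Phi>\<^sub>0 e))) = 0"
begin

definition p0 :: "'e set \<Rightarrow> real" where "p0 E = p (lift E)"
abbreviation "\<zeta> E \<equiv> incr (lift E)"

lemma arc_quotient_cases: 
  assumes "E \<in> arcs quotient" 
  obtains e where "e \<in> arcs X" "E = eo e" "p0 E = p e" "\<zeta> E = incr e" 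
    "tail quotient E = vo (tail X e)" "head quotient E = vo (head X e)"
  using assms by (auto simp: arcs_quotient tail_quotient head_quotient p_lift incr_lift p0_def)

lemma tail_head_quotient: "E \<in> arcs quotient \<Longrightarrow> tail quotient E \<in> verts quotient \<and> head quotient E \<in> verts quotient"
  by (erule arc_quotient_cases) (auto simp: verts_quotient)

lemma p0_nonneg: "E \<in> arcs quotient \<Longrightarrow> 0 \<le> p0 E"
  by (erule arc_quotient_cases) (use p_range in auto)

lemma out_arcs_set: "{E. E \<in> arcs quotient \<and> tail quotient E = A} = out_arcs quotient A"
  by (auto simp: out_arcs_def)

lemma p0_sum: "A \<in> verts quotient \<Longrightarrow> (\<Sum>E | E \<in> arcs quotient \<and> tail quotient E = A. p0 E) = 1"
  unfolding out_arcs_set by (auto simp: verts_quotient sum_out_quotient p_lift p_sum p0_def)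

lemma p0_centered: 
  "A \<in> verts quotient \<Longrightarrow> (\<Sum>E | E \<in> arcs quotient \<and> tail quotient E = A. p0 E *\<^sub>R lc 1 (\<zeta> E)) = 0"
  unfolding out_arcs_set using incr_centered 
  by (auto simp: verts_quotient sum_out_quotient p_lift incr_lift p0_def) (simp add: incr_def)

text \<open>Invariance of \<open>m\<close> is formulated with the probabilities of the inverse
  edges. Reversing all edges turns the sum over outgoing edges into one over incoming edges, which
  is stationarity.\<close>

lemma stationary:
  "(\<Sum>E\<in>arcs quotient. p0 E * m (tail quotient E) * f (head quotient E)) = (\<Sum>A\<in>verts quotient. m A * f A)"
proof -
  let ?E = "arcs quotient"
  have rv: "rv ` E \<in> ?E \<and> rv ` (rv ` E) = E \<and> tail quotient (rv ` E) = head quotient E \<and> head quotient (rv ` E) = tail quotient E"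
    if "E \<in> ?E" for E
  proof -
    obtain e where e: "e \<in> arcs X" "E = eo e" using \<open>E \<in> ?E\<close> by (rule arc_quotient_cases)
    have r: "rv e \<in> arcs X" using e arev_dom arev_arev by metis
    moreover have "head X (rv e) = tail X e" using tail_arev[OF r] by simp
    ultimately show ?thesis using e by (simp add: rv_quotient arcs_quotient tail_quotient head_quotient)
  qed
  have inv: "(\<Sum>E\<in>out_arcs quotient A. p0 (rv ` E) * m (head quotient E)) = m A" if "A \<in> verts quotient" for A
    using inv_measure that by (simp add: invariant_measure_def p0_def)
  have "(\<Sum>A\<in>verts quotient. m A * f A) = 
      (\<Sum>A\<in>verts quotient. \<Sum>E\<in>{E \<in> ?E. tail quotient E = A}. p0 (rv ` E) * m (head quotient E) * f (tail quotient E))"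
  proof (rule sum.cong[OF refl])
    fix A assume A: "A \<in> verts quotient"
    have "m A * f A = (\<Sum>E\<in>out_arcs quotient A. p0 (rv ` E) * m (head quotient E)) * f A" by (simp only: inv[OF A])
    also have "\<dots> = (\<Sum>E\<in>{E \<in> ?E. tail quotient E = A}. p0 (rv ` E) * m (head quotient E) * f (tail quotient E))"
      unfolding out_arcs_set[symmetric] sum_distrib_right by (rule sum.cong) auto
    finally show "m A * f A = (\<Sum>E\<in>{E \<in> ?E. tail quotient E = A}. p0 (rv ` E) * m (head quotient E) * f (tail quotient E))" .
  qed
  also have "\<dots> = (\<Sum>E\<in>?E. p0 (rv ` E) * m (head quotient E) * f (tail quotient E))"
    by (rule sum.group) (use finite_quotient tail_head_quotient in auto)
  also have "\<dots> = (\<Sum>E\<in>?E. p0 E * m (tail quotient E) * f (head quotient E))"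
    by (rule sum.reindex_bij_witness[of _ "(`) rv" "(`) rv"]) (use rv in auto)
  finally show ?thesis by simp
qed

lemma reachable_quotient:
  assumes "A \<in> verts quotient" "B \<in> verts quotient"
  shows "(A, B) \<in> {(tail quotient E, head quotient E) | E. E \<in> arcs quotient \<and> 0 < p0 E}\<^sup>*"
proof -
  have "A \<rightarrow>\<^sup>*\<^bsub>quotient\<lparr>arcs := {E \<in> arcs quotient. 0 < p0 E}\<rparr>\<^esub> B"
    using irreducible assms by (simp add: irreducible_walk_def strongly_connected_def p0_def)
  then show ?thesis unfolding reachable_def
  proof (induction rule: rtrancl_on.induct)
    case (rtrancl_on_into_rtrancl_on a b c)
    then have "(b, c) \<in> {(tail quotient E, head quotient E) | E. E \<in> arcs quotient \<and> 0 < p0 E}"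
      by (auto simp: arcs_ends_def arc_to_ends_def)
    with rtrancl_on_into_rtrancl_on.IH show ?case by (rule rtrancl_into_rtrancl)
  qed simp
qed

text \<open>A step is the dilated increment. Its first two layers are the expansion coefficients,
  and all higher layers go into the error of order three.\<close>

sublocale walk: log_walk lmul "verts quotient" "arcs quotient" "tail quotient" "head quotient" p0 m
  "\<lambda>\<epsilon> E. dil \<epsilon> (\<zeta> E)" "\<lambda>E. lc 1 (\<zeta> E)" "\<lambda>E. lc2 (\<zeta> E)" W
proof
  show "finite (verts quotient)" "finite (arcs quotient)" by (rule finite_quotient)+
  show "(\<Sum>A\<in>verts quotient. m A) = 1" "\<And>A. A \<in> verts quotient \<Longrightarrow> 0 \<le> m A"
    using inv_measure by (auto simp: invariant_measure_def less_imp_le)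
  show "\<exists>C\<ge>0. \<forall>\<phi> d. (\<forall>A\<in>verts quotient. \<bar>(\<Sum>E | E \<in> arcs quotient \<and> tail quotient E = A. p0 E * \<phi> (head quotient E)) - \<phi> A\<bar> \<le> d) \<longrightarrow>
        (\<forall>A\<in>verts quotient. \<forall>B\<in>verts quotient. \<bar>\<phi> A - \<phi> B\<bar> \<le> C * d)"
    by (rule poisson_estimate[OF finite_quotient p0_nonneg p0_sum tail_head_quotient reachable_quotient])
  show "norm (lc 1 (\<zeta> E)) \<le> W" "norm (lc2 (\<zeta> E)) \<le> W" if "E \<in> arcs quotient" for E
    using order_trans[OF norm_lc_1 W[OF that]] order_trans[OF norm_lc2 W[OF that]] by auto
  show "norm (dil \<epsilon> (\<zeta> E) - \<epsilon> *\<^sub>R lc 1 (\<zeta> E) - \<epsilon>\<^sup>2 *\<^sub>R lc2 (\<zeta> E)) \<le> W * \<epsilon> ^ 3" 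
    if "E \<in> arcs quotient" "0 < \<epsilon>" "\<epsilon> \<le> 1" for E \<epsilon>
    by (rule order_trans[OF dil_expansion mult_right_mono[OF W[OF that(1)]]]) (use that in auto)
qed (use tail_head_quotient p0_nonneg p0_sum stationary W_nonneg p0_centered in auto)

text \<open>The dilation is a homomorphism, so a step along an edge multiplies the dilated position
  on the right by the dilated increment. That factor depends on the orbit of the edge only, and
  outgoing edges correspond to those of the quotient.\<close>

lemma iterate_transition_operator:
  "x \<in> verts X \<Longrightarrow> (transition_operator X p ^^ k) (scaling_operator G r g \<Phi>\<^sub>0 \<epsilon> (\<lambda>x. F (Log G x))) x = 
     walk.iter \<epsilon> k (\<lambda>_. F) (vo x) (dil \<epsilon> (Log G (\<Phi>\<^sub>0 x)))"
proof (induction k arbitrary: x)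
  case 0
  then show ?case by (simp add: scaling_operator_def dilation_Log)
next
  case (Suc k)
  have "(transition_operator X p ^^ Suc k) (scaling_operator G r g \<Phi>\<^sub>0 \<epsilon> (\<lambda>x. F (Log G x))) x = 
     (\<Sum>e\<in>out_arcs X x. p e * walk.iter \<epsilon> k (\<lambda>_. F) (vo (head X e)) (dil \<epsilon> (Log G (\<Phi>\<^sub>0 (head X e)))))"
    by (simp add: transition_operator_def) (intro sum.cong refl, simp add: Suc.IH)
  also have "\<dots> = (\<Sum>e\<in>out_arcs X x. p0 (eo e) * walk.iter \<epsilon> k (\<lambda>_. F) (head quotient (eo e)) 
      (lmul (dil \<epsilon> (Log G (\<Phi>\<^sub>0 x))) (dil \<epsilon> (\<zeta> (eo e)))))"
    by (rule sum.cong) (auto simp: p0_def p_lift head_quotient incr_lift Log_\<Phi>0_head dil_lmul)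
  also have "\<dots> = walk.iter \<epsilon> (Suc k) (\<lambda>_. F) (vo x) (dil \<epsilon> (Log G (\<Phi>\<^sub>0 x)))"
    unfolding walk.iter_Suc walk.step_def walk.out_def out_arcs_set by (rule sum_out_quotient[OF Suc.prems, symmetric])
  finally show ?case .
qed

text \<open>Expanding the first and second layer of each increment in the adapted basis, and summing
  over the edges last, turns the coefficients of the fields into the covariances and drifts of the
  limit.\<close>

lemma limit_generator_Log:
  assumes F: "smooth F"
  shows "limit_generator G \<Gamma> r g \<aa> X \<phi> \<psi> p m \<Phi>\<^sub>0 (\<lambda>x. F (Log G x)) = (\<lambda>x. walk.gen F (Log G x))"
proof
  fix x
  let ?u = "Log G x" and ?E = "arcs quotient"
  let ?I = "{1..dims_upto g 1}" and ?J = "{dims_upto g 1 + 1..dims_upto g 2}"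
  let ?c = "\<lambda>i E. coord r g \<aa> i (\<zeta> E)"
  have lin: "log.vf (\<Sum>i\<in>S. c i *\<^sub>R \<aa> i) H u = (\<Sum>i\<in>S. c i * log.vf (\<aa> i) H u)" if "smooth H" for S c H u
    by (simp add: linear_sum[OF log.linear_vf[OF that]] linear_scale[OF log.linear_vf[OF that]])
  have 2: "log.vf (lc 1 (\<zeta> E)) (log.vf (lc 1 (\<zeta> E)) F) ?u = 
    (\<Sum>i\<in>?I. \<Sum>j\<in>?I. ?c i E * ?c j E * log.vf (\<aa> i) (log.vf (\<aa> j) F) ?u)" for E
  proof -
    have eq: "log.vf (lc 1 (\<zeta> E)) F = (\<lambda>u. \<Sum>j\<in>?I. ?c j E * log.vf (\<aa> j) F u)"
      unfolding lc_1_coord by (intro ext lin F)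
    have "log.vf v (\<lambda>u. \<Sum>j\<in>?I. ?c j E * log.vf (\<aa> j) F u) u = (\<Sum>j\<in>?I. ?c j E * log.vf v (log.vf (\<aa> j) F) u)" for v u
      using fun_cong[OF log.vfs_sum[of ?I "\<lambda>j. log.vf (\<aa> j) F" "[v]" "\<lambda>j. ?c j E"], of u] log.smooth_vf[OF F] by simp
    then have "log.vf (lc 1 (\<zeta> E)) (log.vf (lc 1 (\<zeta> E)) F) ?u = (\<Sum>j\<in>?I. ?c j E * log.vf (lc 1 (\<zeta> E)) (log.vf (\<aa> j) F) ?u)"
      unfolding eq .
    also have "\<dots> = (\<Sum>j\<in>?I. ?c j E * (\<Sum>i\<in>?I. ?c i E * log.vf (\<aa> i) (log.vf (\<aa> j) F) ?u))"
      by (intro sum.cong refl arg_cong2[where f=times]) (subst (1) lc_1_coord, rule lin[OF log.smooth_vf[OF F]])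
    also have "\<dots> = (\<Sum>j\<in>?I. \<Sum>i\<in>?I. ?c i E * ?c j E * log.vf (\<aa> i) (log.vf (\<aa> j) F) ?u)"
      by (simp add: sum_distrib_left mult_ac)
    finally show ?thesis by (subst sum.swap)
  qed
  have "walk.drift = (\<Sum>E\<in>?E. walk.q E *\<^sub>R lc2 (\<zeta> E))" by (rule walk.drift_def)
  also have "\<dots> = (\<Sum>E\<in>?E. \<Sum>i\<in>?J. (walk.q E * ?c i E) *\<^sub>R \<aa> i)"
    by (intro sum.cong refl, subst lc2_coord) (simp only: scaleR_sum_right scaleR_scaleR)
  also have "\<dots> = (\<Sum>i\<in>?J. (\<Sum>E\<in>?E. walk.q E * ?c i E) *\<^sub>R \<aa> i)"
    unfolding scaleR_sum_left by (rule sum.swap)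
  finally have d: "walk.drift = (\<Sum>i\<in>?J. (\<Sum>E\<in>?E. walk.q E * ?c i E) *\<^sub>R \<aa> i)" .
  have "(\<Sum>E\<in>?E. walk.q E * log.vf (lc 1 (\<zeta> E)) (log.vf (lc 1 (\<zeta> E)) F) ?u) = 
     (\<Sum>i\<in>?I. \<Sum>j\<in>?I. (\<Sum>E\<in>?E. walk.q E * ?c i E * ?c j E) * log.vf (\<aa> i) (log.vf (\<aa> j) F) ?u)"
    unfolding 2 sum_distrib_left sum_distrib_right
    by (subst sum.swap, rule sum.cong[OF refl], subst sum.swap) (simp only: mult_ac)
  moreover have "log.vf walk.drift F ?u = (\<Sum>i\<in>?J. (\<Sum>E\<in>?E. walk.q E * ?c i E) * log.vf (\<aa> i) F ?u)"
    unfolding d by (rule lin[OF F])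
  ultimately show "limit_generator G \<Gamma> r g \<aa> X \<phi> \<psi> p m \<Phi>\<^sub>0 (\<lambda>x. F (Log G x)) x = walk.gen F ?u"
    unfolding limit_generator_def Let_def vector_field_Log walk.gen_def diffusion_coefficient_def drift_coefficient_def
      edge_measure_def walk.q_def incr_def[symmetric] p0_def o_def
    by simp
qed

text \<open>The rate \<open>\<epsilon>\<close> over the \<open>N \<approx> t / \<epsilon>\<^sup>2\<close> steps comes from the one-step error \<open>O(\<epsilon>\<^sup>3)\<close> of the averaged iterates.\<close>

lemma heat_approximation:
  assumes conv: "convolution_semigroup G \<nu>" 
    and gen: "has_generator G \<nu> (limit_generator G \<Gamma> r g \<aa> X \<phi> \<psi> p m \<Phi>\<^sub>0)"
    and F: "test F" and t: "0 < t"
  shows "\<exists>C\<ge>0. \<forall>\<epsilon> N x A. 0 < \<epsilon> \<longrightarrow> \<epsilon> \<le> 1 \<longrightarrow> \<epsilon>\<^sup>2 * real N \<le> t \<longrightarrow> t \<le> \<epsilon>\<^sup>2 * real (Suc N) \<longrightarrow> A \<in> verts quotient \<longrightarrow>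
     \<bar>heat_semigroup G \<nu> t (\<lambda>x. F (Log G x)) x - walk.iter \<epsilon> N (\<lambda>_. F) A (Log G x)\<bar> \<le> C * \<epsilon>"
proof -
  let ?A = "limit_generator G \<Gamma> r g \<aa> X \<phi> \<psi> p m \<Phi>\<^sub>0"
  let ?T = "heat_semigroup G \<nu>"
  let ?f = "\<lambda>x. F (Log G x)"
  \<comment> \<open>Every function on the group factors through the chart, so test functions
    correspond exactly to test functions of the logarithm.\<close>
  have tf: "\<exists>H. \<phi> = (\<lambda>x. H (Log G x)) \<and> test H" if "\<phi> \<in> test_functions G" for \<phi> :: "'g \<Rightarrow> real"
    using test_functions_Log[of "\<lambda>a. \<phi> (Exp G a)"] that by (intro exI[of _ "\<lambda>a. \<phi> (Exp G a)"]) simp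
  interpret S: generated_semigroup ?T "{\<phi>. \<phi> \<in> borel_measurable borel \<and> (\<exists>B. \<forall>x. \<bar>\<phi> x\<bar> \<le> B)}" "test_functions G" ?A
  proof (rule heat_generated_semigroup[OF is_group carrier_UNIV continuous_mult conv gen])
    fix \<phi> :: "'g \<Rightarrow> real" assume "\<phi> \<in> test_functions G"
    then obtain H where H: "\<phi> = (\<lambda>x. H (Log G x))" "test H" using tf by blast
    show "?A \<phi> \<in> test_functions G"
      unfolding H(1) limit_generator_Log[OF test_smooth[OF H(2)]] test_functions_Log by (rule walk.test_gen[OF H(2)])
    have "continuous_on UNIV \<phi>" unfolding H(1)
      by (rule continuous_on_compose2[OF smooth_continuous_on[OF test_smooth[OF H(2)], of UNIV] continuous_Log]) simp
    then show "continuous_on UNIV \<phi> \<and> (\<exists>B. \<forall>x. \<bar>\<phi> x\<bar> \<le> B)"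
      using test_bounded[OF H(2)] H(1) by auto
  qed
  have f: "?f \<in> test_functions G" using F by (simp add: test_functions_Log)
  obtain C1 where C1: "0 \<le> C1" "\<And>\<epsilon> k u. 0 < \<epsilon> \<and> \<epsilon> \<le> 1 \<and> \<epsilon>\<^sup>2 * real k \<le> t \<Longrightarrow> 
      \<bar>walk.mean F \<epsilon> (Suc k) u - walk.mean F \<epsilon> k u - \<epsilon>\<^sup>2 * walk.gen (walk.mean F \<epsilon> k) u\<bar> \<le> C1 * \<epsilon> ^ 3"
    using walk.mean_consistency[OF F, of t] by blast
  obtain C2 where C2: "0 \<le> C2" "\<And>\<epsilon> k u. 0 < \<epsilon> \<and> \<epsilon> \<le> 1 \<and> \<epsilon>\<^sup>2 * real k \<le> t \<Longrightarrow> 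
      \<bar>walk.gen (walk.gen (walk.mean F \<epsilon> k)) u\<bar> \<le> C2"
    using walk.gen_gen_mean_bound[OF F, of t] by blast
  obtain C3 where C3: "0 \<le> C3" "\<And>\<epsilon> k A vs u. 0 < \<epsilon> \<and> \<epsilon> \<le> 1 \<and> \<epsilon>\<^sup>2 * real k \<le> t \<Longrightarrow> A \<in> verts quotient \<Longrightarrow> length vs = 0 \<Longrightarrow>
     \<bar>log.vfs vs (walk.iter \<epsilon> k (\<lambda>_. F) A) u - log.vfs vs (walk.mean F \<epsilon> k) u\<bar> \<le> C3 * \<epsilon>\<^sup>2 * prod_list (map norm vs)"
    using walk.mean_oscillation[OF F, of t 0] by blast
  obtain a where a: "0 \<le> a" "\<And>u. \<bar>walk.gen F u\<bar> \<le> a" using test_bounded[OF walk.test_gen[OF F]] by blast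
  show ?thesis
  proof (intro exI[of _ "t * (C1 + C2) + C3 + a"] conjI allI impI)
    show "0 \<le> t * (C1 + C2) + C3 + a" using t C1 C2 C3 a by simp
    fix \<epsilon> :: real and N x A
    assume \<epsilon>: "0 < \<epsilon>" "\<epsilon> \<le> 1" and N: "\<epsilon>\<^sup>2 * real N \<le> t" "t \<le> \<epsilon>\<^sup>2 * real (Suc N)" and A: "A \<in> verts quotient"
    have ad: "0 < \<epsilon> \<and> \<epsilon> \<le> 1 \<and> \<epsilon>\<^sup>2 * real k \<le> t" if "k \<le> N" for k
      using \<epsilon> order_trans[OF mult_left_mono[of "real k" "real N" "\<epsilon>\<^sup>2"] N(1)] that by simp
    have e2: "\<epsilon>\<^sup>2 \<le> \<epsilon>" using \<epsilon> by (simp add: power2_eq_square mult_left_le_one_le)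
    let ?M = "\<lambda>k x. walk.mean F \<epsilon> k (Log G x)"
    have sM: "smooth (walk.mean F \<epsilon> k)" "test (walk.mean F \<epsilon> k)" for k
      using walk.test_mean[OF F] test_smooth by blast+
    have "\<bar>?T (real N * \<epsilon>\<^sup>2) (?M 0) x - ?M N x\<bar> \<le> real N * (C1 * \<epsilon> ^ 3 + (\<epsilon>\<^sup>2)\<^sup>2 * C2)"
    proof (rule S.approximation_chain)
      show "?M k \<in> test_functions G" for k by (simp add: test_functions_Log sM)
      fix k x assume k: "k < N"
      then have adk: "0 < \<epsilon> \<and> \<epsilon> \<le> 1 \<and> \<epsilon>\<^sup>2 * real k \<le> t" by (intro ad) simp
      show "\<bar>?M (Suc k) x - ?M k x - \<epsilon>\<^sup>2 * ?A (?M k) x\<bar> \<le> C1 * \<epsilon> ^ 3"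
        unfolding limit_generator_Log[OF sM(1)] by (rule C1(2)[OF adk])
      show "\<bar>?A (?A (?M k)) x\<bar> \<le> C2"
        unfolding limit_generator_Log[OF sM(1)] limit_generator_Log[OF test_smooth[OF walk.test_gen[OF sM(2)]]]
        by (rule C2(2)[OF adk])
    qed simp
    \<comment> \<open>A factor \<open>\<epsilon>\<^sup>2\<close> of the one-step error pays for the
      number of steps; what remains is of order \<epsilon>.\<close>
    also have "real N * (C1 * \<epsilon> ^ 3 + (\<epsilon>\<^sup>2)\<^sup>2 * C2) = (\<epsilon>\<^sup>2 * real N) * (\<epsilon> * C1 + \<epsilon>\<^sup>2 * C2)"
      by (simp add: power2_eq_square power3_eq_cube algebra_simps)
    also have "\<dots> \<le> t * (\<epsilon> * C1 + \<epsilon> * C2)"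
      using N(1) t \<epsilon> C1(1) C2(1) e2 by (intro mult_mono add_mono mult_right_mono) auto
    finally have 1: "\<bar>?T (real N * \<epsilon>\<^sup>2) ?f x - ?M N x\<bar> \<le> t * (C1 + C2) * \<epsilon>"
      by (simp add: walk.mean_0[OF F] algebra_simps)
    \<comment> \<open>The \<open>N\<close> steps fall short of \<open>t\<close> by at most
      \<open>\<epsilon>\<^sup>2\<close>; the semigroup moves \<open>f\<close> by a multiple of the
      remaining time.\<close>
    have 2: "\<bar>?T t ?f x - ?T (real N * \<epsilon>\<^sup>2) ?f x\<bar> \<le> a * \<epsilon>"
    proof -
      define h where "h = t - real N * \<epsilon>\<^sup>2"
      have h: "0 \<le> h" "h \<le> \<epsilon>\<^sup>2" using N by (simp_all add: h_def algebra_simps)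
      have M: "?f \<in> {\<phi>. \<phi> \<in> borel_measurable borel \<and> (\<exists>B. \<forall>x. \<bar>\<phi> x\<bar> \<le> B)}" using f S.D_M by blast
      have M': "?T h ?f \<in> {\<phi>. \<phi> \<in> borel_measurable borel \<and> (\<exists>B. \<forall>x. \<bar>\<phi> x\<bar> \<le> B)}" by (rule S.T_M[OF M h(1)])
      have "?T t ?f x - ?T (real N * \<epsilon>\<^sup>2) ?f x = ?T (real N * \<epsilon>\<^sup>2) (\<lambda>x. ?T h ?f x - ?f x) x"
        using S.T_add[OF M _ h(1), of "real N * \<epsilon>\<^sup>2"] S.T_diff[OF M' M, of "real N * \<epsilon>\<^sup>2" x] by (simp add: h_def)
      also have "\<bar>\<dots>\<bar> \<le> h * a"
      proof (rule S.T_contraction[OF S.M_diff[OF M' M]])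
        show "\<bar>?T h ?f x - ?f x\<bar> \<le> h * a" for x
          by (rule S.first_order[OF f _ h(1)]) (unfold limit_generator_Log[OF test_smooth[OF F]], rule a)
      qed simp
      also have "h * a \<le> \<epsilon> * a" using h e2 a by (intro mult_right_mono) auto
      finally show ?thesis by (simp add: mult.commute)
    qed
    \<comment> \<open>Returning from the average to a single vertex happens once, so the oscillation
      \<open>\<epsilon>\<^sup>2\<close> is harmless here.\<close>
    have "\<bar>walk.iter \<epsilon> N (\<lambda>_. F) A (Log G x) - ?M N x\<bar> \<le> C3 * \<epsilon>\<^sup>2"
      using C3(2)[OF ad[OF order_refl] A, of "[]" "Log G x"] by simp
    also have "\<dots> \<le> C3 * \<epsilon>" using e2 C3 by (intro mult_left_mono)
    finally show "\<bar>?T t ?f x - walk.iter \<epsilon> N (\<lambda>_. F) A (Log G x)\<bar> \<le> (t * (C1 + C2) + C3 + a) * \<epsilon>"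
      using 1 2 unfolding distrib_right[of _ _ \<epsilon>] by linarith
  qed
qed

text \<open>The group element between the two realizations is bounded, and the dilation shrinks it
  to size \<epsilon>.\<close>

lemma scaled_realization:
  assumes "equivariant_realization G \<Gamma> X \<phi> \<Phi>"
  shows "\<exists>D\<ge>0. \<forall>\<epsilon> x. 0 < \<epsilon> \<longrightarrow> \<epsilon> \<le> 1 \<longrightarrow> x \<in> verts X \<longrightarrow> 
    (\<exists>v. dil \<epsilon> (Log G (\<Phi> x)) = lmul (dil \<epsilon> (Log G (\<Phi>\<^sub>0 x))) v \<and> norm v \<le> D * \<epsilon>)"
proof -
  obtain D where D: "0 \<le> D" "\<And>x. x \<in> verts X \<Longrightarrow> layer_norm (Log G (inv (\<Phi>\<^sub>0 x) \<otimes> \<Phi> x)) \<le> D"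
    using realization_distance[OF assms] by blast
  show ?thesis
  proof (intro exI[of _ D] conjI allI impI D(1))
    fix \<epsilon> :: real and x assume \<epsilon>: "0 < \<epsilon>" "\<epsilon> \<le> 1" and x: "x \<in> verts X"
    let ?v = "Log G (inv (\<Phi>\<^sub>0 x) \<otimes> \<Phi> x)"
    have "\<Phi> x = \<Phi>\<^sub>0 x \<otimes> (inv (\<Phi>\<^sub>0 x) \<otimes> \<Phi> x)" by (simp add: carrier_UNIV m_assoc[symmetric])
    then have "Log G (\<Phi> x) = lmul (Log G (\<Phi>\<^sub>0 x)) ?v" by (metis Log_mult)
    moreover have "norm (dil \<epsilon> ?v) \<le> D * \<epsilon>"
      unfolding mult.commute[of D] by (rule order_trans[OF norm_dil mult_left_mono[OF D(2)[OF x]]]) (use \<epsilon> in auto)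
    ultimately show "\<exists>v. dil \<epsilon> (Log G (\<Phi> x)) = lmul (dil \<epsilon> (Log G (\<Phi>\<^sub>0 x))) v \<and> norm v \<le> D * \<epsilon>"
      by (intro exI[of _ "dil \<epsilon> ?v"]) (simp add: dil_lmul)
  qed
qed

text \<open>The walk is analysed through \<open>\<Phi>\<^sub>0\<close>, whereas the heat semigroup
  is evaluated at the point given by \<open>\<Phi>\<close>. The exchange is made twice, in the
  function to be iterated and in the position of the final iterate, each time at cost
  \<open>K * D * \<epsilon>\<close>.\<close>

lemma transition_operator_approximation:
  assumes conv: "convolution_semigroup G \<nu>" 
    and gen: "has_generator G \<nu> (limit_generator G \<Gamma> r g \<aa> X \<phi> \<psi> p m \<Phi>\<^sub>0)"
    and \<Phi>: "equivariant_realization G \<Gamma> X \<phi> \<Phi>" and f: "f \<in> test_functions G" and t: "0 < t"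
  shows "\<exists>C\<ge>0. \<forall>\<epsilon> N. \<forall>x\<in>verts X. 0 < \<epsilon> \<longrightarrow> \<epsilon> \<le> 1 \<longrightarrow> \<epsilon>\<^sup>2 * real N \<le> t \<longrightarrow> t \<le> \<epsilon>\<^sup>2 * real (Suc N) \<longrightarrow> 
     \<bar>(transition_operator X p ^^ N) (scaling_operator G r g \<Phi> \<epsilon> f) x 
       - scaling_operator G r g \<Phi> \<epsilon> (heat_semigroup G \<nu> t f) x\<bar> \<le> C * \<epsilon>"
proof -
  define F where "F a = f (Exp G a)" for a
  have fF: "f = (\<lambda>x. F (Log G x))" by (simp add: F_def)
  have F: "test F" using f unfolding fF test_functions_Log .
  obtain C where C: "0 \<le> C" "\<And>\<epsilon> N x A. 0 < \<epsilon> \<Longrightarrow> \<epsilon> \<le> 1 \<Longrightarrow> \<epsilon>\<^sup>2 * real N \<le> t \<Longrightarrow> t \<le> \<epsilon>\<^sup>2 * real (Suc N) \<Longrightarrow> A \<in> verts quotient \<Longrightarrow>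
     \<bar>heat_semigroup G \<nu> t f x - walk.iter \<epsilon> N (\<lambda>_. F) A (Log G x)\<bar> \<le> C * \<epsilon>"
    using heat_approximation[OF conv gen F t] unfolding fF[symmetric] by blast
  obtain D where D: "0 \<le> D" "\<And>\<epsilon> x. 0 < \<epsilon> \<Longrightarrow> \<epsilon> \<le> 1 \<Longrightarrow> x \<in> verts X \<Longrightarrow> 
    \<exists>v. dil \<epsilon> (Log G (\<Phi> x)) = lmul (dil \<epsilon> (Log G (\<Phi>\<^sub>0 x))) v \<and> norm v \<le> D * \<epsilon>"
    using scaled_realization[OF \<Phi>] by blast
  obtain K where K: "0 \<le> K" "\<And>\<epsilon> k A u v. 0 < \<epsilon> \<and> \<epsilon> \<le> 1 \<and> \<epsilon>\<^sup>2 * real k \<le> t \<Longrightarrow> A \<in> verts quotient \<Longrightarrow> norm v \<le> D \<Longrightarrow> 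
     \<bar>walk.iter \<epsilon> k (\<lambda>_. F) A (lmul u v) - walk.iter \<epsilon> k (\<lambda>_. F) A u\<bar> \<le> K * norm v"
    using walk.it_lipschitz[OF F, of t D] by blast
  have lip: "\<bar>walk.iter \<epsilon> k (\<lambda>_. F) A (dil \<epsilon> (Log G (\<Phi> x))) - walk.iter \<epsilon> k (\<lambda>_. F) A (dil \<epsilon> (Log G (\<Phi>\<^sub>0 x)))\<bar> \<le> K * D * \<epsilon>"
    if \<epsilon>: "0 < \<epsilon>" "\<epsilon> \<le> 1" and k: "\<epsilon>\<^sup>2 * real k \<le> t" and A: "A \<in> verts quotient" and x: "x \<in> verts X" for \<epsilon> k A x
  proof -
    obtain v where v: "dil \<epsilon> (Log G (\<Phi> x)) = lmul (dil \<epsilon> (Log G (\<Phi>\<^sub>0 x))) v" "norm v \<le> D * \<epsilon>"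
      using D(2)[OF \<epsilon> x] by blast
    have "D * \<epsilon> \<le> D" using D(1) \<epsilon> by (simp add: mult_left_le)
    then have "\<bar>walk.iter \<epsilon> k (\<lambda>_. F) A (dil \<epsilon> (Log G (\<Phi> x))) - walk.iter \<epsilon> k (\<lambda>_. F) A (dil \<epsilon> (Log G (\<Phi>\<^sub>0 x)))\<bar> \<le> K * norm v"
      unfolding v(1) using \<epsilon> k A v(2) by (intro K(2)) auto
    also have "\<dots> \<le> K * (D * \<epsilon>)" using v K by (intro mult_left_mono)
    finally show ?thesis by simp
  qed
  show ?thesis
  proof (intro exI[of _ "K * D + K * D + C"] conjI allI ballI impI)
    show "0 \<le> K * D + K * D + C" using K C D by simp
    fix \<epsilon> N x assume x: "x \<in> verts X" and \<epsilon>: "0 < \<epsilon>" "\<epsilon> \<le> 1" 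
      and N: "\<epsilon>\<^sup>2 * real N \<le> t" "t \<le> \<epsilon>\<^sup>2 * real (Suc N)"
    let ?L = "transition_operator X p ^^ N"
    have vo: "vo y \<in> verts quotient" if "y \<in> verts X" for y using that by (simp add: verts_quotient)
    have "\<bar>?L (scaling_operator G r g \<Phi> \<epsilon> f) x - ?L (scaling_operator G r g \<Phi>\<^sub>0 \<epsilon> f) x\<bar> \<le> K * D * \<epsilon>"
    proof (rule transition_operator_contraction[OF _ x])
      fix y assume y: "y \<in> verts X"
      show "\<bar>scaling_operator G r g \<Phi> \<epsilon> f y - scaling_operator G r g \<Phi>\<^sub>0 \<epsilon> f y\<bar> \<le> K * D * \<epsilon>"
        \<comment> \<open>With 0 steps the iterate is \<open>F\<close>, so the general Lipschitz
          bound contains that of the test function.\<close>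
        using lip[OF \<epsilon> _ vo[OF y] y, of 0] t by (simp add: scaling_operator_def dilation_Log fF)
    qed
    moreover have "?L (scaling_operator G r g \<Phi>\<^sub>0 \<epsilon> f) x = walk.iter \<epsilon> N (\<lambda>_. F) (vo x) (dil \<epsilon> (Log G (\<Phi>\<^sub>0 x)))"
      unfolding fF by (rule iterate_transition_operator[OF x])
    moreover have "\<bar>scaling_operator G r g \<Phi> \<epsilon> (heat_semigroup G \<nu> t f) x - walk.iter \<epsilon> N (\<lambda>_. F) (vo x) (dil \<epsilon> (Log G (\<Phi> x)))\<bar> \<le> C * \<epsilon>"
      using C(2)[OF \<epsilon> N vo[OF x], of "Exp G (dil \<epsilon> (Log G (\<Phi> x)))"] by (simp add: scaling_operator_def dilation_Log)
    ultimately show "\<bar>?L (scaling_operator G r g \<Phi> \<epsilon> f) x - scaling_operator G r g \<Phi> \<epsilon> (heat_semigroup G \<nu> t f) x\<bar> 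
        \<le> (K * D + K * D + C) * \<epsilon>"
      using lip[OF \<epsilon> N(1) vo[OF x] x] unfolding distrib_right[of _ _ \<epsilon>] by linarith
  qed
qed

end

theorem theorem7p5:
  fixes G :: "('g::{t2_space,second_countable_topology}, 'a::euclidean_space) lie_data"
    and \<Gamma> :: "'g set" and r :: nat and g :: "nat \<Rightarrow> 'a set" and \<aa> :: "nat \<Rightarrow> 'a"
    and X :: "('v, 'e) pre_digraph" and rv :: "'e \<Rightarrow> 'e"
    and \<phi> :: "'g \<Rightarrow> 'v \<Rightarrow> 'v" and \<psi> :: "'g \<Rightarrow> 'e \<Rightarrow> 'e"
    and p :: "'e \<Rightarrow> real" and m :: "'v set \<Rightarrow> real" and \<rho> :: "('e set \<Rightarrow> real) \<Rightarrow> 'a"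
    and \<Phi>\<^sub>0 \<Phi> :: "'v \<Rightarrow> 'g"
    and x0 :: 'v and M :: "'w measure" and w :: "nat \<Rightarrow> 'w \<Rightarrow> 'v"
    and \<nu> :: "real \<Rightarrow> 'g measure" and t :: real and f :: "'g \<Rightarrow> real"
  assumes "nilpotent_covering_graph G \<Gamma> X rv \<phi> \<psi>"
    and "invariant_transition_probability X rv (G\<lparr>carrier := \<Gamma>\<rparr>) \<phi> \<psi> p"
    and "irreducible_walk (quotient_graph X (G\<lparr>carrier := \<Gamma>\<rparr>) \<phi> \<psi>) (p \<circ> lift)"
    and "invariant_measure (quotient_graph X (G\<lparr>carrier := \<Gamma>\<rparr>) \<phi> \<psi>) ((`) rv) (p \<circ> lift) m"
    and A1: "stratification G r g"
    and "adapted_basis r g \<aa>"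
    and "induced_homology_map G \<Gamma> r g X rv \<phi> \<psi> \<rho>"
    and "modified_harmonic G \<Gamma> r g X rv \<phi> \<psi> p m \<rho> \<Phi>\<^sub>0"
    and "random_walk X p x0 M w"
    and A2: "AE \<omega> in M. (\<lambda>n. (1 / real n) *\<^sub>R layer_component r g 1 (Log G (\<Phi>\<^sub>0 (w n \<omega>)))) \<longlonglongrightarrow> 0"
    and "convolution_semigroup G \<nu>"
    and "has_generator G \<nu> (limit_generator G \<Gamma> r g \<aa> X \<phi> \<psi> p m \<Phi>\<^sub>0)"
    and "equivariant_realization G \<Gamma> X \<phi> \<Phi>"
    and "t > 0"
    and "f \<in> test_functions G"
  shows "\<exists>C>0. \<forall>n\<ge>1.
    sup_norm (verts X) (\<lambda>x.
        (transition_operator X p ^^ nat \<lfloor>real n * t\<rfloor>)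
          (scaling_operator G r g \<Phi> (real n powr (- 1 / 2)) f) x
        - scaling_operator G r g \<Phi> (real n powr (- 1 / 2)) (heat_semigroup G \<nu> t f) x)
      \<le> ereal (C / real n powr (1 / 2))"
proof -
  interpret NC: nilpotent_covering_graph G \<Gamma> X rv \<phi> \<psi> by fact
  interpret TP: invariant_transition_probability X rv "G\<lparr>carrier := \<Gamma>\<rparr>" \<phi> \<psi> p by fact
  have equi: "equivariant_realization G \<Gamma> X \<phi> \<Phi>\<^sub>0"
    using \<open>modified_harmonic G \<Gamma> r g X rv \<phi> \<psi> p m \<rho> \<Phi>\<^sub>0\<close> by (simp add: modified_harmonic_def)
  interpret CW: covering_walk G r g \<aa> \<Gamma> X rv \<phi> \<psi> p \<Phi>\<^sub>0
    by unfold_locales (fact A1, fact \<open>adapted_basis r g \<aa>\<close>, fact equi)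
  interpret CC: centered_covering_walk G r g \<aa> \<Gamma> X rv \<phi> \<psi> p \<Phi>\<^sub>0 m
  proof
    show "(\<Sum>e\<in>out_arcs X x. p e *\<^sub>R layer_component r g 1 (Log G (edge_increment G X \<Phi>\<^sub>0 e))) = 0"
      if "x \<in> verts X" for x
      using CW.modified_harmonic_centered[OF \<open>modified_harmonic G \<Gamma> r g X rv \<phi> \<psi> p m \<rho> \<Phi>\<^sub>0\<close> \<open>random_walk X p x0 M w\<close> A2 that]
      by (simp only: CW.incr_def)
  qed fact+
  obtain C where C: "0 \<le> C" "\<And>\<epsilon> N x. x \<in> verts X \<Longrightarrow> 0 < \<epsilon> \<Longrightarrow> \<epsilon> \<le> 1 \<Longrightarrow> \<epsilon>\<^sup>2 * real N \<le> t \<Longrightarrow> t \<le> \<epsilon>\<^sup>2 * real (Suc N) \<Longrightarrow> 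
     \<bar>(transition_operator X p ^^ N) (scaling_operator G r g \<Phi> \<epsilon> f) x 
       - scaling_operator G r g \<Phi> \<epsilon> (heat_semigroup G \<nu> t f) x\<bar> \<le> C * \<epsilon>"
    using CC.transition_operator_approximation[OF \<open>convolution_semigroup G \<nu>\<close> 
        \<open>has_generator G \<nu> _\<close> \<open>equivariant_realization G \<Gamma> X \<phi> \<Phi>\<close> \<open>f \<in> test_functions G\<close> \<open>0 < t\<close>] by blast
  show ?thesis
  proof (intro exI[of _ "C + 1"] conjI allI impI)
    show "0 < C + 1" using C by simp
    fix n :: nat assume n: "1 \<le> n"
    define \<epsilon> where "\<epsilon> = real n powr (- 1 / 2)"
    define N where "N = nat \<lfloor>real n * t\<rfloor>"
    have n0: "0 < real n" using n by simp
    have \<epsilon>: "0 < \<epsilon>" "\<epsilon> \<le> 1" using n powr_mono[of "- 1 / 2" 0 "real n"] by (auto simp: \<epsilon>_def)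
    have \<epsilon>2: "\<epsilon>\<^sup>2 = 1 / real n"
      using n by (simp add: \<epsilon>_def powr_powr[symmetric] power2_eq_square powr_add[symmetric] powr_minus_divide)
    \<comment> \<open>The integer part loses less than one step, which is the time defect
      \<open>\<epsilon>\<^sup>2\<close> tolerated in \<open>heat_approximation\<close>.\<close>
    have "real N \<le> real n * t" "real n * t \<le> real N + 1"
      using \<open>0 < t\<close> n0 unfolding N_def by (simp_all add: of_nat_nat)
    then have N: "\<epsilon>\<^sup>2 * real N \<le> t" "t \<le> \<epsilon>\<^sup>2 * real (Suc N)"
      using n0 by (simp_all add: \<epsilon>2 field_simps)
    have \<epsilon>': "\<epsilon> = 1 / real n powr (1 / 2)" unfolding \<epsilon>_def by (simp add: powr_minus_divide)
    show "sup_norm (verts X) (\<lambda>x. (transition_operator X p ^^ nat \<lfloor>real n * t\<rfloor>)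
          (scaling_operator G r g \<Phi> (real n powr (- 1 / 2)) f) x
        - scaling_operator G r g \<Phi> (real n powr (- 1 / 2)) (heat_semigroup G \<nu> t f) x)
      \<le> ereal ((C + 1) / real n powr (1 / 2))"
      unfolding sup_norm_def N_def[symmetric] \<epsilon>_def[symmetric]
    proof (rule SUP_least)
      fix x assume "x \<in> verts X"
      from C(2)[OF this \<epsilon> N] have "\<bar>(transition_operator X p ^^ N) (scaling_operator G r g \<Phi> \<epsilon> f) x 
          - scaling_operator G r g \<Phi> \<epsilon> (heat_semigroup G \<nu> t f) x\<bar> \<le> C * \<epsilon>" .
      also have "\<dots> \<le> (C + 1) * \<epsilon>" using \<epsilon> by simp
      also have "\<dots> = (C + 1) / real n powr (1 / 2)" by (simp add: \<epsilon>')
      finally show "ereal \<bar>(transition_operator X p ^^ N) (scaling_operator G r g \<Phi> \<epsilon> f) x 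
          - scaling_operator G r g \<Phi> \<epsilon> (heat_semigroup G \<nu> t f) x\<bar> \<le> ereal ((C + 1) / real n powr (1 / 2))"
        by simp
    qed
  qed
qed

end
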